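(* The localization problem for tight closure has a negative answer: there exist a Noetherian domain $A$ of prime characteristic $p>0$, an ideal $I$ of $A$, and a multiplicatively closed subset $S\subset A$ with $0\notin S$, such that $(S^{-1}I)^{*}\neq S^{-1}(I^{*})$ as ideals of $S^{-1}A$.
   Context: For a Noetherian domain $A$ of characteristic $p>0$, an ideal $I$ of $A$ and a power $q$ of $p$, $I^{[q]}$ denotes the ideal generated by all $v^{q}$ with $v\in I$. An element $u\in A$ is in the tight closure $I^{*}$ of $I$ if there is some $d\neq 0$ in $A$ such that $du^{q}\in I^{[q]}$ for all powers $q$ of $p$. The tight closure $(S^{-1}I)^{*}$ is taken in the ring $S^{-1}A$, and $S^{-1}(I^{*})$ is the extension of $I^{*}$ to $S^{-1}A$. The localization problem asks whether $(S^{-1}I)^{*}=S^{-1}(I^{*})$ always holds. *)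

theory Defs
  imports "HOL-Algebra.Ring_Divisibility" "HOL-Computational_Algebra.Primes"
begin

section \<open>Characteristic\<close>

text \<open>The order of the unit in the additive group; it is 0 when the unit has infinite order.\<close>

definition ring_char :: "('a, 'm) ring_scheme \<Rightarrow> nat" where
  "ring_char R = group.ord (add_monoid R) \<one>\<^bsub>R\<^esub>"

lemma (in ring) ring_char_dvd_iff: "[n] \<cdot> \<one> = \<zero> \<longleftrightarrow> ring_char R dvd n" for n :: nat
  using group.pow_eq_id[OF add.is_group, of \<one> n] by (simp add: ring_char_def add_pow_def)

section \<open>Rings of fractions\<close>

text \<open>The ring of fractions of \<open>A\<close> at a submonoid \<open>S\<close> of the multiplicative monoid of \<open>A\<close>.
  Its elements are the classes of pairs \<open>(a, s)\<close>, read as \<open>a / s\<close>, under the usual equivalence.\<close>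

definition frac_rel :: "('a, 'm) ring_scheme \<Rightarrow> 'a set \<Rightarrow> (('a \<times> 'a) \<times> ('a \<times> 'a)) set" where
  "frac_rel A S = {((a, s), (b, t)). a \<in> carrier A \<and> s \<in> S \<and> b \<in> carrier A \<and> t \<in> S \<and>
     (\<exists>u\<in>S. u \<otimes>\<^bsub>A\<^esub> (a \<otimes>\<^bsub>A\<^esub> t) = u \<otimes>\<^bsub>A\<^esub> (b \<otimes>\<^bsub>A\<^esub> s))}"

definition fraction :: "('a, 'm) ring_scheme \<Rightarrow> 'a set \<Rightarrow> 'a \<Rightarrow> 'a \<Rightarrow> ('a \<times> 'a) set" where
  "fraction A S a s = frac_rel A S `` {(a, s)}"

text \<open>The operations are defined as unions over all representatives;
  \<open>fraction_mult\<close> and \<open>fraction_add\<close> below show that they do not depend on the representatives.\<close>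

definition localization :: "('a, 'm) ring_scheme \<Rightarrow> 'a set \<Rightarrow> ('a \<times> 'a) set ring" where
  "localization A S =
    \<lparr>carrier = (carrier A \<times> S) // frac_rel A S,
     mult = (\<lambda>P Q. \<Union>(a, s)\<in>P. \<Union>(b, t)\<in>Q. fraction A S (a \<otimes>\<^bsub>A\<^esub> b) (s \<otimes>\<^bsub>A\<^esub> t)),
     one = fraction A S \<one>\<^bsub>A\<^esub> \<one>\<^bsub>A\<^esub>,
     zero = fraction A S \<zero>\<^bsub>A\<^esub> \<one>\<^bsub>A\<^esub>,
     add = (\<lambda>P Q. \<Union>(a, s)\<in>P. \<Union>(b, t)\<in>Q.
              fraction A S (a \<otimes>\<^bsub>A\<^esub> t \<oplus>\<^bsub>A\<^esub> b \<otimes>\<^bsub>A\<^esub> s) (s \<otimes>\<^bsub>A\<^esub> t))\<rparr>"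

definition extended_ideal :: "('a, 'm) ring_scheme \<Rightarrow> 'a set \<Rightarrow> 'a set \<Rightarrow> ('a \<times> 'a) set set" where
  "extended_ideal A S I = Idl\<^bsub>localization A S\<^esub> ((\<lambda>a. fraction A S a \<one>\<^bsub>A\<^esub>) ` I)"

context
  fixes A :: "('a, 'm) ring_scheme" (structure) and S :: "'a set"
  assumes cring: "cring A" and submonoid: "submonoid S A"
begin

interpretation cring A by (rule cring)
interpretation S: submonoid S A by (rule submonoid)

lemma frac_rel_iff: "((a, s), (b, t)) \<in> frac_rel A S \<longleftrightarrow>
    a \<in> carrier A \<and> s \<in> S \<and> b \<in> carrier A \<and> t \<in> S \<and> (\<exists>u\<in>S. u \<otimes> (a \<otimes> t) = u \<otimes> (b \<otimes> s))"
  by (simp add: frac_rel_def)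

lemma equiv_frac_rel: "equiv (carrier A \<times> S) (frac_rel A S)"
proof (rule equivI)
  show "frac_rel A S \<subseteq> (carrier A \<times> S) \<times> (carrier A \<times> S)"
    by (auto simp: frac_rel_def)
  show "refl_on (carrier A \<times> S) (frac_rel A S)"
    by (auto simp: refl_on_def frac_rel_def intro: S.one_closed)
  show "sym (frac_rel A S)"
    by (rule symI) (auto simp: frac_rel_def intro: sym)
  show "trans (frac_rel A S)"
  proof (rule transI, clarify)
    fix a s b t c r
    assume "((a, s), (b, t)) \<in> frac_rel A S" "((b, t), (c, r)) \<in> frac_rel A S"
    then obtain u v where *: "a \<in> carrier A" "s \<in> S" "b \<in> carrier A" "t \<in> S" "c \<in> carrier A" "r \<in> S"
      "u \<in> S" "v \<in> S" and u: "u \<otimes> (a \<otimes> t) = u \<otimes> (b \<otimes> s)" and v: "v \<otimes> (b \<otimes> r) = v \<otimes> (c \<otimes> t)"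
      by (auto simp: frac_rel_iff)
    have "(u \<otimes> v \<otimes> t) \<otimes> (a \<otimes> r) = (v \<otimes> r) \<otimes> (u \<otimes> (a \<otimes> t))"
      using * by (simp add: m_ac)
    also have "\<dots> = (u \<otimes> s) \<otimes> (v \<otimes> (b \<otimes> r))"
      unfolding u using * by (simp add: m_ac)
    also have "\<dots> = (u \<otimes> v \<otimes> t) \<otimes> (c \<otimes> s)"
      unfolding v using * by (simp add: m_ac)
    finally show "((a, s), (c, r)) \<in> frac_rel A S"
      using * by (auto simp: frac_rel_iff intro!: bexI[of _ "u \<otimes> v \<otimes> t"])
  qed
qed

lemma fraction_eq_iff:
  assumes "a \<in> carrier A" "s \<in> S" "b \<in> carrier A" "t \<in> S"
  shows "fraction A S a s = fraction A S b t \<longleftrightarrow> (\<exists>u\<in>S. u \<otimes> (a \<otimes> t) = u \<otimes> (b \<otimes> s))"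
  unfolding fraction_def using eq_equiv_class_iff[OF equiv_frac_rel, of "(a, s)" "(b, t)"] assms
  by (auto simp: frac_rel_iff)

lemma localization_carrier: "carrier (localization A S) = {fraction A S a s |a s. a \<in> carrier A \<and> s \<in> S}"
  by (auto simp: localization_def quotient_def fraction_def)

lemma UN_fraction:
  assumes "a \<in> carrier A" "s \<in> S"
    and "\<And>c r. c \<in> carrier A \<Longrightarrow> r \<in> S \<Longrightarrow> fraction A S c r = fraction A S a s \<Longrightarrow> f c r = f a s"
  shows "(\<Union>(c, r)\<in>fraction A S a s. f c r) = f a s"
proof -
  have 1: "(a, s) \<in> fraction A S a s"
    unfolding fraction_def using equiv_class_self[OF equiv_frac_rel] assms(1,2) by blast
  have 2: "f c r = f a s" if "(c, r) \<in> fraction A S a s" for c r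
  proof (rule assms(3))
    from that have rel: "((a, s), (c, r)) \<in> frac_rel A S" by (simp add: fraction_def)
    then show "c \<in> carrier A" "r \<in> S" by (auto simp: frac_rel_iff)
    show "fraction A S c r = fraction A S a s"
      unfolding fraction_def using equiv_class_eq[OF equiv_frac_rel rel] by simp
  qed
  show ?thesis using 1 2 by blast
qed

lemma fraction_mult:
  assumes "a \<in> carrier A" "s \<in> S" "b \<in> carrier A" "t \<in> S"
  shows "fraction A S a s \<otimes>\<^bsub>localization A S\<^esub> fraction A S b t = fraction A S (a \<otimes> b) (s \<otimes> t)"
proof -
  have *: "fraction A S (c \<otimes> d) (r \<otimes> q) = fraction A S (c' \<otimes> d') (r' \<otimes> q')"
    if C: "c \<in> carrier A" "r \<in> S" "d \<in> carrier A" "q \<in> S"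
      "c' \<in> carrier A" "r' \<in> S" "d' \<in> carrier A" "q' \<in> S"
      and eq: "fraction A S c r = fraction A S c' r'" "fraction A S d q = fraction A S d' q'"
    for c r d q c' r' d' q'
  proof -
    from eq C obtain u v where uv: "u \<in> S" "v \<in> S"
      and u: "u \<otimes> (c \<otimes> r') = u \<otimes> (c' \<otimes> r)" and v: "v \<otimes> (d \<otimes> q') = v \<otimes> (d' \<otimes> q)"
      by (auto simp: fraction_eq_iff)
    note C' = C uv
    have "(u \<otimes> v) \<otimes> ((c \<otimes> d) \<otimes> (r' \<otimes> q')) = (u \<otimes> (c \<otimes> r')) \<otimes> (v \<otimes> (d \<otimes> q'))"
      using C' by (simp add: m_ac)
    also have "\<dots> = (u \<otimes> v) \<otimes> ((c' \<otimes> d') \<otimes> (r \<otimes> q))"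
      unfolding u v using C' by (simp add: m_ac)
    finally show ?thesis
      using C' by (auto simp: fraction_eq_iff intro!: bexI[of _ "u \<otimes> v"])
  qed
  have inner: "(\<Union>(d, q)\<in>fraction A S b t. fraction A S (c \<otimes> d) (r \<otimes> q)) = fraction A S (c \<otimes> b) (r \<otimes> t)"
    if "c \<in> carrier A" "r \<in> S" for c r
    using assms that by (intro UN_fraction * refl) auto
  have outer: "(\<Union>(c, r)\<in>fraction A S a s. \<Union>(d, q)\<in>fraction A S b t. fraction A S (c \<otimes> d) (r \<otimes> q))
      = (\<Union>(d, q)\<in>fraction A S b t. fraction A S (a \<otimes> d) (s \<otimes> q))"
    using assms by (intro UN_fraction) (simp_all only: inner, intro *, simp_all)
  show ?thesis using outer inner[OF assms(1,2)] by (simp add: localization_def)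
qed

lemma fraction_add:
  assumes "a \<in> carrier A" "s \<in> S" "b \<in> carrier A" "t \<in> S"
  shows "fraction A S a s \<oplus>\<^bsub>localization A S\<^esub> fraction A S b t = fraction A S (a \<otimes> t \<oplus> b \<otimes> s) (s \<otimes> t)"
proof -
  have *: "fraction A S (c \<otimes> q \<oplus> d \<otimes> r) (r \<otimes> q) = fraction A S (c' \<otimes> q' \<oplus> d' \<otimes> r') (r' \<otimes> q')"
    if C: "c \<in> carrier A" "r \<in> S" "d \<in> carrier A" "q \<in> S"
      "c' \<in> carrier A" "r' \<in> S" "d' \<in> carrier A" "q' \<in> S"
      and eq: "fraction A S c r = fraction A S c' r'" "fraction A S d q = fraction A S d' q'"
    for c r d q c' r' d' q'
  proof -
    from eq C obtain u v where uv: "u \<in> S" "v \<in> S"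
      and u: "u \<otimes> (c \<otimes> r') = u \<otimes> (c' \<otimes> r)" and v: "v \<otimes> (d \<otimes> q') = v \<otimes> (d' \<otimes> q)"
      by (auto simp: fraction_eq_iff)
    note C' = C uv
    have "(u \<otimes> v) \<otimes> ((c \<otimes> q \<oplus> d \<otimes> r) \<otimes> (r' \<otimes> q'))
        = (v \<otimes> q \<otimes> q') \<otimes> (u \<otimes> (c \<otimes> r')) \<oplus> (u \<otimes> r \<otimes> r') \<otimes> (v \<otimes> (d \<otimes> q'))"
      using C' by (simp add: m_ac r_distr l_distr)
    also have "\<dots> = (u \<otimes> v) \<otimes> ((c' \<otimes> q' \<oplus> d' \<otimes> r') \<otimes> (r \<otimes> q))"
      unfolding u v using C' by (simp add: m_ac r_distr l_distr)
    finally show ?thesis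
      using C' by (auto simp: fraction_eq_iff intro!: bexI[of _ "u \<otimes> v"])
  qed
  have inner: "(\<Union>(d, q)\<in>fraction A S b t. fraction A S (c \<otimes> q \<oplus> d \<otimes> r) (r \<otimes> q))
      = fraction A S (c \<otimes> t \<oplus> b \<otimes> r) (r \<otimes> t)"
    if "c \<in> carrier A" "r \<in> S" for c r
    using assms that by (intro UN_fraction * refl) auto
  have outer: "(\<Union>(c, r)\<in>fraction A S a s. \<Union>(d, q)\<in>fraction A S b t. fraction A S (c \<otimes> q \<oplus> d \<otimes> r) (r \<otimes> q))
      = (\<Union>(d, q)\<in>fraction A S b t. fraction A S (a \<otimes> q \<oplus> d \<otimes> s) (s \<otimes> q))"
    using assms by (intro UN_fraction) (simp_all only: inner, intro *, simp_all)
  show ?thesis using outer inner[OF assms(1,2)] by (simp add: localization_def)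
qed

lemma localization_one: "\<one>\<^bsub>localization A S\<^esub> = fraction A S \<one> \<one>"
  and localization_zero: "\<zero>\<^bsub>localization A S\<^esub> = fraction A S \<zero> \<one>"
  by (simp_all add: localization_def)

lemma localization_cring: "cring (localization A S)"
proof -
  let ?L = "localization A S"
  note simps = localization_one localization_zero fraction_mult fraction_add
  note [simp] = S.one_closed
  have carrI: "fraction A S a s \<in> carrier ?L" if "a \<in> carrier A" "s \<in> S" for a s
    using that by (auto simp: localization_carrier)
  have carrE: "\<exists>a s. a \<in> carrier A \<and> s \<in> S \<and> x = fraction A S a s" if "x \<in> carrier ?L" for x
    using that by (auto simp: localization_carrier)
  have monoid: "comm_monoid ?L"
  proof (rule comm_monoidI)
    show "\<one>\<^bsub>?L\<^esub> \<in> carrier ?L" by (simp add: simps carrI)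
  next
    fix x assume "x \<in> carrier ?L"
    then show "\<one>\<^bsub>?L\<^esub> \<otimes>\<^bsub>?L\<^esub> x = x" by (auto dest!: carrE simp: simps)
  next
    fix x y assume "x \<in> carrier ?L" "y \<in> carrier ?L"
    then show "x \<otimes>\<^bsub>?L\<^esub> y \<in> carrier ?L" "x \<otimes>\<^bsub>?L\<^esub> y = y \<otimes>\<^bsub>?L\<^esub> x"
      by (auto dest!: carrE simp: simps m_comm intro!: carrI)
  next
    fix x y z assume "x \<in> carrier ?L" "y \<in> carrier ?L" "z \<in> carrier ?L"
    then show "x \<otimes>\<^bsub>?L\<^esub> y \<otimes>\<^bsub>?L\<^esub> z = x \<otimes>\<^bsub>?L\<^esub> (y \<otimes>\<^bsub>?L\<^esub> z)"
      by (auto dest!: carrE simp: simps m_assoc)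
  qed
  have group: "abelian_group ?L"
  proof (rule abelian_groupI)
    show "\<zero>\<^bsub>?L\<^esub> \<in> carrier ?L" by (simp add: simps carrI)
  next
    fix x assume "x \<in> carrier ?L"
    then obtain a s where x: "a \<in> carrier A" "s \<in> S" "x = fraction A S a s"
      using carrE by blast
    then show "\<zero>\<^bsub>?L\<^esub> \<oplus>\<^bsub>?L\<^esub> x = x" by (simp add: simps)
    have "(\<ominus> a) \<otimes> s \<oplus> a \<otimes> s = \<zero>"
      using x by (simp flip: l_distr add: l_neg)
    then have "fraction A S (\<ominus> a) s \<oplus>\<^bsub>?L\<^esub> x = \<zero>\<^bsub>?L\<^esub>"
      using x by (auto simp: simps fraction_eq_iff)
    then show "\<exists>y\<in>carrier ?L. y \<oplus>\<^bsub>?L\<^esub> x = \<zero>\<^bsub>?L\<^esub>"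
      using x by (intro bexI[of _ "fraction A S (\<ominus> a) s"] carrI) simp_all
  next
    fix x y assume "x \<in> carrier ?L" "y \<in> carrier ?L"
    then show "x \<oplus>\<^bsub>?L\<^esub> y \<in> carrier ?L" "x \<oplus>\<^bsub>?L\<^esub> y = y \<oplus>\<^bsub>?L\<^esub> x"
      by (auto dest!: carrE simp: simps m_comm a_comm intro!: carrI)
  next
    fix x y z assume "x \<in> carrier ?L" "y \<in> carrier ?L" "z \<in> carrier ?L"
    then show "x \<oplus>\<^bsub>?L\<^esub> y \<oplus>\<^bsub>?L\<^esub> z = x \<oplus>\<^bsub>?L\<^esub> (y \<oplus>\<^bsub>?L\<^esub> z)"
      by (auto dest!: carrE simp: simps l_distr r_distr m_ac a_assoc)
  qed
  show ?thesis
  proof (rule cringI[OF group monoid])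
    fix x y z assume "x \<in> carrier ?L" "y \<in> carrier ?L" "z \<in> carrier ?L"
    then obtain a s b t c r where x: "a \<in> carrier A" "s \<in> S" "b \<in> carrier A" "t \<in> S"
      "c \<in> carrier A" "r \<in> S" "x = fraction A S a s" "y = fraction A S b t" "z = fraction A S c r"
      using carrE by metis
    have "\<one> \<otimes> ((a \<otimes> t \<oplus> b \<otimes> s) \<otimes> c \<otimes> (s \<otimes> r \<otimes> (t \<otimes> r))) =
        \<one> \<otimes> ((a \<otimes> c \<otimes> (t \<otimes> r) \<oplus> b \<otimes> c \<otimes> (s \<otimes> r)) \<otimes> (s \<otimes> t \<otimes> r))"
      using x by (simp add: l_distr r_distr m_ac)
    then show "(x \<oplus>\<^bsub>?L\<^esub> y) \<otimes>\<^bsub>?L\<^esub> z = x \<otimes>\<^bsub>?L\<^esub> z \<oplus>\<^bsub>?L\<^esub> y \<otimes>\<^bsub>?L\<^esub> z"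
      using x by (subst x(7-9))+ (auto simp: simps fraction_eq_iff simp del: l_one intro!: bexI[of _ \<one>])
  qed
qed

lemma fraction_hom: "(\<lambda>a. fraction A S a \<one>) \<in> ring_hom A (localization A S)"
proof (rule ring_hom_memI)
  show "fraction A S a \<one> \<in> carrier (localization A S)" if "a \<in> carrier A" for a
    using that S.one_closed unfolding localization_carrier by blast
qed (use S.one_closed in \<open>simp_all add: localization_one fraction_add fraction_mult\<close>)

end

section \<open>Tight closure\<close>

definition frobenius_power :: "('a, 'm) ring_scheme \<Rightarrow> 'a set \<Rightarrow> nat \<Rightarrow> 'a set" where
  "frobenius_power A I q = Idl\<^bsub>A\<^esub> {v [^]\<^bsub>A\<^esub> q |v. v \<in> I}"

text \<open>Meant for Noetherian domains of prime characteristic; the exponents are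
  \<open>q = 1, p, p\<^sup>2, \<dots>\<close> with \<open>p = ring_char A\<close>.\<close>

definition tight_closure :: "('a, 'm) ring_scheme \<Rightarrow> 'a set \<Rightarrow> 'a set" where
  "tight_closure A I = {u \<in> carrier A. \<exists>d \<in> carrier A - {\<zero>\<^bsub>A\<^esub>}. \<forall>e::nat.
     d \<otimes>\<^bsub>A\<^esub> u [^]\<^bsub>A\<^esub> (ring_char A ^ e) \<in> frobenius_power A I (ring_char A ^ e)}"

end

theory Submission
  imports Defs "HOL-Algebra.Algebraic_Closure_Type" "HOL-Library.Z2" "HOL-Library.Countable"
    "HOL-Computational_Algebra.Polynomial_Factorial"
begin

text \<open>
  The counterexample is the family of plane quartics of Brenner and Monsky.  Put
  \<open>D = x y\<close>, \<open>E = x^3 + y^3\<close>, \<open>g = z^4 + D z^2 + E z + t D^2\<close> over the field with two elements, and let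
  \<open>A = F_2[t][x, y][z] / (g)\<close>, \<open>I = (x^4, y^4, z^4)\<close>, \<open>u = x^3 y^2 z\<close> and \<open>S = F_2[t] - {0}\<close>.  Then \<open>u / 1\<close> lies in
  the tight closure of \<open>S^-1 I\<close>, but no multiple \<open>s u\<close> with \<open>s\<close> in \<open>S\<close> lies in the tight closure of \<open>I\<close>.

  Up to its constant term, \<open>g\<close> is an additive polynomial in \<open>z\<close>.  So for \<open>N = 2^n\<close> the power \<open>z^(2 N)\<close>
  is congruent modulo \<open>g\<close> to a quadratic polynomial \<open>a z^2 + b z + c\<close>, where only \<open>c\<close> involves \<open>t\<close>.  The
  products \<open>E a\<close> and \<open>E b\<close> lie in \<open>J = (x^(2 N), y^(2 N))\<close> (\<open>E_quadc\<close>, \<open>EE_linc_in_xy_ideal\<close>).  Up to the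
  factor \<open>E\<close>, questions about \<open>z^(2 N)\<close> thereby become questions about the form \<open>c\<close> of degree \<open>2 N\<close>
  in two variables.

  Generic \<open>t\<close>.  The leading term of \<open>c\<close> in \<open>t\<close> is \<open>t^(N/2) D^N\<close> (\<open>genconst_leading\<close>), and every form in \<open>x\<close>, \<open>y\<close>
  of degree at least \<open>3 N + 2\<close> lies in \<open>(x^(2 N), y^(2 N), D^N E)\<close> (\<open>homog_decomp\<close>).  Hence modulo
  \<open>(x^(2 N), y^(2 N), E c)\<close> all multiples \<open>t^k p\<close> of such a form \<open>p\<close> reduce to finitely many
  polynomials in \<open>t\<close>; two of them agree, so some \<open>t^i + t^j\<close> with \<open>i < j\<close> carries \<open>p\<close> into this ideal
  (\<open>pigeonhole_multiplier\<close>).  Applied to the coefficients of \<open>x E u^q\<close>, this puts \<open>x E u^q\<close> into the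
  ideal generated by \<open>x^(4 q)\<close>, \<open>y^(4 q)\<close>, \<open>z^(4 q)\<close> after inverting \<open>S\<close>, for every \<open>q\<close> (\<open>in_closure_generic\<close>).

  Special \<open>t\<close>.  Suppose \<open>d (s u)^q\<close> is in that ideal for all \<open>q\<close>, with \<open>d\<close> nonzero in \<open>A\<close> and \<open>s\<close> in \<open>S\<close>.  Then
  \<open>t\<close> can be specialised to some \<open>l^2 + l\<close> where \<open>d\<close> and \<open>s\<close> do not vanish and \<open>l\<close> has an odd period \<open>n \<ge> 3\<close>
  under Frobenius.  The coefficient of \<open>x^e y^(2 N - e)\<close> in \<open>c\<close> is then \<open>l + l^(2^min(n, v))\<close> with \<open>v\<close> the
  2-adic valuation of \<open>e\<close>, if \<open>e\<close> is congruent to \<open>N\<close> modulo 3, and zero otherwise (\<open>bcoeff_constc\<close>).  The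
  middle coefficient \<open>l + l^N\<close> vanishes.  So the linear system that expresses \<open>w c E \<in> J\<close>, for an unknown form
  \<open>w\<close> of degree \<open>N - 4\<close>, contains an alternating Toeplitz matrix of odd size; it has a solution \<open>w\<close>, whose
  middle coefficient is nonzero (\<open>dyadic_kernel\<close>, \<open>annihilator_exists\<close>).  Now \<open>r = E w\<close> satisfies
  \<open>r z^(2 N) \<in> J\<close>, which is one degree better than for generic \<open>t\<close>.  Multiplying by powers of \<open>r\<close> and \<open>E\<close>
  turns the assumption on \<open>d\<close> into \<open>d_i theta^p \<in> (x^(4 N p), y^(8 N p))\<close> for one fixed form \<open>theta\<close> and all
  powers \<open>p > 1\<close> of 2, with \<open>d_i\<close> a coefficient of \<open>d\<close>.  Flatness of Frobenius on \<open>k[x, y]\<close> removes \<open>d_i\<close>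
  (\<open>xy_ideal_frobenius_cancel\<close>), but \<open>theta\<close> is not in \<open>(x^(4 N), y^(8 N))\<close>: one of its coefficients is
  \<open>(l^2 + l) w_0^8\<close>, with \<open>w_0\<close> the middle coefficient of \<open>w\<close> (\<open>theta_not_xy_ideal\<close>).
\<close>

section \<open>Rings of characteristic two\<close>

class char2 = comm_ring_1 +
  assumes one_add_one_eq_0: "1 + 1 = 0"
begin

lemma two_eq_0 [simp]: "2 = 0"
  using one_add_one_eq_0 by (simp add: one_add_one)

lemma char2_add_self [simp]: "a + a = 0"
  by (metis one_add_one_eq_0 distrib_left mult_1_right mult_zero_right)

lemma char2_uminus [simp]: "- a = a"
  by (metis char2_add_self minus_unique)

lemma char2_diff [simp]: "a - b = a + b"
  by (metis diff_conv_add_uminus char2_uminus)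

lemma char2_add_left_self [simp]: "a + (a + b) = b"
  by (simp flip: add.assoc)

end

lemma char2_square_add: "(a + b) ^ 2 = a ^ 2 + b ^ 2" for a b :: "'a :: char2"
proof -
  have "(a + b) ^ 2 = a ^ 2 + b ^ 2 + (a * b + a * b)"
    by (simp add: power2_eq_square algebra_simps del: char2_add_self)
  then show ?thesis by simp
qed

lemma char2_power4_add: "(a + b) ^ 4 = a ^ 4 + b ^ 4" for a b :: "'a :: char2"
proof -
  have "v ^ 4 = (v ^ 2) ^ 2" for v :: 'a by (simp flip: power_mult)
  then show ?thesis by (simp only: char2_square_add)
qed

lemma power_2_Suc: "a ^ (2 ^ Suc n) = (a ^ (2 ^ n)) ^ 2" for a :: "'a :: monoid_mult"
  by (simp only: power_Suc2 power_mult)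

lemma char2_power_add: "(a + b) ^ (2 ^ k) = a ^ (2 ^ k) + b ^ (2 ^ k)" for a b :: "'a :: char2"
  by (induction k) (simp_all only: power_2_Suc char2_square_add power_0 power_one_right)

lemma char2_eq_iff: "a = b \<longleftrightarrow> a + b = (0 :: 'a :: char2)"
  by (metis char2_add_self char2_add_left_self add.right_neutral)

instance poly :: (char2) char2
  by standard (simp add: one_add_one_eq_0 flip: pCons_one)

instance bit :: char2
  by standard simp

instance alg_closure :: ("{field, char2}") char2
proof
  have "to_ac (1 + 1 :: 'a) = 0" unfolding one_add_one_eq_0 by simp
  then show "1 + 1 = (0 :: 'a alg_closure)" by (simp only: to_ac_add to_ac_1)
qed

lemma char2_power_sum:
  "(sum f I) ^ (2 ^ k) = (\<Sum>i\<in>I. f i ^ (2 ^ k) :: 'a :: char2)"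
  by (induction I rule: infinite_finite_induct) (simp_all add: char2_power_add zero_power)

section \<open>Powers of a root of the quartic\<close>

text \<open>The coefficients of \<open>z^(2^(n+1))\<close> modulo \<open>z^4 + D z^2 + E z + t D^2\<close>: squaring a quadratic polynomial in \<open>z\<close>
  in characteristic two produces only \<open>z^4\<close>, \<open>z^2\<close> and \<open>1\<close>, and \<open>z^4\<close> is again quadratic.  The quadratic
  coefficient is given by a recursion of its own, with the linear one eliminated.\<close>

fun quadc :: "'a :: comm_ring_1 \<Rightarrow> 'a \<Rightarrow> nat \<Rightarrow> 'a" where
  "quadc D E 0 = 1"
| "quadc D E (Suc 0) = D"
| "quadc D E (Suc (Suc n)) = D * quadc D E (Suc n) ^ 2 + E ^ 2 * quadc D E n ^ 4"

fun linc :: "'a :: comm_ring_1 \<Rightarrow> 'a \<Rightarrow> nat \<Rightarrow> 'a" where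
  "linc D E 0 = 0"
| "linc D E (Suc n) = E * quadc D E n ^ 2"

fun constc :: "'a :: comm_ring_1 \<Rightarrow> 'a \<Rightarrow> 'a \<Rightarrow> nat \<Rightarrow> 'a" where
  "constc D E t 0 = 0"
| "constc D E t (Suc n) = constc D E t n ^ 2 + t * (D * quadc D E n) ^ 2"

lemma quadc_Suc: "quadc D E (Suc n) = D * quadc D E n ^ 2 + linc D E n ^ 2"
  by (cases n) (simp_all add: power_mult_distrib flip: power_mult)

definition quartic :: "'a :: comm_ring_1 \<Rightarrow> 'a \<Rightarrow> 'a \<Rightarrow> 'a \<Rightarrow> 'a" where
  "quartic D E t z = z ^ 4 + D * z ^ 2 + E * z + t * D ^ 2"

lemma power_mod_quartic:
  fixes D E t z :: "'a :: char2"
  shows "quartic D E t z dvd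
    z ^ (2 ^ Suc n) + (quadc D E n * z ^ 2 + linc D E n * z + constc D E t n)"
proof (induction n)
  case (Suc n)
  let ?a = "quadc D E n" and ?b = "linc D E n" and ?c = "constc D E t n" and ?g = "quartic D E t z"
  let ?v = "z ^ (2 ^ Suc n) + (?a * z ^ 2 + ?b * z + ?c)"
  have sq: "?v ^ 2 = z ^ (2 ^ Suc (Suc n)) + (?a ^ 2 * z ^ 4 + ?b ^ 2 * z ^ 2 + ?c ^ 2)"
    unfolding power_2_Suc[of z "Suc n"] char2_square_add power_mult_distrib
    by (simp flip: power_mult)
  have "?g dvd ?v ^ 2 + ?a ^ 2 * ?g"
    using Suc by (simp add: power2_eq_square)
  also have "?v ^ 2 + ?a ^ 2 * ?g = z ^ (2 ^ Suc (Suc n)) +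
      (quadc D E (Suc n) * z ^ 2 + linc D E (Suc n) * z + constc D E t (Suc n))"
    unfolding sq quadc_Suc linc.simps constc.simps quartic_def
    by (simp add: algebra_simps power_mult_distrib)
  finally show ?case .
qed simp

text \<open>The quartic without constant term splits over the field with four elements, with roots the linear forms
  \<open>0\<close>, \<open>x + y\<close> and its conjugates; this makes \<open>quadc\<close> a quotient of Moore determinants.  The cleared
  form needs no roots: it follows by induction from the two-step recursion, cancelling \<open>E\<close> once.\<close>

lemma E_quadc:
  fixes x y :: "'a :: {idom, char2}"
  assumes "x ^ 3 + y ^ 3 \<noteq> 0"
  shows "(x ^ 3 + y ^ 3) * quadc (x * y) (x ^ 3 + y ^ 3) n =
    (if even n then x ^ (2 * 2 ^ n + 1) + y ^ (2 * 2 ^ n + 1)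
     else x * y ^ (2 * 2 ^ n) + x ^ (2 * 2 ^ n) * y)"
proof (induction n rule: induct_nat_012)
  case 0 then show ?case by (simp add: numeral_3_eq_3)
next
  case 1 then show ?case by (simp add: algebra_simps power_numeral_reduce)
next
  case (ge2 n)
  let ?E = "x ^ 3 + y ^ 3" and ?D = "x * y"
  define U V where "U = x ^ (2 * 2 ^ n)" and "V = y ^ (2 * 2 ^ n)"
  have p: "x ^ (2 * 2 ^ Suc n) = U ^ 2" "x ^ (2 * 2 ^ Suc (Suc n)) = U ^ 4"
    "y ^ (2 * 2 ^ Suc n) = V ^ 2" "y ^ (2 * 2 ^ Suc (Suc n)) = V ^ 4"
    by (simp_all add: U_def V_def ac_simps flip: power_mult)
  have p1: "x ^ (2 * 2 ^ n + 1) = U * x" "y ^ (2 * 2 ^ n + 1) = V * y"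
    "x ^ (2 * 2 ^ Suc n + 1) = U ^ 2 * x" "y ^ (2 * 2 ^ Suc n + 1) = V ^ 2 * y"
    "x ^ (2 * 2 ^ Suc (Suc n) + 1) = U ^ 4 * x" "y ^ (2 * 2 ^ Suc (Suc n) + 1) = V ^ 4 * y"
    unfolding power_add p power_one_right by (simp_all add: U_def V_def)
  let ?a0 = "quadc ?D ?E n" and ?a1 = "quadc ?D ?E (Suc n)" and ?a2 = "quadc ?D ?E (Suc (Suc n))"
  have rec: "?a2 = ?D * ?a1 ^ 2 + ?E ^ 2 * ?a0 ^ 4" by simp
  have "?E * (?E * ?a2) = ?D * (?E * ?a1) ^ 2 + (?E * ?a0) ^ 4"
    unfolding rec power_mult_distrib by (simp add: algebra_simps power_numeral_reduce)
  also have "\<dots> = ?E * (if even n then U ^ 4 * x + V ^ 4 * y else x * V ^ 4 + U ^ 4 * y)"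
  proof (cases "even n")
    case True
    then have e: "?E * ?a0 = U * x + V * y" "?E * ?a1 = x * V ^ 2 + U ^ 2 * y"
      using ge2 unfolding p p1 by (simp_all add: U_def V_def)
    show ?thesis unfolding e using True
      by (simp add: char2_square_add char2_power4_add) (simp add: algebra_simps power_mult_distrib power_numeral_reduce)
  next
    case False
    then have e: "?E * ?a1 = U ^ 2 * x + V ^ 2 * y" "?E * ?a0 = x * V + U * y"
      using ge2 unfolding p p1 by (simp_all add: U_def V_def)
    show ?thesis unfolding e using False
      by (simp add: char2_square_add char2_power4_add) (simp add: algebra_simps power_mult_distrib power_numeral_reduce)
  qed
  finally show ?case
    using assms unfolding p p1 by (simp add: mult_left_cancel del: quadc.simps)
qed

lemma quadc_ring_hom:
  fixes h :: "'a :: comm_ring_1 \<Rightarrow> 'b :: comm_ring_1"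
  assumes "\<And>a b. h (a + b) = h a + h b" "\<And>a b. h (a * b) = h a * h b" "h 1 = 1"
  shows "h (quadc D E n) = quadc (h D) (h E) n"
proof -
  have pw: "h (a ^ k) = h a ^ k" for a k by (induction k) (simp_all add: assms)
  show ?thesis by (induction n rule: induct_nat_012) (simp_all add: assms pw)
qed

section \<open>Forms in two variables and the ideals of two powers\<close>

text \<open>Polynomials in \<open>x\<close> and \<open>y\<close> are iterated univariate ones, with \<open>x\<close> the inner variable.\<close>

definition bcoeff :: "'k :: comm_ring_1 poly poly \<Rightarrow> nat \<Rightarrow> nat \<Rightarrow> 'k" where
  "bcoeff p i j = Polynomial.coeff (Polynomial.coeff p j) i"

definition vx :: "'k :: comm_ring_1 poly poly" where "vx = [:[:0, 1:]:]"
definition vy :: "'k :: comm_ring_1 poly poly" where "vy = [:0, 1:]"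

lemma bcoeff_eqI: "(\<And>i j. bcoeff p i j = bcoeff q i j) \<Longrightarrow> p = q"
  by (simp add: bcoeff_def poly_eq_iff)

lemma bcoeff_simps [simp]:
  "bcoeff 0 i j = 0" "bcoeff (p + q) i j = bcoeff p i j + bcoeff q i j" "bcoeff (sum f I) i j = (\<Sum>u\<in>I. bcoeff (f u) i j)"
  by (simp_all add: bcoeff_def coeff_sum)

lemma vx_power: "vx ^ a = [:Polynomial.monom 1 a:]"
  by (simp add: vx_def monom_altdef poly_const_pow)

lemma vy_power: "vy ^ b = Polynomial.monom 1 b"
  by (simp add: vy_def monom_altdef)

lemma bcoeff_vx_mult: "bcoeff (vx ^ a * p) i j = (if a \<le> i then bcoeff p (i - a) j else 0)"
  by (simp add: bcoeff_def vx_power coeff_monom_mult)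

lemma bcoeff_vy_mult: "bcoeff (vy ^ b * p) i j = (if b \<le> j then bcoeff p i (j - b) else 0)"
  by (simp add: bcoeff_def vy_power coeff_monom_mult)

lemma bcoeff_const: "bcoeff [:[:c:]:] i j = (if i = 0 \<and> j = 0 then c else 0)"
  by (cases i; cases j) (simp_all add: bcoeff_def)

lemma bcoeff_const_mult: "bcoeff ([:[:c:]:] * p) i j = c * bcoeff p i j"
  by (simp add: bcoeff_def)

lemma bcoeff_one: "bcoeff 1 i j = (if i = 0 \<and> j = 0 then 1 else 0)"
  unfolding one_pCons bcoeff_const ..

lemma bcoeff_monomial: "bcoeff (vx ^ a * vy ^ b :: 'a :: comm_ring_1 poly poly) i j = (if i = a \<and> j = b then 1 else 0)"
  unfolding bcoeff_vx_mult using bcoeff_vy_mult[of b "1 :: 'a poly poly"] by (auto simp: bcoeff_one)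

lemma bcoeff_mult:
  "bcoeff (p * q) i j = (\<Sum>j'\<le>j. \<Sum>i'\<le>i. bcoeff p i' j' * bcoeff q (i - i') (j - j'))"
  by (simp add: bcoeff_def Polynomial.coeff_mult coeff_sum)

definition xy_ideal :: "nat \<Rightarrow> nat \<Rightarrow> 'k :: comm_ring_1 poly poly set" where
  "xy_ideal a b = {vx ^ a * p + vy ^ b * q |p q. True}"

text \<open>Membership in the monomial ideal \<open>(x^a, y^b)\<close> is a condition on single coefficients, so every ideal
  membership in two variables below is decided by looking at monomials.\<close>

lemma xy_ideal_iff_bcoeff: "p \<in> xy_ideal a b \<longleftrightarrow> (\<forall>i<a. \<forall>j<b. bcoeff p i j = 0)"
proof
  assume "p \<in> xy_ideal a b"
  then show "\<forall>i<a. \<forall>j<b. bcoeff p i j = 0"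
    by (auto simp: xy_ideal_def bcoeff_vx_mult bcoeff_vy_mult)
next
  assume *: "\<forall>i<a. \<forall>j<b. bcoeff p i j = 0"
  let ?q = "map_poly (poly_shift a) (poly_cutoff b p)"
  have "p = vx ^ a * ?q + vy ^ b * poly_shift b p"
  proof (rule bcoeff_eqI)
    fix i j
    show "bcoeff p i j = bcoeff (vx ^ a * ?q + vy ^ b * poly_shift b p) i j"
      using * by (auto simp: bcoeff_vx_mult bcoeff_vy_mult) (auto simp: bcoeff_def coeff_map_poly coeff_poly_shift coeff_poly_cutoff)
  qed
  then show "p \<in> xy_ideal a b" unfolding xy_ideal_def by blast
qed

lemma xy_ideal_0 [simp]: "0 \<in> xy_ideal a b"
  by (simp add: xy_ideal_iff_bcoeff)

lemma xy_ideal_add: "p \<in> xy_ideal a b \<Longrightarrow> q \<in> xy_ideal a b \<Longrightarrow> p + q \<in> xy_ideal a b"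
  by (simp add: xy_ideal_iff_bcoeff)

lemma xy_ideal_mult: "p \<in> xy_ideal a b \<Longrightarrow> q * p \<in> xy_ideal a b"
proof -
  have eq: "q * (vx ^ a * u + vy ^ b * v) = vx ^ a * (q * u) + vy ^ b * (q * v)" for u v
    by (simp add: algebra_simps)
  show "p \<in> xy_ideal a b \<Longrightarrow> q * p \<in> xy_ideal a b" unfolding xy_ideal_def by (smt (verit) eq mem_Collect_eq)
qed

lemma xy_ideal_add_iff:
  assumes "p \<in> xy_ideal a b" shows "p + q \<in> xy_ideal a b \<longleftrightarrow> q \<in> xy_ideal a b"
  using assms by (simp add: xy_ideal_iff_bcoeff)

lemma xy_ideal_vx: "a \<le> c \<Longrightarrow> vx ^ c * p \<in> xy_ideal a b"
  by (simp add: xy_ideal_iff_bcoeff bcoeff_vx_mult)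

lemma xy_ideal_frobenius:
  fixes p :: "'k :: char2 poly poly"
  assumes "p \<in> xy_ideal a b"
  shows "p ^ (2 ^ k) \<in> xy_ideal (2 ^ k * a) (2 ^ k * b)"
proof -
  from assms obtain u v where p: "p = vx ^ a * u + vy ^ b * v" by (auto simp: xy_ideal_def)
  have "p ^ (2 ^ k) = vx ^ (2 ^ k * a) * u ^ (2 ^ k) + vy ^ (2 ^ k * b) * v ^ (2 ^ k)"
    unfolding p char2_power_add power_mult_distrib by (simp add: mult.commute flip: power_mult)
  then show ?thesis by (auto simp: xy_ideal_def)
qed

lemma xy_ideal_square:
  fixes p :: "'k :: char2 poly poly"
  shows "p \<in> xy_ideal a b \<Longrightarrow> p ^ 2 \<in> xy_ideal (2 * a) (2 * b)"
  using xy_ideal_frobenius[of p a b 1] by simp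

lemma xy_ideal_shift: "vx ^ c * (vy ^ d * p) \<in> xy_ideal (a + c) (b + d) \<longleftrightarrow> p \<in> xy_ideal a b"
proof
  assume *: "vx ^ c * (vy ^ d * p) \<in> xy_ideal (a + c) (b + d)"
  show "p \<in> xy_ideal a b" unfolding xy_ideal_iff_bcoeff
  proof (intro allI impI)
    fix i j assume "i < a" "j < b"
    then show "bcoeff p i j = 0"
      using *[unfolded xy_ideal_iff_bcoeff, rule_format, of "i + c" "j + d"] by (simp add: bcoeff_vx_mult bcoeff_vy_mult)
  qed
qed (auto simp: xy_ideal_iff_bcoeff bcoeff_vx_mult bcoeff_vy_mult)

definition homog :: "nat \<Rightarrow> 'k :: comm_ring_1 poly poly \<Rightarrow> bool" where
  "homog d p \<longleftrightarrow> (\<forall>i j. bcoeff p i j \<noteq> 0 \<longrightarrow> i + j = d)"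

lemma homog_0 [simp]: "homog d 0"
  by (simp add: homog_def)

lemma homog_add: "homog d p \<Longrightarrow> homog d q \<Longrightarrow> homog d (p + q)"
  unfolding homog_def bcoeff_simps by (metis add.right_neutral)

lemma homog_mult: "homog d p \<Longrightarrow> homog e q \<Longrightarrow> homog (d + e) (p * q)"
  unfolding homog_def
proof (intro allI impI)
  fix i j assume p: "\<forall>i j. bcoeff p i j \<noteq> 0 \<longrightarrow> i + j = d" and q: "\<forall>i j. bcoeff q i j \<noteq> 0 \<longrightarrow> i + j = e"
    and "bcoeff (p * q) i j \<noteq> 0"
  then obtain j' i' where *: "j' \<le> j" "i' \<le> i" "bcoeff p i' j' * bcoeff q (i - i') (j - j') \<noteq> 0"
    unfolding bcoeff_mult by (metis (no_types, lifting) atMost_iff sum.not_neutral_contains_not_neutral)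
  have "bcoeff p i' j' \<noteq> 0" "bcoeff q (i - i') (j - j') \<noteq> 0" using *(3) by auto
  then have "i' + j' = d" "(i - i') + (j - j') = e" using p q by blast+
  then show "i + j = d + e" using * by linarith
qed

lemma homog_one: "homog 0 1" by (simp add: homog_def bcoeff_one)
lemma homog_const: "homog 0 [:[:c:]:]" by (simp add: homog_def bcoeff_const)
lemma homog_monomial: "homog (a + b) (vx ^ a * vy ^ b)" by (simp add: homog_def bcoeff_monomial)
lemma homog_vx: "homog a (vx ^ a)" using homog_monomial[of a 0] by simp
lemma homog_vy: "homog b (vy ^ b)" using homog_monomial[of 0 b] by simp

lemma homog_power: "homog d p \<Longrightarrow> homog (n * d) (p ^ n)"
  by (induction n) (simp_all add: homog_one homog_mult)

text \<open>The largest degree of a monomial outside \<open>(x^a, y^b)\<close> is \<open>a + b - 2\<close>.\<close>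

lemma homog_xy_ideal: "homog d p \<Longrightarrow> a + b \<le> d + 1 \<Longrightarrow> p \<in> xy_ideal a b"
  unfolding homog_def xy_ideal_iff_bcoeff by (metis add.commute add_less_le_mono Suc_eq_plus1 less_Suc_eq_le not_less_iff_gr_or_eq add_le_mono le_eq_less_or_eq add_Suc_right Suc_leI not_less)

lemma coeff_frobenius:
  fixes f :: "'k :: char2 poly"
  shows "Polynomial.coeff (f ^ (2 ^ k)) n =
    (if 2 ^ k dvd n then Polynomial.coeff f (n div 2 ^ k) ^ (2 ^ k) else 0)"
proof -
  have "f ^ (2 ^ k) = (\<Sum>i\<le>degree f. Polynomial.monom (Polynomial.coeff f i) i) ^ (2 ^ k)"
    by (simp add: poly_as_sum_of_monoms)
  also have "\<dots> = (\<Sum>i\<le>degree f. Polynomial.monom (Polynomial.coeff f i ^ (2 ^ k)) (i * 2 ^ k))"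
    unfolding char2_power_sum by (simp add: monom_power)
  finally have "Polynomial.coeff (f ^ (2 ^ k)) n =
      (\<Sum>i\<le>degree f. if i * 2 ^ k = n then Polynomial.coeff f i ^ (2 ^ k) else 0)"
    by (simp add: coeff_sum)
  also have "\<dots> = (if 2 ^ k dvd n then Polynomial.coeff f (n div 2 ^ k) ^ (2 ^ k) else 0)"
  proof (cases "2 ^ k dvd n")
    case True
    then obtain m where n: "n = m * 2 ^ k" by (metis dvd_div_mult_self)
    show ?thesis unfolding n using coeff_eq_0[of f m] by (auto simp: zero_power not_le)
  qed (auto intro!: sum.neutral)
  finally show ?thesis .
qed

text \<open>Powers of the variable below \<open>2^k\<close> form a basis over the subring of \<open>2^k\<close>-th powers, so a factor of small
  degree does not mix the coefficients of a \<open>2^k\<close>-th power.\<close>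

lemma coeff_mult_frobenius:
  fixes f d :: "'k :: char2 poly"
  assumes "degree d < 2 ^ k" "i < 2 ^ k"
  shows "Polynomial.coeff (d * f ^ (2 ^ k)) (i + 2 ^ k * j) =
    Polynomial.coeff d i * Polynomial.coeff f j ^ (2 ^ k)"
proof -
  let ?n = "i + 2 ^ k * j"
  have "Polynomial.coeff d l * Polynomial.coeff (f ^ (2 ^ k)) (?n - l) = 0" if "l \<le> ?n" "l \<noteq> i" for l
  proof (cases "l < 2 ^ k")
    case True
    have "\<not> 2 ^ k dvd ?n - l"
    proof
      assume "2 ^ k dvd ?n - l"
      then have "l mod 2 ^ k = ?n mod 2 ^ k" using that(1) by (metis mod_eq_dvd_iff_nat)
      then show False using True assms(2) that(2) by simp
    qed
    then show ?thesis by (simp add: coeff_frobenius)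
  qed (use assms coeff_eq_0[of d l] in auto)
  then have "Polynomial.coeff (d * f ^ (2 ^ k)) ?n =
      (\<Sum>l\<le>?n. if l = i then Polynomial.coeff d l * Polynomial.coeff (f ^ (2 ^ k)) (?n - l) else 0)"
    unfolding Polynomial.coeff_mult by (intro sum.cong) auto
  also have "\<dots> = Polynomial.coeff d i * Polynomial.coeff f j ^ (2 ^ k)"
    by (simp add: coeff_frobenius)
  finally show ?thesis .
qed

text \<open>This is the flatness of Frobenius in the form in which tight closure needs it: a multiplier that works
  for a large Frobenius power can be dropped.  Take \<open>2^k\<close> above the degrees of \<open>d\<close> and look at the leading
  coefficient of \<open>d\<close>, once in each variable.\<close>

lemma xy_ideal_frobenius_cancel:
  fixes d f :: "'k :: {idom, char2} poly poly"
  assumes "d \<noteq> 0" and *: "\<And>k. k \<ge> 1 \<Longrightarrow> d * f ^ (2 ^ k) \<in> xy_ideal (2 ^ k * a) (2 ^ k * b)"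
  shows "f \<in> xy_ideal a b"
  unfolding xy_ideal_iff_bcoeff
proof (intro allI impI)
  fix i j assume ij: "i < a" "j < b"
  define d1 where "d1 = Polynomial.coeff d (degree d)"
  have "d1 \<noteq> 0" using assms(1) by (simp add: d1_def)
  define k where "k = Suc (max (degree d) (degree d1))"
  have "k < 2 ^ k" by (rule less_exp)
  then have k: "degree d < 2 ^ k" "degree d1 < 2 ^ k" "k \<ge> 1"
    unfolding k_def by linarith+
  have lt: "u + 2 ^ k * v < 2 ^ k * w" if "u < 2 ^ k" "v < w" for u v w :: nat
  proof -
    have "u + 2 ^ k * v < 2 ^ k * (v + 1)" using that(1) by simp
    also have "\<dots> \<le> 2 ^ k * w" using that(2) by (intro mult_le_mono) auto
    finally show ?thesis .
  qed
  have "0 = bcoeff (d * f ^ (2 ^ k)) (degree d1 + 2 ^ k * i) (degree d + 2 ^ k * j)"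
    using *[OF k(3)] lt[OF k(1) ij(2)] lt[OF k(2) ij(1)] unfolding xy_ideal_iff_bcoeff by simp
  also have "\<dots> = Polynomial.coeff d1 (degree d1) * bcoeff f i j ^ (2 ^ k)"
    unfolding bcoeff_def coeff_mult_frobenius[OF k(1) k(1)] d1_def[symmetric] coeff_mult_frobenius[OF k(2) k(2)] ..
  finally show "bcoeff f i j = 0" using \<open>d1 \<noteq> 0\<close> by auto
qed

section \<open>Kernels of dyadic Toeplitz matrices\<close>

text \<open>A statement about alternating matrices \<open>M\<close> over a field of characteristic two that survives gluing index sets.
  In even size \<open>M\<close> is invertible and, as its inverse is alternating too, a solution of \<open>M w = c 1\<close> has
  coordinate sum zero.  In odd size the kernel is a line that is not in the hyperplane of coordinate sum zero,
  and pairing with it shows that \<open>M w = c 1\<close> forces \<open>c = 0\<close>.\<close>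

definition nondeg :: "('i \<Rightarrow> 'i \<Rightarrow> 'k :: field) \<Rightarrow> 'i set \<Rightarrow> bool" where
  "nondeg M T \<longleftrightarrow>
    (if even (card T)
     then (\<forall>w c. (\<forall>i\<in>T. (\<Sum>j\<in>T. M i j * w j) = c) \<longrightarrow> sum w T = 0 \<and> (c = 0 \<longrightarrow> (\<forall>i\<in>T. w i = 0))) \<and>
          (\<forall>c. \<exists>w. \<forall>i\<in>T. (\<Sum>j\<in>T. M i j * w j) = c)
     else (\<forall>w c. (\<forall>i\<in>T. (\<Sum>j\<in>T. M i j * w j) = c) \<longrightarrow> c = 0 \<and> (sum w T = 0 \<longrightarrow> (\<forall>i\<in>T. w i = 0))) \<and>
          (\<exists>w. (\<forall>i\<in>T. (\<Sum>j\<in>T. M i j * w j) = 0) \<and> sum w T = 1))"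

lemma nondeg_evenD:
  assumes "nondeg M T" "even (card T)" "\<And>i. i \<in> T \<Longrightarrow> (\<Sum>j\<in>T. M i j * w j) = c"
  shows "sum w T = 0" "c = 0 \<Longrightarrow> i \<in> T \<Longrightarrow> w i = 0"
proof -
  have "\<forall>i\<in>T. (\<Sum>j\<in>T. M i j * w j) = c" using assms(3) by blast
  then show "sum w T = 0" "c = 0 \<Longrightarrow> i \<in> T \<Longrightarrow> w i = 0"
    using assms(1,2) unfolding nondeg_def by (simp_all only: if_True)
qed

lemma nondeg_even_ex:
  assumes "nondeg M T" "even (card T)"
  obtains w where "\<And>i. i \<in> T \<Longrightarrow> (\<Sum>j\<in>T. M i j * w j) = c" "sum w T = 0"
proof -
  obtain w where w: "\<forall>i\<in>T. (\<Sum>j\<in>T. M i j * w j) = c"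
    using assms unfolding nondeg_def by (simp only: if_True) blast
  then have "sum w T = 0" using nondeg_evenD(1)[OF assms] by blast
  then show thesis using that w by blast
qed

lemma nondeg_oddD:
  assumes "nondeg M T" "odd (card T)" "\<And>i. i \<in> T \<Longrightarrow> (\<Sum>j\<in>T. M i j * w j) = c"
  shows "c = 0" "sum w T = 0 \<Longrightarrow> i \<in> T \<Longrightarrow> w i = 0"
proof -
  have "\<forall>i\<in>T. (\<Sum>j\<in>T. M i j * w j) = c" using assms(3) by blast
  then show "c = 0" "sum w T = 0 \<Longrightarrow> i \<in> T \<Longrightarrow> w i = 0"
    using assms(1,2) unfolding nondeg_def by (simp_all only: if_False)
qed

lemma nondeg_odd_ex:
  assumes "nondeg M T" "odd (card T)"
  obtains w where "\<And>i. i \<in> T \<Longrightarrow> (\<Sum>j\<in>T. M i j * w j) = 0" "sum w T = 1"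
  using assms unfolding nondeg_def by (simp only: if_False) blast

lemma char2_add_eq: "a + b = c \<Longrightarrow> a = c + (b :: 'a :: char2)"
  by (metis char2_diff add_diff_cancel_right')

text \<open>If all entries between two index sets are the same nonzero \<open>m\<close>, each block sees the other one only through
  its coordinate sum, so the system decouples into \<open>M_1 w_1 = c_1 1\<close> and \<open>M_2 w_2 = c_2 1\<close>.  The
  parity condition excludes the case that is symmetric to the second one.\<close>

lemma nondeg_Un:
  fixes M :: "'i \<Rightarrow> 'i \<Rightarrow> 'k :: {field, char2}"
  assumes fin: "finite T1" "finite T2" and disj: "T1 \<inter> T2 = {}"
    and cross: "\<And>i j. i \<in> T1 \<Longrightarrow> j \<in> T2 \<Longrightarrow> M i j = m" "\<And>i j. i \<in> T2 \<Longrightarrow> j \<in> T1 \<Longrightarrow> M i j = m"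
    and m: "m \<noteq> 0" and nd: "nondeg M T1" "nondeg M T2"
    and par: "even (card T2) \<or> odd (card T1)"
  shows "nondeg M (T1 \<union> T2)"
proof -
  let ?T = "T1 \<union> T2"
  let ?S1 = "\<lambda>w i. \<Sum>j\<in>T1. M i j * w j" and ?S2 = "\<lambda>w i. \<Sum>j\<in>T2. M i j * w j"
  have row1: "(\<Sum>j\<in>?T. M i j * w j) = ?S1 w i + m * sum w T2" if "i \<in> T1" for w i
    using fin disj that by (simp add: sum.union_disjoint cross sum_distrib_left)
  have row2: "(\<Sum>j\<in>?T. M i j * w j) = m * sum w T1 + ?S2 w i" if "i \<in> T2" for w i
    using fin disj that by (simp add: sum.union_disjoint cross sum_distrib_left)
  have sumT: "sum w ?T = sum w T1 + sum w T2" for w :: "'i \<Rightarrow> 'k"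
    using fin disj by (simp add: sum.union_disjoint)
  have card: "card ?T = card T1 + card T2" using fin disj by (simp add: card_Un_disjoint)
  have eq1: "?S1 w i = c + m * sum w T2" if "\<And>i. i \<in> ?T \<Longrightarrow> (\<Sum>j\<in>?T. M i j * w j) = c" "i \<in> T1" for w c i
    using that(1)[of i] that(2) row1[of i w] by (intro char2_add_eq) simp
  have eq2: "?S2 w i = c + m * sum w T1" if "\<And>i. i \<in> ?T \<Longrightarrow> (\<Sum>j\<in>?T. M i j * w j) = c" "i \<in> T2" for w c i
    using that(1)[of i] that(2) row2[of i w] by (intro char2_add_eq) (simp add: add.commute)
  have glue: "\<exists>w. (\<forall>i\<in>T1. w i = w1 i) \<and> (\<forall>i\<in>T2. w i = w2 i)" for w1 w2 :: "'i \<Rightarrow> 'k"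
    using disj by (intro exI[of _ "\<lambda>i. if i \<in> T1 then w1 i else w2 i"]) auto
  show ?thesis
  proof (cases "even (card T1)")
    case e1: True
    then have e2: "even (card T2)" using par by simp
    have "sum w ?T = 0 \<and> (c = 0 \<longrightarrow> (\<forall>i\<in>?T. w i = 0))"
      if "\<And>i. i \<in> ?T \<Longrightarrow> (\<Sum>j\<in>?T. M i j * w j) = c" for w c
    proof -
      note d1 = nondeg_evenD[OF nd(1) e1 eq1[OF that]] and d2 = nondeg_evenD[OF nd(2) e2 eq2[OF that]]
      have "sum w T1 = 0" "sum w T2 = 0" by (rule d1(1), assumption+) (rule d2(1), assumption+)
      then show ?thesis using d1(2) d2(2) by (auto simp: sumT)
    qed
    moreover have "\<exists>w. \<forall>i\<in>?T. (\<Sum>j\<in>?T. M i j * w j) = c" for c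
    proof -
      obtain w1 where w1: "\<And>i. i \<in> T1 \<Longrightarrow> ?S1 w1 i = c" "sum w1 T1 = 0"
        using nondeg_even_ex[OF nd(1) e1] by blast
      obtain w2 where w2: "\<And>i. i \<in> T2 \<Longrightarrow> ?S2 w2 i = c" "sum w2 T2 = 0"
        using nondeg_even_ex[OF nd(2) e2] by blast
      obtain w where w: "\<And>i. i \<in> T1 \<Longrightarrow> w i = w1 i" "\<And>i. i \<in> T2 \<Longrightarrow> w i = w2 i"
        using glue by blast
      show ?thesis
        by (rule exI[of _ w]) (use w w1 w2 in \<open>auto simp: row1 row2\<close>)
    qed
    ultimately show ?thesis using e1 e2 unfolding nondeg_def card by auto
  next
    case o1: False
    show ?thesis
    proof (cases "even (card T2)")
      case e2: True
      have "c = 0 \<and> (sum w ?T = 0 \<longrightarrow> (\<forall>i\<in>?T. w i = 0))"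
        if "\<And>i. i \<in> ?T \<Longrightarrow> (\<Sum>j\<in>?T. M i j * w j) = c" for w c
      proof -
        note d1 = nondeg_oddD[OF nd(1) o1 eq1[OF that]] and d2 = nondeg_evenD[OF nd(2) e2 eq2[OF that]]
        have "sum w T2 = 0" by (rule d2(1), assumption+)
        then have c: "c = 0" using d1(1) by simp
        have "w i = 0" if "sum w ?T = 0" "i \<in> ?T" for i
        proof -
          have s1: "sum w T1 = 0" using that(1) \<open>sum w T2 = 0\<close> by (simp add: sumT)
          then show ?thesis using that(2) d1(2) d2(2) c by auto
        qed
        then show ?thesis using c by blast
      qed
      moreover have "\<exists>w. (\<forall>i\<in>?T. (\<Sum>j\<in>?T. M i j * w j) = 0) \<and> sum w ?T = 1"
      proof -
        obtain w1 where w1: "\<And>i. i \<in> T1 \<Longrightarrow> ?S1 w1 i = 0" "sum w1 T1 = 1"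
          using nondeg_odd_ex[OF nd(1) o1] by blast
        obtain w2 where w2: "\<And>i. i \<in> T2 \<Longrightarrow> ?S2 w2 i = m" "sum w2 T2 = 0"
          using nondeg_even_ex[OF nd(2) e2] by blast
        obtain w where w: "\<And>i. i \<in> T1 \<Longrightarrow> w i = w1 i" "\<And>i. i \<in> T2 \<Longrightarrow> w i = w2 i"
          using glue by blast
        show ?thesis
        proof (intro exI[of _ w] conjI ballI)
          fix i assume "i \<in> ?T"
          then show "(\<Sum>j\<in>?T. M i j * w j) = 0"
          proof
            assume i: "i \<in> T1" show ?thesis unfolding row1[OF i] by (simp add: w w1 w2 i)
          next
            assume i: "i \<in> T2" show ?thesis unfolding row2[OF i] by (simp add: w w1 w2 i)
          qed
        qed (simp add: sumT w w1 w2)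
      qed
      ultimately show ?thesis using o1 e2 unfolding nondeg_def card by auto
    next
      case o2: False
      have "sum w ?T = 0 \<and> (c = 0 \<longrightarrow> (\<forall>i\<in>?T. w i = 0))"
        if "\<And>i. i \<in> ?T \<Longrightarrow> (\<Sum>j\<in>?T. M i j * w j) = c" for w c
      proof -
        note d1 = nondeg_oddD[OF nd(1) o1 eq1[OF that]] and d2 = nondeg_oddD[OF nd(2) o2 eq2[OF that]]
        have c: "c = m * sum w T2" "c = m * sum w T1"
          using d1(1) d2(1) by (simp_all add: char2_eq_iff[of c])
        then have "sum w T1 = sum w T2" using m by simp
        moreover have "w i = 0" if "c = 0" "i \<in> ?T" for i
        proof -
          have "sum w T1 = 0" "sum w T2 = 0" using c that(1) m by simp_all
          then show ?thesis using that(2) d1(2) d2(2) by blast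
        qed
        ultimately show ?thesis by (auto simp: sumT)
      qed
      moreover have "\<exists>w. \<forall>i\<in>?T. (\<Sum>j\<in>?T. M i j * w j) = c" for c
      proof -
        obtain w1 where w1: "\<And>i. i \<in> T1 \<Longrightarrow> ?S1 w1 i = 0" "sum w1 T1 = 1"
          using nondeg_odd_ex[OF nd(1) o1] by blast
        obtain w2 where w2: "\<And>i. i \<in> T2 \<Longrightarrow> ?S2 w2 i = 0" "sum w2 T2 = 1"
          using nondeg_odd_ex[OF nd(2) o2] by blast
        obtain w where w: "\<And>i. i \<in> T1 \<Longrightarrow> w i = c / m * w1 i" "\<And>i. i \<in> T2 \<Longrightarrow> w i = c / m * w2 i"
          using glue[of "\<lambda>i. c / m * w1 i" "\<lambda>i. c / m * w2 i"] by blast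
        have "?S1 w i = c / m * ?S1 w1 i" "?S2 w i = c / m * ?S2 w2 i" for i
          by (simp_all add: w sum_distrib_left mult.left_commute)
        moreover have "sum w T1 = c / m" "sum w T2 = c / m"
        proof -
          have "sum w T1 = c / m * sum w1 T1" "sum w T2 = c / m * sum w2 T2"
            unfolding sum_distrib_left by (intro sum.cong; simp add: w)+
          then show "sum w T1 = c / m" "sum w T2 = c / m" using w1(2) w2(2) by simp_all
        qed
        ultimately show ?thesis
          by (intro exI[of _ w]) (use w1 w2 m in \<open>auto simp: row1 row2\<close>)
      qed
      ultimately show ?thesis using o1 o2 unfolding nondeg_def card by auto
    qed
  qed
qed

text \<open>The Toeplitz matrix whose entries depend on the 2-adic distance of the indices.\<close>

definition dyadic :: "(nat \<Rightarrow> 'k :: zero) \<Rightarrow> int \<Rightarrow> int \<Rightarrow> 'k" where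
  "dyadic \<mu> i j = (if i = j then 0 else \<mu> (multiplicity 2 (i - j)))"

text \<open>Split an index set inside one residue class modulo \<open>2^v\<close> into its two classes modulo \<open>2^(v+1)\<close>: all
  entries between them equal \<open>\<mu> v\<close>.  The recursion ends with singletons, where the matrix is zero.\<close>

lemma nondeg_dyadic:
  fixes \<mu> :: "nat \<Rightarrow> 'k :: {field, char2}"
  assumes "finite T" "\<And>i j. i \<in> T \<Longrightarrow> j \<in> T \<Longrightarrow> \<bar>i - j\<bar> < 2 ^ V" "\<And>l. l < V \<Longrightarrow> \<mu> l \<noteq> 0"
  shows "nondeg (dyadic \<mu>) T"
proof -
  have "nondeg (dyadic \<mu>) T"
    if "v \<le> V" "finite T" "\<And>i j. i \<in> T \<Longrightarrow> j \<in> T \<Longrightarrow> 2 ^ v dvd i - j"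
      "\<And>i j. i \<in> T \<Longrightarrow> j \<in> T \<Longrightarrow> \<bar>i - j\<bar> < 2 ^ V" for v T
    using that
  proof (induction arbitrary: T rule: inc_induct)
    case base
    have "i = j" if "i \<in> T" "j \<in> T" for i j
      using base(2,3)[OF that] zdvd_imp_le[of "2 ^ V" "\<bar>i - j\<bar>"] by fastforce
    then have "T = {} \<or> (\<exists>i. T = {i})" by blast
    then show ?case by (auto simp: nondeg_def dyadic_def intro: exI[of _ "\<lambda>_. 1"])
  next
    case (step v)
    show ?case
    proof (cases "T = {}")
      case True then show ?thesis by (simp add: nondeg_def)
    next
      case False
      then obtain r where r: "r \<in> T" by blast
      define T1 T2 where "T1 = {i \<in> T. 2 ^ Suc v dvd i - r}" and "T2 = {i \<in> T. \<not> 2 ^ Suc v dvd i - r}"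
      have T: "T = T1 \<union> T2" "T1 \<inter> T2 = {}" "finite T1" "finite T2"
        using step.prems(1) by (auto simp: T1_def T2_def)
      have half: "\<exists>k. i - r = 2 ^ v * (2 * k + 1)" if i: "i \<in> T2" for i
      proof -
        have "2 ^ v dvd i - r" using step.prems(2) i r by (simp add: T2_def)
        then obtain k where k: "i - r = 2 ^ v * k" ..
        have "odd k"
        proof
          assume "even k"
          then have "2 ^ v * 2 dvd i - r" unfolding k by (intro mult_dvd_mono) auto
          then show False using i by (simp add: T2_def mult.commute)
        qed
        then show ?thesis using k by (metis oddE)
      qed
      have 1: "2 ^ Suc v dvd i - j" if ij: "i \<in> T1" "j \<in> T1" for i j
        using dvd_diff[of "2 ^ Suc v" "i - r" "j - r"] ij by (simp add: T1_def)
      have 2: "2 ^ Suc v dvd i - j" if ij: "i \<in> T2" "j \<in> T2" for i j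
      proof -
        obtain k l where "i - r = 2 ^ v * (2 * k + 1)" "j - r = 2 ^ v * (2 * l + 1)"
          using half ij by blast
        then have "i - j = 2 ^ Suc v * (k - l)" by (simp add: algebra_simps)
        then show ?thesis by simp
      qed
      have mult: "multiplicity 2 (i - j) = v" if ij: "i \<in> T1" "j \<in> T2" for i j
      proof (rule multiplicity_eqI)
        show "2 ^ v dvd i - j" using step.prems(2) ij T(1) by blast
        show "\<not> 2 ^ Suc v dvd i - j"
          using dvd_diff[of "2 ^ Suc v" "i - r" "i - j"] ij by (auto simp: T1_def T2_def)
      qed
      have mult': "multiplicity 2 (j - i) = v" if ij: "i \<in> T1" "j \<in> T2" for i j
      proof -
        have "multiplicity 2 (j - i) = multiplicity 2 (- (i - j))" by simp
        also have "\<dots> = multiplicity 2 (i - j)" by (simp only: multiplicity_def dvd_minus_iff)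
        finally show ?thesis using mult[OF ij] by simp
      qed
      have nd: "nondeg (dyadic \<mu>) T1" "nondeg (dyadic \<mu>) T2"
        using step.prems T 1 2 by (intro step.IH; auto)+
      have cr: "dyadic \<mu> i j = \<mu> v" "dyadic \<mu> j i = \<mu> v" if ij: "i \<in> T1" "j \<in> T2" for i j
        using mult[OF ij] mult'[OF ij] ij T(2) by (auto simp: dyadic_def)
      have v: "\<mu> v \<noteq> 0" using step.hyps assms(3) by simp
      show ?thesis
      proof (cases "even (card T2) \<or> odd (card T1)")
        case True
        show ?thesis unfolding T(1)
          by (rule nondeg_Un[OF T(3,4,2) _ _ v nd True]) (use cr in auto)
      next
        case False
        then have *: "even (card T1) \<or> odd (card T2)" by blast
        have "T2 \<inter> T1 = {}" using T(2) by blast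
        then have "nondeg (dyadic \<mu>) (T2 \<union> T1)"
          by (rule nondeg_Un[OF T(4,3) _ _ _ v nd(2,1) *]) (use cr in auto)
        then show ?thesis unfolding T(1) by (simp add: Un_commute)
      qed
    qed
  qed
  from this[of 0 T] assms show ?thesis by simp
qed

text \<open>A kernel vector that vanishes at \<open>c\<close> restricts to a kernel vector of the even-sized matrix without \<open>c\<close>.\<close>

lemma dyadic_kernel:
  fixes \<mu> :: "nat \<Rightarrow> 'k :: {field, char2}"
  assumes "finite T" "\<And>i j. i \<in> T \<Longrightarrow> j \<in> T \<Longrightarrow> \<bar>i - j\<bar> < 2 ^ V" "\<And>l. l < V \<Longrightarrow> \<mu> l \<noteq> 0"
    and "odd (card T)" "c \<in> T"
  obtains w where "\<And>i. i \<in> T \<Longrightarrow> (\<Sum>j\<in>T. dyadic \<mu> i j * w j) = 0" "w c \<noteq> 0"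
proof -
  obtain w where w: "\<And>i. i \<in> T \<Longrightarrow> (\<Sum>j\<in>T. dyadic \<mu> i j * w j) = 0" "sum w T = 1"
    using nondeg_odd_ex[OF nondeg_dyadic[where V = V and \<mu> = \<mu>] assms(4)] assms(1-3) by blast
  have "w c \<noteq> 0"
  proof
    assume c: "w c = 0"
    have split: "sum f T = f c + sum f (T - {c})" for f :: "int \<Rightarrow> 'k"
      using assms(1,5) by (simp add: sum.remove)
    have "nondeg (dyadic \<mu>) (T - {c})"
      by (rule nondeg_dyadic[where V = V]) (use assms in auto)
    moreover have "even (card (T - {c}))" using assms(1,4,5) by (simp add: card_Diff_singleton)
    moreover have "(\<Sum>j\<in>T - {c}. dyadic \<mu> i j * w j) = 0" if "i \<in> T - {c}" for i
      using w(1)[of i] that c by (simp add: split)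
    ultimately have "sum w (T - {c}) = 0" by (rule nondeg_evenD)
    then show False using w(2) c by (simp add: split)
  qed
  then show thesis using w(1) that by blast
qed

section \<open>The constant coefficient and its annihilator\<close>

abbreviation DD :: "'k :: comm_ring_1 poly poly" where "DD \<equiv> vx * vy"
abbreviation EE :: "'k :: comm_ring_1 poly poly" where "EE \<equiv> vx ^ 3 + vy ^ 3"

definition scalar :: "'k :: comm_ring_1 \<Rightarrow> 'k poly poly" where "scalar c = [:[:c:]:]"

lemma bcoeff_scalar_mult: "bcoeff (scalar c * p) i j = c * bcoeff p i j"
  unfolding scalar_def by (rule bcoeff_const_mult)

lemma homog_scalar: "homog 0 (scalar c)"
  unfolding scalar_def by (rule homog_const)

lemma bcoeff_EE_mult:
  "bcoeff (EE * p) i j = (if 3 \<le> i then bcoeff p (i - 3) j else 0) + (if 3 \<le> j then bcoeff p i (j - 3) else 0)"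
  by (simp add: distrib_right bcoeff_vx_mult bcoeff_vy_mult)

lemma EE_nonzero: "(EE :: 'k :: comm_ring_1 poly poly) \<noteq> 0"
proof
  assume "(EE :: 'k poly poly) = 0"
  then have "bcoeff (EE * 1 :: 'k poly poly) 3 0 = 0" by simp
  then show False unfolding bcoeff_EE_mult by (simp add: bcoeff_one)
qed

lemma bcoeff_square:
  fixes p :: "'k :: char2 poly poly"
  shows "bcoeff (p ^ 2) i j = (if even i \<and> even j then bcoeff p (i div 2) (j div 2) ^ 2 else 0)"
  by (simp add: bcoeff_def coeff_frobenius[where k = 1, unfolded power_one_right])

lemma homog_DD: "homog 2 DD" using homog_monomial[of 1 1] by (simp add: numeral_2_eq_2)
lemma homog_EE: "homog 3 EE" by (simp add: homog_add homog_vx homog_vy)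

lemma power2_mod_3: "2 ^ n mod 3 = (if even n then 1 else 2 :: nat)"
proof (induction n)
  case (Suc n)
  have "2 ^ Suc n mod 3 = 2 * (2 ^ n mod 3) mod (3 :: nat)" by (simp only: power_Suc mod_mult_right_eq)
  then show ?case unfolding Suc by simp
qed simp

lemma double_mod_3: "2 * a mod 3 = 2 * b mod 3 \<longleftrightarrow> a mod 3 = b mod 3" for a b :: nat
proof -
  have eq: "2 * u mod 3 = 2 * (u mod 3) mod 3" for u :: nat by (simp only: mod_mult_right_eq)
  have "u mod 3 = 0 \<or> u mod 3 = 1 \<or> u mod 3 = 2" for u :: nat by linarith
  from this[of a] this[of b] show ?thesis unfolding eq[of a] eq[of b] by (elim disjE) simp_all
qed

text \<open>Dividing \<open>E_quadc\<close> by \<open>E = x^3 + y^3\<close> is summing a geometric series with ratio \<open>(x / y)^3\<close>, so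
  \<open>D quadc\<close> is the sum of all monomials whose exponent of \<open>x\<close> lies in one residue class modulo 3.\<close>

lemma bcoeff_DD_quadc:
  fixes n :: nat
  assumes "i + j = 2 * 2 ^ n"
  shows "bcoeff (DD * quadc DD EE n :: 'k :: {idom, char2} poly poly) i j =
    (if 0 < i \<and> 0 < j \<and> i mod 3 = 2 ^ n mod 3 then 1 else 0)"
proof -
  define N :: nat where "N = 2 ^ n"
  define I where "I = {e. 0 < e \<and> e < 2 * N \<and> e mod 3 = N mod 3}"
  have "finite I" by (rule finite_subset[of _ "{..<2 * N}"]) (auto simp: I_def)
  define s :: "'k poly poly" where "s = (\<Sum>e\<in>I. vx ^ e * vy ^ (2 * N - e))"
  have bcoeff_s: "bcoeff s i j = (if i \<in> I \<and> j = 2 * N - i then 1 else 0)" for i j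
  proof -
    have "bcoeff s i j = (\<Sum>e\<in>I. if e = i then if j = 2 * N - i then 1 else 0 else 0)"
      unfolding s_def bcoeff_simps bcoeff_monomial by (intro sum.cong) auto
    then show ?thesis using \<open>finite I\<close> by simp
  qed
  have N1: "N \<ge> 1" by (simp add: N_def)
  define r where "r = N mod 3"
  have r: "r = (if even n then 1 else 2)" by (simp add: r_def N_def power2_mod_3)
  have "DD * (EE * quadc DD EE n) = (vx ^ (2 * N + 3 - r) * vy ^ r + vx ^ r * vy ^ (2 * N + 3 - r) :: 'k poly poly)"
    unfolding E_quadc[OF EE_nonzero] by (simp add: r N_def algebra_simps power2_eq_square numeral_3_eq_3)
  also have "\<dots> = EE * s"
  proof (rule bcoeff_eqI)
    fix i j
    define P where "P \<longleftrightarrow> i + j = 2 * N + 3 \<and> i mod 3 = r"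
    have a: "3 \<le> i \<and> i - 3 \<in> I \<and> j = 2 * N - (i - 3) \<longleftrightarrow> P \<and> 3 < i \<and> 0 < j"
      by (auto simp: I_def P_def r_def le_mod_geq[of 3 i])
    have b: "3 \<le> j \<and> i \<in> I \<and> j - 3 = 2 * N - i \<longleftrightarrow> P \<and> 0 < i \<and> 3 < j"
      by (auto simp: I_def P_def r_def)
    have "bcoeff (EE * s) i j = of_bool (3 \<le> i \<and> i - 3 \<in> I \<and> j = 2 * N - (i - 3)) +
        of_bool (3 \<le> j \<and> i \<in> I \<and> j - 3 = 2 * N - i)"
      by (simp add: bcoeff_EE_mult bcoeff_s)
    also have "\<dots> = of_bool (P \<and> 3 < i \<and> 0 < j) + of_bool (P \<and> 0 < i \<and> 3 < j)"
      unfolding a b ..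
    also have "\<dots> = of_bool (i = 2 * N + 3 - r \<and> j = r) + of_bool (i = r \<and> j = 2 * N + 3 - r)"
    proof (cases P)
      case True
      have N: "\<exists>k. N = 3 * k + r" by (metis r_def mult_div_mod_eq)
      have i: "\<exists>k. i = 3 * k + r" using True by (metis P_def mult_div_mod_eq)
      have ij: "i + j = 2 * N + 3" using True by (simp add: P_def)
      have r12: "r = 1 \<or> r = 2" by (simp add: r)
      have j: "\<exists>k. j = 3 * k + r"
      proof -
        obtain k l where kl: "N = 3 * k + r" "i = 3 * l + r" using N i by blast
        have "3 * l < 6 * k + 6" using kl ij r12 by linarith
        then have "l \<le> 2 * k + 1" by simp
        then obtain m where "2 * k + 1 = l + m" by (metis le_add_diff_inverse)
        then have "j = 3 * m + r" using kl ij by linarith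
        then show ?thesis by blast
      qed
      have aux: "(3 < u \<longleftrightarrow> u \<noteq> r) \<and> 0 < u" if u: "\<exists>k. u = 3 * k + r" for u
      proof -
        obtain k where "u = 3 * k + r" using u by blast
        then show ?thesis using r12 by (cases k) auto
      qed
      have e1: "(P \<and> 3 < i \<and> 0 < j) = (i \<noteq> r)" "(P \<and> 0 < i \<and> 3 < j) = (j \<noteq> r)"
        using aux[OF i] aux[OF j] True by blast+
      have e2: "(i = 2 * N + 3 - r \<and> j = r) = (j = r)" "(i = r \<and> j = 2 * N + 3 - r) = (i = r)"
        using ij by linarith+
      have "\<not> (i = r \<and> j = r)" using ij r12 N1 by linarith
      then show ?thesis unfolding e1 e2 by (cases "i = r"; cases "j = r") simp_all
    next
      case False
      have "P" if "i = 2 * N + 3 - r" "j = r"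
      proof -
        obtain k where k: "N = 3 * k + r" by (metis r_def mult_div_mod_eq)
        have "i = 3 * (2 * k + 1) + r" using that k r by simp
        then have "i mod 3 = r mod 3" by (simp only: mod_mult_self4)
        then show ?thesis using that r unfolding P_def by (simp split: if_splits)
      qed
      moreover have "P" if "i = r" "j = 2 * N + 3 - r" using that r by (simp add: P_def split: if_splits)
      ultimately show ?thesis using False by auto
    qed
    also have "\<dots> = bcoeff (vx ^ (2 * N + 3 - r) * vy ^ r + vx ^ r * vy ^ (2 * N + 3 - r) :: 'k poly poly) i j"
      unfolding bcoeff_simps bcoeff_monomial by simp
    finally show "bcoeff (vx ^ (2 * N + 3 - r) * vy ^ r + vx ^ r * vy ^ (2 * N + 3 - r) :: 'k poly poly) i j = bcoeff (EE * s) i j" ..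
  qed
  finally have "EE * s = DD * (EE * quadc DD EE n)" ..
  then have s: "DD * quadc DD EE n = s"
    unfolding mult.left_commute[of DD EE] using EE_nonzero[where 'k='k] by simp
  show ?thesis
    using assms unfolding s bcoeff_s N_def[symmetric] by (auto simp: I_def)
qed

lemma homog_quadc: "homog (2 * 2 ^ n - 2) (quadc DD EE n :: 'k :: {idom, char2} poly poly)"
proof (induction n rule: induct_nat_012)
  case 0 then show ?case by (simp add: homog_one)
next
  case 1 then show ?case by (simp add: homog_DD)
next
  case (ge2 n)
  obtain k where "(2 :: nat) ^ n = Suc k" by (metis not0_implies_Suc power_eq_0_iff zero_neq_numeral)
  then have e: "2 * 2 ^ Suc (Suc n) - 2 = 2 + 2 * (2 * 2 ^ Suc n - 2 :: nat)"
    "2 * 2 ^ Suc (Suc n) - 2 = 2 * 3 + 4 * (2 * 2 ^ n - 2 :: nat)" by simp_all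
  have "homog (2 * 2 ^ Suc (Suc n) - 2) (DD * quadc DD EE (Suc n) ^ 2 :: 'k poly poly)"
    unfolding e(1) by (intro homog_mult homog_DD homog_power ge2)
  moreover have "homog (2 * 2 ^ Suc (Suc n) - 2) (EE ^ 2 * quadc DD EE n ^ 4 :: 'k poly poly)"
    unfolding e(2) by (intro homog_mult homog_EE homog_power ge2)
  ultimately show ?case unfolding quadc.simps by (rule homog_add)
qed

lemma homog_constc: "homog (2 * 2 ^ n) (constc DD EE (scalar t) n :: 'k :: {idom, char2} poly poly)"
proof (induction n)
  case (Suc n)
  obtain k where "(2 :: nat) ^ n = Suc k" by (metis not0_implies_Suc power_eq_0_iff zero_neq_numeral)
  then have e: "2 * 2 ^ Suc n = 2 * (2 * 2 ^ n :: nat)" "2 * 2 ^ Suc n = 0 + 2 * (2 + (2 * 2 ^ n - 2) :: nat)"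
    by simp_all
  have "homog (2 * 2 ^ Suc n) (constc DD EE (scalar t) n ^ 2 :: 'k poly poly)"
    unfolding e(1) by (intro homog_power Suc)
  moreover have "homog (2 * 2 ^ Suc n) (scalar t * (DD * quadc DD EE n) ^ 2 :: 'k poly poly)"
    unfolding e(2) by (intro homog_mult homog_scalar homog_power homog_DD homog_quadc)
  ultimately show ?case unfolding constc.simps by (rule homog_add)
qed simp

text \<open>Each factor 2 of the exponent contributes one more summand of \<open>t + t^2 + t^4 + ...\<close>, and for
  \<open>t = l^2 + l\<close> this sum telescopes.\<close>

lemma bcoeff_constc:
  fixes l :: "'k :: {idom, char2}"
  assumes "i + j = 2 * 2 ^ n"
  shows "bcoeff (constc DD EE (scalar (l ^ 2 + l)) n) i j =
    (if 0 < i \<and> 0 < j \<and> i mod 3 = 2 ^ n mod 3 then l + l ^ (2 ^ min n (multiplicity 2 i)) else 0)"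
  using assms
proof (induction n arbitrary: i j)
  case (Suc n)
  let ?c = "constc DD EE (scalar (l ^ 2 + l))"
  have eq: "bcoeff (?c (Suc n)) i j = bcoeff (?c n ^ 2) i j + (l ^ 2 + l) * bcoeff ((DD * quadc DD EE n) ^ 2) i j"
    by (simp only: constc.simps bcoeff_simps bcoeff_scalar_mult)
  show ?case
  proof (cases "even i")
    case False
    then have "multiplicity 2 i = 0" by (simp add: not_dvd_imp_multiplicity_0)
    then show ?thesis using False unfolding eq by (simp add: bcoeff_square)
  next
    case True
    have "even (i + j)" unfolding Suc.prems by simp
    then have "even j" using True by simp
    then obtain i' j' where ij: "i = 2 * i'" "j = 2 * j'" using True by (metis evenE)
    have s: "i' + j' = 2 * 2 ^ n" using Suc.prems ij by simp
    have m: "i mod 3 = 2 ^ Suc n mod 3 \<longleftrightarrow> i' mod 3 = 2 ^ n mod 3"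
      unfolding ij power_Suc using double_mod_3 by blast
    have v: "multiplicity 2 i = Suc (multiplicity 2 i')" if "i' > 0"
      unfolding ij using that by (simp add: multiplicity_times_same)
    have ev: "even i" "even j" "i div 2 = i'" "j div 2 = j'" "0 < i \<longleftrightarrow> 0 < i'" "0 < j \<longleftrightarrow> 0 < j'"
      by (simp_all add: ij)
    show ?thesis
    proof (cases "0 < i' \<and> 0 < j' \<and> i' mod 3 = 2 ^ n mod 3")
      case True
      then have v: "min (Suc n) (multiplicity 2 i) = Suc (min n (multiplicity 2 i'))"
        using v by simp
      have "bcoeff (?c (Suc n)) i j = (l + l ^ (2 ^ min n (multiplicity 2 i'))) ^ 2 + (l ^ 2 + l)"
        unfolding eq bcoeff_square using Suc.IH[OF s] bcoeff_DD_quadc[OF s, where 'k='k] True by (simp add: ev(1-4))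
      also have "\<dots> = l + l ^ (2 ^ Suc (min n (multiplicity 2 i')))"
        unfolding power_2_Suc char2_square_add by (simp add: ac_simps)
      finally show ?thesis unfolding m ev v using True by simp
    next
      case False
      have "bcoeff (?c n) i' j' = 0" "bcoeff (DD * quadc DD EE n) i' j' = (0 :: 'k)"
        unfolding Suc.IH[OF s] bcoeff_DD_quadc[OF s] by (simp_all only: False if_False)
      then have "bcoeff (?c (Suc n)) i j = 0"
        unfolding eq bcoeff_square by (simp add: ev(1-4))
      then show ?thesis unfolding m ev(5,6) by (simp only: False if_False)
    qed
  qed
qed simp

lemma multiplicity_shift:
  fixes e n :: nat and k :: int
  assumes e: "int e = 2 ^ n + 6 * k" and k: "k \<noteq> 0" "\<bar>k\<bar> < 2 ^ (n - 2)" and n: "3 \<le> n"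
  shows "multiplicity 2 e = Suc (multiplicity 2 k)" "Suc (multiplicity 2 k) < n"
proof -
  define v where "v = multiplicity 2 k"
  have "2 ^ v dvd k" unfolding v_def by (rule multiplicity_dvd)
  then obtain u where u: "k = 2 ^ v * u" ..
  have "odd u"
  proof
    assume "even u"
    then have "2 ^ Suc v dvd k" unfolding u by (simp add: mult_dvd_mono mult.commute)
    moreover have "\<not> 2 ^ Suc v dvd k"
      unfolding v_def using k by (simp add: power_dvd_iff_le_multiplicity del: power_Suc)
    ultimately show False by contradiction
  qed
  have "(2 :: int) ^ v \<le> \<bar>k\<bar>" using \<open>2 ^ v dvd k\<close> k(1) by (metis abs_of_pos dvd_abs_iff zdvd_imp_le zero_less_abs_iff)
  then have "(2 :: int) ^ v < 2 ^ (n - 2)" using k(2) by linarith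
  then have v: "v < n - 2" by simp
  then show "Suc (multiplicity 2 k) < n" unfolding v_def by simp
  define w where "w = 2 ^ (n - 1 - v) + 3 * u"
  have w: "odd w" using v \<open>odd u\<close> by (simp add: w_def)
  have nv: "n = Suc v + (n - 1 - v)" using v by simp
  have ew: "int e = 2 ^ Suc v * w"
    unfolding e u w_def by (subst nv, simp add: algebra_simps power_add)
  have "multiplicity 2 e = Suc v"
  proof (rule multiplicity_eqI)
    have "int (2 ^ Suc v) dvd int e" unfolding ew by simp
    then show "2 ^ Suc v dvd e" by (simp only: int_dvd_int_iff)
    have "\<not> 2 ^ Suc v * 2 dvd 2 ^ Suc v * w" unfolding dvd_mult_cancel_left using w by simp
    then have "\<not> int (2 ^ Suc (Suc v)) dvd int e" unfolding ew by (simp add: mult.commute)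
    then show "\<not> 2 ^ Suc (Suc v) dvd e" by (simp only: int_dvd_int_iff not_False_eq_True)
  qed
  then show "multiplicity 2 e = Suc (multiplicity 2 k)" by (simp add: v_def)
qed

text \<open>Look for \<open>w\<close> among the forms with exponents congruent to 2 modulo 6.  The conditions on \<open>w c E\<close> then are the
  equations of a dyadic Toeplitz system with entries \<open>l + l^(2^(v+1))\<close>, indexed by \<open>2 s + 1\<close> integers
  where \<open>N = 12 s + 8\<close>; the diagonal entry is the middle coefficient \<open>l + l^N = 0\<close> of \<open>c\<close>.\<close>

lemma annihilator_exists:
  fixes l :: "'k :: {field, char2}"
  assumes n: "odd n" "3 \<le> n" and per: "l ^ (2 ^ n) = l" "\<And>j. 0 < j \<Longrightarrow> j < n \<Longrightarrow> l ^ (2 ^ j) \<noteq> l"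
  obtains w where "homog (2 ^ n - 4) w" "\<And>i j. bcoeff w i j \<noteq> 0 \<Longrightarrow> i mod 6 = 2"
    "bcoeff w (2 ^ n div 2 - 2) (2 ^ n div 2 - 2) \<noteq> 0"
    "EE * w * constc DD EE (scalar (l ^ 2 + l)) n \<in> xy_ideal (2 * 2 ^ n) (2 * 2 ^ n)"
proof -
  define N :: nat where "N = 2 ^ n"
  obtain s where s: "N = 12 * s + 8" "2 * int s < 2 ^ (n - 2)"
  proof -
    obtain p where p: "n = p + 3" using n(2) by (metis le_add_diff_inverse2)
    have "2 ^ p mod 3 = (1 :: nat)" using n(1) unfolding p by (simp add: power2_mod_3)
    then obtain a where a: "2 ^ p = 3 * a + (1 :: nat)" by (metis mult_div_mod_eq)
    \<comment> \<open>with \<open>n = p + 3\<close> and \<open>2^p = 3 a + 1\<close>, the number \<open>s\<close> is \<open>2 a\<close>\<close>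
    have "int (2 ^ p) = 3 * int a + 1" unfolding a by simp
    then have "2 * int (2 * a) < 2 ^ (n - 2)" unfolding p by simp
    moreover have "N = 12 * (2 * a) + 8" unfolding N_def p power_add a by simp
    ultimately show thesis using that by blast
  qed
  let ?c = "constc DD EE (scalar (l ^ 2 + l)) n"
  define \<mu> where "\<mu> = (\<lambda>v. l + l ^ (2 ^ Suc v))"
  define T where "T = {0..2 * int s}"
  have "finite T" by (simp add: T_def)
  moreover have "\<bar>i - j\<bar> < 2 ^ (n - 2)" if "i \<in> T" "j \<in> T" for i j using that s(2) by (auto simp: T_def)
  moreover have "\<mu> v \<noteq> 0" if "v < n - 2" for v
    using per(2)[of "Suc v"] that unfolding \<mu>_def char2_eq_iff[symmetric] by force
  moreover have "odd (card T)" by (simp add: T_def nat_add_distrib nat_mult_distrib)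
  moreover have "int s \<in> T" by (simp add: T_def)
  ultimately obtain a where a: "\<And>i. i \<in> T \<Longrightarrow> (\<Sum>j\<in>T. dyadic \<mu> i j * a j) = 0" "a (int s) \<noteq> 0"
    using dyadic_kernel[of T "n - 2" \<mu> "int s"] by blast
  have T: "T = int ` {..2 * s}"
    using image_int_atLeastAtMost[of 0 "2 * s"] by (simp add: T_def atMost_atLeast0)
  define w where "w = (\<Sum>m\<le>2 * s. scalar (a (int m)) * (vx ^ (6 * m + 2) * vy ^ (6 * (2 * s - m) + 2)))"
  have bcoeffw: "bcoeff w i j = (\<Sum>m\<le>2 * s. a (int m) * (if i = 6 * m + 2 \<and> j = 6 * (2 * s - m) + 2 then 1 else 0))" for i j
    unfolding w_def bcoeff_simps bcoeff_scalar_mult bcoeff_monomial ..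
  have supp: "\<exists>m\<le>2 * s. i = 6 * m + 2 \<and> j = 6 * (2 * s - m) + 2" if "bcoeff w i j \<noteq> 0" for i j
    using that unfolding bcoeffw
    by (elim sum.not_neutral_contains_not_neutral) (auto split: if_splits)
  show thesis
  proof
    show "homog (2 ^ n - 4) w" unfolding homog_def
    proof (intro allI impI)
      fix i j assume "bcoeff w i j \<noteq> 0"
      then obtain m where "m \<le> 2 * s" "i = 6 * m + 2" "j = 6 * (2 * s - m) + 2"
        using supp by blast
      then show "i + j = 2 ^ n - 4" unfolding N_def[symmetric] s by simp
    qed
    show "i mod 6 = 2" if nz: "bcoeff w i j \<noteq> 0" for i j
    proof -
      obtain m where "i = 6 * m + 2"
        using supp nz by blast
      then have "i mod 6 = 2 mod 6" by (simp only: mod_mult_self4)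
      then show ?thesis by simp
    qed
    have mid: "2 ^ n div 2 - 2 = 6 * s + 2" unfolding N_def[symmetric] s by simp
    have "bcoeff w (6 * s + 2) (6 * s + 2) = (\<Sum>m\<le>2 * s. if m = s then a (int m) else 0)"
      unfolding bcoeffw by (intro sum.cong) auto
    also have "\<dots> = a (int s)" by simp
    finally show "bcoeff w (2 ^ n div 2 - 2) (2 ^ n div 2 - 2) \<noteq> 0" unfolding mid using a(2) by simp
    \<comment> \<open>the monomials of \<open>w c\<close> that \<open>E\<close> can move to a monomial outside \<open>(x^(2 N), y^(2 N))\<close>\<close>
    have zero: "bcoeff (w * ?c) i j = 0" if ij: "i + j = 3 * N - 4" "N - 3 \<le> i" "N - 3 \<le> j" for i j
    proof -
      define f where "f = (\<lambda>m. bcoeff (vx ^ (6 * m + 2) * vy ^ (6 * (2 * s - m) + 2) * ?c) i j)"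
      have term_eq: "f m =
        (if (i - (6 * m + 2)) mod 3 = 2 then l + l ^ (2 ^ min n (multiplicity 2 (i - (6 * m + 2)))) else 0)"
        if m: "m \<le> 2 * s" for m
      proof -
        define u v where "u = 6 * m + 2" and "v = 6 * (2 * s - m) + 2"
        have uv: "(i - u) + (j - v) = 2 * 2 ^ n"
          using ij m unfolding N_def[symmetric] s(1) u_def v_def by simp
        have "0 < i - u" "0 < j - v" "u \<le> i" "v \<le> j" using ij m s(1) by (auto simp: u_def v_def)
        moreover have "2 ^ n mod 3 = (2 :: nat)" using n(1) by (simp add: power2_mod_3)
        ultimately show ?thesis
          unfolding f_def u_def[symmetric] v_def[symmetric] mult.assoc bcoeff_vx_mult bcoeff_vy_mult bcoeff_constc[OF uv] by simp
      qed
      have sum_eq: "bcoeff (w * ?c) i j = (\<Sum>m\<le>2 * s. a (int m) * f m)"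
        unfolding f_def w_def sum_distrib_right bcoeff_simps mult.assoc[of "scalar _"] bcoeff_scalar_mult ..
      have vanish: ?thesis if "\<And>m. m \<le> 2 * s \<Longrightarrow> f m = 0" unfolding sum_eq using that by simp
      define q where "q = i div 6"
      have i: "i = 6 * q + i mod 6" unfolding q_def by simp
      have "i mod 6 < 6" by simp
      then have "i mod 6 = 0 \<or> i mod 6 = 1 \<or> i mod 6 = 2 \<or> i mod 6 = 3 \<or> i mod 6 = 4 \<or> i mod 6 = 5"
        by linarith
      moreover have "odd i" if "odd (i mod 6)" using that by (subst i) simp
      ultimately consider "odd i" | "i = 6 * q" | "i = 6 * q + 2" | "i = 6 * q + 4"
        using i by (metis add_0_right odd_numeral odd_one)
      then show ?thesis
      proof cases
        case 1
        have "multiplicity 2 (i - (6 * m + 2)) = 0" if "m \<le> 2 * s" for m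
          using 1 that ij(2) s(1) by (intro not_dvd_imp_multiplicity_0) auto
        then show ?thesis by (intro vanish) (simp only: term_eq if_False power_0 min_0R power_one_right char2_add_self if_cancel)
      next
        case 2
        have "(i - (6 * m + 2)) mod 3 \<noteq> 2" if "m \<le> 2 * s" for m
        proof -
          have "m < q" using 2 that ij(2) s(1) by linarith
          then obtain d where "q = Suc (m + d)" using less_imp_Suc_add by blast
          then have "i - (6 * m + 2) = 3 * (2 * d + 1) + 1" using 2 by simp
          then show ?thesis by (simp only: mod_mult_self4)
        qed
        then show ?thesis by (intro vanish) (simp only: term_eq if_False power_0 min_0R power_one_right char2_add_self if_cancel)
      next
        case 3
        have "(i - (6 * m + 2)) mod 3 \<noteq> 2" if "m \<le> 2 * s" for m
        proof -
          have "i - (6 * m + 2) = 3 * (2 * (q - m))" using 3 by simp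
          then show ?thesis by simp
        qed
        then show ?thesis by (intro vanish) (simp only: term_eq if_False power_0 min_0R power_one_right char2_add_self if_cancel)
      next
        case 4
        obtain b where b: "q = 2 * s + 1 + b" "b \<le> 2 * s"
        proof (rule that)
          show "q = 2 * s + 1 + (q - (2 * s + 1))" "q - (2 * s + 1) \<le> 2 * s"
            using 4 ij s(1) by auto
        qed
        have "f m = dyadic \<mu> (int b) (int m)"
          if m: "m \<le> 2 * s" for m
        proof -
          have e: "int (i - (6 * m + 2)) = 2 ^ n + 6 * (int b - int m)"
          proof -
            have "int (2 ^ n) = 12 * int s + 8" unfolding N_def[symmetric] s(1) by simp
            then show ?thesis using 4 b m by simp
          qed
          have "int (i - (6 * m + 2)) = 3 * (4 * int s + 2 + 2 * (int b - int m)) + 2" using 4 b m by simp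
          then have "int (i - (6 * m + 2)) mod 3 = 2" by (simp only: mod_mult_self4) simp
          then have "int ((i - (6 * m + 2)) mod 3) = int 2" by (simp only: zmod_int of_nat_numeral)
          then have m3: "(i - (6 * m + 2)) mod 3 = 2" by (simp only: of_nat_eq_iff)
          show ?thesis
          proof (cases "b = m")
            case True
            have "int (i - (6 * m + 2)) = int (2 ^ n)" unfolding e using True by simp
            then have "i - (6 * m + 2) = 2 ^ n" by (simp only: of_nat_eq_iff)
            then show ?thesis unfolding term_eq[OF m] using m3 True per(1)
              by (simp add: dyadic_def)
          next
            case False
            have "\<bar>int b - int m\<bar> < 2 ^ (n - 2)" using b m s(2) by simp
            from multiplicity_shift[OF e _ this n(2)] False
            show ?thesis unfolding term_eq[OF m] using m3 by (simp add: dyadic_def \<mu>_def)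
          qed
        qed
        then have "bcoeff (w * ?c) i j = (\<Sum>m\<le>2 * s. dyadic \<mu> (int b) (int m) * a (int m))"
          unfolding sum_eq by (intro sum.cong) (simp_all add: mult.commute)
        also have "\<dots> = (\<Sum>j\<in>T. dyadic \<mu> (int b) j * a j)"
          unfolding T by (subst sum.reindex) simp_all
        also have "\<dots> = 0" by (rule a(1)) (use b in \<open>simp add: T_def\<close>)
        finally show ?thesis .
      qed
    qed
    show "EE * w * ?c \<in> xy_ideal (2 * 2 ^ n) (2 * 2 ^ n)"
      unfolding N_def[symmetric] xy_ideal_iff_bcoeff mult.assoc
    proof (intro allI impI)
      fix i j assume lt: "i < 2 * N" "j < 2 * N"
      show "bcoeff (EE * (w * ?c)) i j = 0"
      proof (cases "i + j = 3 * N - 1")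
        case True
        then show ?thesis unfolding bcoeff_EE_mult using lt s(1) by (simp add: zero)
      next
        case False
        have "homog (3 + (2 ^ n - 4 + 2 * 2 ^ n)) (EE * (w * ?c))"
          by (intro homog_mult homog_EE \<open>homog (2 ^ n - 4) w\<close> homog_constc)
        moreover have "3 + (2 ^ n - 4 + 2 * 2 ^ n) = 3 * N - 1" unfolding N_def[symmetric] s(1) by simp
        ultimately show ?thesis using False unfolding homog_def by metis
      qed
    qed
  qed
qed

section \<open>A form outside a monomial ideal\<close>

lemma EE_quadc_odd:
  "odd m \<Longrightarrow> EE * quadc DD EE m = (vx * vy ^ (2 * 2 ^ m) + vx ^ (2 * 2 ^ m) * vy :: 'k :: {idom, char2} poly poly)"
  by (simp add: E_quadc[OF EE_nonzero])

lemma EE_quadc_even: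
  "even m \<Longrightarrow> EE * quadc DD EE m = (vx ^ (2 * 2 ^ m) * vx + vy ^ (2 * 2 ^ m) * vy :: 'k :: {idom, char2} poly poly)"
  by (simp add: E_quadc[OF EE_nonzero] mult.commute)

lemma EE_quadc_xy_ideal:
  obtains f g where "EE * quadc DD EE m = (vx ^ (2 * 2 ^ m) * f + vy ^ (2 * 2 ^ m) * g :: 'k :: {idom, char2} poly poly)"
proof (cases "even m")
  case True then show ?thesis using that EE_quadc_even by blast
next
  case False
  show ?thesis by (rule that[of vy vx], unfold EE_quadc_odd[OF False]) (simp only: ac_simps)
qed

lemma EE_quadc_in_xy_ideal: "EE * quadc DD EE m \<in> (xy_ideal (2 * 2 ^ m) (2 * 2 ^ m) :: 'k :: {idom, char2} poly poly set)"
proof -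
  obtain f g where "EE * quadc DD EE m = (vx ^ (2 * 2 ^ m) * f + vy ^ (2 * 2 ^ m) * g :: 'k poly poly)"
    by (rule EE_quadc_xy_ideal)
  then show ?thesis unfolding xy_ideal_def by blast
qed

lemma EE_linc_in_xy_ideal: "EE * linc DD EE m \<in> (xy_ideal (2 * 2 ^ m) (2 * 2 ^ m) :: 'k :: {idom, char2} poly poly set)"
proof (cases m)
  case (Suc k)
  have "(EE * quadc DD EE k) ^ 2 \<in> (xy_ideal (2 * (2 * 2 ^ k)) (2 * (2 * 2 ^ k)) :: 'k poly poly set)"
    by (rule xy_ideal_square[OF EE_quadc_in_xy_ideal])
  moreover have "EE * linc DD EE m = ((EE * quadc DD EE k) ^ 2 :: 'k poly poly)"
    unfolding Suc by (simp only: linc.simps power2_eq_square mult_ac)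
  ultimately show ?thesis unfolding Suc by simp
qed simp

lemma xy_ideal_vy_shift: "p \<in> xy_ideal a b \<Longrightarrow> vy ^ c * p \<in> xy_ideal a (b + c)"
  using xy_ideal_shift[of 0 c p a b] by simp

lemma xy_ideal_square_step:
  fixes f :: "'k :: char2 poly poly"
  assumes "f * c \<in> xy_ideal a b" "f * (DD * v) \<in> xy_ideal a b"
  shows "f ^ 2 * (c ^ 2 + t * (DD * v) ^ 2) \<in> xy_ideal (2 * a) (2 * b)"
proof -
  have "f ^ 2 * (c ^ 2 + t * (DD * v) ^ 2) = (f * c) ^ 2 + t * (f * (DD * v)) ^ 2"
    by (simp only: distrib_left power_mult_distrib mult_ac)
  then show ?thesis using xy_ideal_square[OF assms(1)] xy_ideal_mult[OF xy_ideal_square[OF assms(2)]] by (simp add: xy_ideal_add)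
qed

lemma EE_power_7: "(EE :: 'k :: char2 poly poly) ^ 7 * q = EE * ((vx ^ 6 + vy ^ 6) * ((vx ^ 12 + vy ^ 12) * q))"
proof -
  have "(EE :: 'k poly poly) ^ 7 = EE ^ Suc (2 + 4)" by simp
  also have "\<dots> = EE * (EE ^ 2 * EE ^ 4)" by (simp only: power_add power_Suc)
  also have "(EE :: 'k poly poly) ^ 2 = vx ^ 6 + vy ^ 6"
    unfolding char2_square_add by (simp flip: power_mult)
  also have "(EE :: 'k poly poly) ^ 4 = vx ^ 12 + vy ^ 12"
    unfolding char2_power4_add by (simp flip: power_mult)
  finally show ?thesis by (simp only: mult.assoc)
qed

lemma bcoeff_binomial_mult:
  "a \<le> i \<Longrightarrow> a \<le> j \<Longrightarrow> bcoeff ((vx ^ a + vy ^ a) * p) i j = bcoeff p (i - a) j + bcoeff p i (j - a)"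
  by (simp add: distrib_right bcoeff_vx_mult bcoeff_vy_mult)

lemma frobenius_step_eq:
  "t * (f * (d * v)) ^ 2 + (f * c + u) ^ 2 = f ^ 2 * (c ^ 2 + t * (d * v) ^ 2) + u ^ 2" for t :: "'a :: char2"
  by (simp add: char2_square_add power_mult_distrib algebra_simps)

text \<open>Here \<open>w\<close> is the form of \<open>annihilator_exists\<close> and \<open>syz = E w\<close>.\<close>

context
  fixes l :: "'k :: {field, char2}" and n :: nat and w :: "'k poly poly" and N :: nat
  assumes n: "odd n" "3 \<le> n" and N: "N = 2 ^ n"
    and l: "l ^ 2 \<noteq> l"
    and homog_w: "homog (N - 4) w"
    and supp_w: "\<forall>i j. bcoeff w i j \<noteq> 0 \<longrightarrow> i mod 6 = 2"
    and mid_w: "bcoeff w (N div 2 - 2) (N div 2 - 2) \<noteq> 0"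
begin

abbreviation "quadk m \<equiv> (quadc DD EE m :: 'k poly poly)"
abbreviation "constk m \<equiv> constc DD EE (scalar (l ^ 2 + l)) m"
abbreviation "syz \<equiv> EE * w"

lemma N_eq: obtains M where "N = 8 * M" "2 ^ (n - 1) = 4 * M" "2 ^ (n - 2) = 2 * M" "M \<ge> 1"
proof -
  obtain k where k: "n = k + 3" using n(2) by (metis le_add_diff_inverse2)
  show thesis by (rule that[of "2 ^ k"]) (simp_all add: N k power_add)
qed

lemma hom_syz: "homog (N - 1) syz"
proof -
  obtain M where "N = 8 * M" "M \<ge> 1" using N_eq by metis
  then have "N - 1 = 3 + (N - 4)" by simp
  then show ?thesis using homog_mult[OF homog_EE homog_w] by (simp only:)
qed

lemma syz_xy_ideal: "syz \<in> xy_ideal (N div 2) (N div 2)"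
proof (rule homog_xy_ideal[OF hom_syz])
  obtain M where "N = 8 * M" "M \<ge> 1" using N_eq by metis
  then show "N div 2 + N div 2 \<le> N - 1 + 1" by simp
qed

lemma syz_power_xy_ideal: "syz ^ (8 * 2 ^ k) \<in> xy_ideal (4 * N * 2 ^ k) (4 * N * 2 ^ k)"
proof -
  obtain M where M: "N = 8 * M" "M \<ge> 1" using N_eq by metis
  have "syz ^ (2 ^ (k + 3)) \<in> xy_ideal (2 ^ (k + 3) * (N div 2)) (2 ^ (k + 3) * (N div 2))"
    by (rule xy_ideal_frobenius[OF syz_xy_ideal])
  moreover have "8 * 2 ^ k = (2 :: nat) ^ (k + 3)" by (simp add: power_add)
  moreover have "4 * N * 2 ^ k = 2 ^ (k + 3) * (N div 2)" by (simp add: power_add M)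
  ultimately show ?thesis by (simp only:)
qed

text \<open>\<open>E quadk\<close> is a combination of \<open>x^(4 N 2^k)\<close> and \<open>y^(4 N 2^k)\<close>.  The first summand is in the ideal; the other one
  only has half of the required power of \<open>y\<close>, and \<open>syz^(8 2^k)\<close> supplies the other half, because the degree
  \<open>N - 1\<close> of \<open>syz\<close> is just large enough for \<open>(x^(N/2), y^(N/2))\<close>.\<close>

lemma kill_quadk: "EE ^ (2 ^ k) * syz ^ (8 * 2 ^ k) * quadk (n + 1 + k) \<in> xy_ideal (4 * N * 2 ^ k) (8 * N * 2 ^ k)"
proof -
  have e: "2 * 2 ^ (n + 1 + k) = 4 * N * 2 ^ k" by (simp add: N power_add)
  obtain f g where fg: "EE * quadk (n + 1 + k) = vx ^ (4 * N * 2 ^ k) * f + vy ^ (4 * N * 2 ^ k) * g"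
    using EE_quadc_xy_ideal[of "n + 1 + k"] unfolding e by blast
  have "EE ^ (2 ^ k) = EE * (EE :: 'k poly poly) ^ (2 ^ k - 1)"
    by (simp only: Suc_diff_1 zero_less_power zero_less_numeral flip: power_Suc)
  then have "EE ^ (2 ^ k) * syz ^ (8 * 2 ^ k) * quadk (n + 1 + k) =
      EE ^ (2 ^ k - 1) * syz ^ (8 * 2 ^ k) * (EE * quadk (n + 1 + k))"
    by (simp only: mult_ac)
  also have "\<dots> = vx ^ (4 * N * 2 ^ k) * (EE ^ (2 ^ k - 1) * syz ^ (8 * 2 ^ k) * f) +
      vy ^ (4 * N * 2 ^ k) * (EE ^ (2 ^ k - 1) * g * syz ^ (8 * 2 ^ k))"
    unfolding fg by (simp only: distrib_left mult_ac add_ac)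
  also have "\<dots> \<in> xy_ideal (4 * N * 2 ^ k) (4 * N * 2 ^ k + 4 * N * 2 ^ k)"
    by (intro xy_ideal_add xy_ideal_vx xy_ideal_vy_shift xy_ideal_mult syz_power_xy_ideal) simp
  also have "4 * N * 2 ^ k + 4 * N * 2 ^ k = 8 * N * 2 ^ k" by simp
  finally show ?thesis .
qed

definition theta :: "'k poly poly" where "theta = EE * syz ^ 8 * constk (n + 1)"

text \<open>In the recursion for the constant coefficient, the terms that are not Frobenius powers of \<open>theta\<close> are
  squares of multiples of \<open>quadk\<close>, and these are killed.\<close>

lemma theta_power:
  "EE ^ (2 ^ k) * syz ^ (8 * 2 ^ k) * constk (n + 1 + k) + theta ^ (2 ^ k) \<in> xy_ideal (4 * N * 2 ^ k) (8 * N * 2 ^ k)"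
proof (induction k)
  case 0 show ?case by (simp add: theta_def)
next
  case (Suc k)
  let ?R = "EE ^ (2 ^ k) * syz ^ (8 * 2 ^ k)"
  have R: "EE ^ (2 ^ Suc k) * syz ^ (8 * 2 ^ Suc k) = ?R ^ 2"
    by (simp only: power_2_Suc power_mult_distrib power_mult)
  have "?R * (DD * quadk (n + 1 + k)) \<in> xy_ideal (4 * N * 2 ^ k) (8 * N * 2 ^ k)"
    using xy_ideal_mult[OF kill_quadk[of k], of DD] by (simp only: mult_ac)
  note this[THEN xy_ideal_square, THEN xy_ideal_mult, of "scalar (l ^ 2 + l)"]
  moreover note xy_ideal_square[OF Suc]
  ultimately have "scalar (l ^ 2 + l) * (?R * (DD * quadk (n + 1 + k))) ^ 2 + (?R * constk (n + 1 + k) + theta ^ (2 ^ k)) ^ 2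
      \<in> xy_ideal (2 * (4 * N * 2 ^ k)) (2 * (8 * N * 2 ^ k))"
    by (rule xy_ideal_add)
  also have "scalar (l ^ 2 + l) * (?R * (DD * quadk (n + 1 + k))) ^ 2 + (?R * constk (n + 1 + k) + theta ^ (2 ^ k)) ^ 2 =
      ?R ^ 2 * (constk (n + 1 + k) ^ 2 + scalar (l ^ 2 + l) * (DD * quadk (n + 1 + k)) ^ 2) + (theta ^ (2 ^ k)) ^ 2"
    by (rule frobenius_step_eq)
  also have "\<dots> = EE ^ (2 ^ Suc k) * syz ^ (8 * 2 ^ Suc k) * constk (n + 1 + Suc k) + theta ^ (2 ^ Suc k)"
    by (simp only: R power_2_Suc[of theta] constc.simps add_Suc_right)
  also have "2 * (4 * N * 2 ^ k) = 4 * N * 2 ^ Suc k" by simp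
  also have "2 * (8 * N * 2 ^ k) = 8 * N * 2 ^ Suc k" by simp
  finally show ?case .
qed

text \<open>Unfold the constant coefficient three times.  The deepest terms vanish modulo the ideal for degree reasons
  (\<open>h1\<close>, \<open>h2\<close>), the next one by parity of exponents (\<open>h4\<close>).  What remains is
  \<open>(l^2 + l) x^4 y^(4 N + 2) E^7 w^8\<close>; in the monomial \<open>x^(4 N - 3) y^(8 N - 2)\<close> only one monomial of \<open>E^7\<close> can meet
  exponents of \<open>w^8\<close>, which are divisible by 8, and it meets the middle coefficient of \<open>w\<close>.\<close>

lemma theta_not_xy_ideal: "theta \<notin> xy_ideal (4 * N) (8 * N)"
proof
  assume theta: "theta \<in> xy_ideal (4 * N) (8 * N)"
  let ?al = "scalar (l ^ 2 + l)"
  obtain M where M: "N = 8 * M" "2 ^ (n - 1) = 4 * M" "2 ^ (n - 2) = 2 * M" "M \<ge> 1" by (rule N_eq)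
  have n': "n = Suc (n - 1)" "n - 1 = Suc (n - 2)" using n(2) by simp_all
  have c1: "constk (n + 1) = constk n ^ 2 + ?al * (DD * quadk n) ^ 2" by simp
  have c2: "constk n = constk (n - 1) ^ 2 + ?al * (DD * quadk (n - 1)) ^ 2" by (subst n'(1)) simp
  have c3: "constk (n - 1) = constk (n - 2) ^ 2 + ?al * (DD * quadk (n - 2)) ^ 2" by (subst n'(2)) simp
  have h1: "syz * constk (n - 2) \<in> xy_ideal (N div 2) N"
    by (rule homog_xy_ideal[OF homog_mult[OF hom_syz homog_constc]]) (use M in simp)
  have h2: "syz * (DD * quadk (n - 2)) \<in> xy_ideal (N div 2) N"
    by (rule homog_xy_ideal[OF homog_mult[OF hom_syz homog_mult[OF homog_DD homog_quadc]]]) (use M in simp)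
  have h3: "syz ^ 2 * constk (n - 1) \<in> xy_ideal N (2 * N)"
    unfolding c3 using xy_ideal_square_step[OF h1 h2] M(1) by simp
  have h4: "syz ^ 2 * (DD * quadk (n - 1)) \<in> xy_ideal N (2 * N)"
  proof -
    have e: "2 * 2 ^ (n - 1) = N" using M by simp
    have "EE * quadk (n - 1) = vx ^ N * vx + vy ^ N * vy"
      unfolding EE_quadc_even[of "n - 1"] e using EE_quadc_even[of "n - 1", where 'k='k] n unfolding e by simp
    have "syz ^ 2 * (DD * quadk (n - 1)) = EE * w ^ 2 * DD * (EE * quadk (n - 1))"
      by (simp add: power2_eq_square mult_ac)
    also have "\<dots> = vx ^ N * (EE * w ^ 2 * DD * vx) + vy ^ N * (EE * w ^ 2 * DD * vy)"
      unfolding \<open>EE * quadk (n - 1) = _\<close> by (simp only: distrib_left mult_ac add_ac)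
    also have "\<dots> \<in> xy_ideal N (N + N)"
    proof (intro xy_ideal_add xy_ideal_vx xy_ideal_vy_shift)
      show "EE * w ^ 2 * DD * vy \<in> xy_ideal N N"
        unfolding xy_ideal_iff_bcoeff
      proof (intro allI impI)
        fix i j assume ij: "i < N" "j < N"
        have "homog (3 + 2 * (N - 4) + 2 + 1) (EE * w ^ 2 * DD * vy)"
          using homog_vy[of 1] by (intro homog_mult homog_EE homog_power homog_w homog_DD) simp
        moreover have "3 + 2 * (N - 4) + 2 + 1 = 2 * N - 2" using M by simp
        ultimately have homog: "bcoeff (EE * w ^ 2 * DD * vy) i j \<noteq> 0 \<Longrightarrow> i + j = 2 * N - 2"
          unfolding homog_def by metis
        \<comment> \<open>only \<open>i = j = N - 1\<close> has the right degree, and the exponents of \<open>w^2\<close> are divisible by 4\<close>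
        show "bcoeff (EE * w ^ 2 * DD * vy) i j = 0"
        proof (rule ccontr)
          assume nz: "bcoeff (EE * w ^ 2 * DD * vy) i j \<noteq> 0"
          then have ij: "i = N - 1" "j = N - 1" using homog ij by simp_all
          have eq: "EE * w ^ 2 * DD * vy = vx ^ 4 * (vy ^ 2 * w ^ 2) + vx ^ 1 * (vy ^ 5 * w ^ 2)"
            by (simp add: algebra_simps eval_nat_numeral)
          have "4 \<le> i" "2 \<le> j" "1 \<le> i" "5 \<le> j" using ij M by simp_all
          then have "bcoeff (EE * w ^ 2 * DD * vy) i j = bcoeff (w ^ 2) (i - 4) (j - 2) + bcoeff (w ^ 2) (i - 1) (j - 5)"
            by (simp only: eq bcoeff_simps bcoeff_vx_mult bcoeff_vy_mult if_True)
          moreover have "bcoeff (w ^ 2) (i - 4) (j - 2) = 0" unfolding bcoeff_square using ij M by simp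
          moreover have w0: "bcoeff w (N div 2 - 1) j' = 0" for j'
          proof (rule ccontr)
            assume "bcoeff w (N div 2 - 1) j' \<noteq> 0"
            then have "(N div 2 - 1) mod 6 = 2" using supp_w by blast
            then have "even (N div 2 - 1)" by (metis even_numeral dvd_mod_iff[of 2 6])
            then show False using M by simp
          qed
          then have "bcoeff (w ^ 2) (i - 1) (j - 5) = 0"
          proof -
            have "(i - 1) div 2 = N div 2 - 1" unfolding ij M(1) using M(4) by (cases M) simp_all
            then show ?thesis unfolding bcoeff_square by (simp only: w0) simp
          qed
          ultimately show False using nz by simp
        qed
      qed
    qed simp
    finally show ?thesis by (simp only: mult_2)
  qed
  have "(syz ^ 2) ^ 2 * constk n \<in> xy_ideal (2 * N) (2 * (2 * N))"
    unfolding c2 by (rule xy_ideal_square_step[OF h3 h4])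
  then have "((syz ^ 2) ^ 2 * constk n) ^ 2 \<in> xy_ideal (4 * N) (8 * N)"
    by (drule_tac xy_ideal_square) simp
  then have h5: "EE * (syz ^ 8 * constk n ^ 2) \<in> xy_ideal (4 * N) (8 * N)"
    by (intro xy_ideal_mult[of "syz ^ 8 * constk n ^ 2"]) (simp add: power_mult_distrib flip: power_mult)
  have theta_eq: "theta = EE * (syz ^ 8 * constk n ^ 2) + EE * (syz ^ 8 * (?al * (DD * quadk n) ^ 2))"
    unfolding theta_def c1 by (simp only: distrib_left mult_ac add_ac)
  have "EE * (syz ^ 8 * (?al * (DD * quadk n) ^ 2)) \<in> xy_ideal (4 * N) (8 * N)"
    using theta xy_ideal_add_iff[OF h5] unfolding theta_eq by blast
  also have "EE * (syz ^ 8 * (?al * (DD * quadk n) ^ 2)) = ?al * (EE ^ 7 * w ^ 8) * DD ^ 2 * (EE * quadk n) ^ 2"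
    unfolding power_mult_distrib by (simp add: eval_nat_numeral mult_ac)
  also have "\<dots> = vx ^ (4 * N) * (?al * (EE ^ 7 * w ^ 8) * DD ^ 2 * vy ^ 2) +
      ?al * (vx ^ 4 * (vy ^ (4 * N + 2) * (EE ^ 7 * w ^ 8)))"
    unfolding EE_quadc_odd[OF n(1)] N[symmetric] char2_square_add power_mult_distrib
    by (simp add: algebra_simps power_add flip: power_mult) (simp add: eval_nat_numeral mult_ac)
  finally have in_id: "?al * (vx ^ 4 * (vy ^ (4 * N + 2) * (EE ^ 7 * w ^ 8))) \<in> xy_ideal (4 * N) (8 * N)"
    using xy_ideal_add_iff[OF xy_ideal_vx[of "4 * N" "4 * N"]] by blast
  have w8: "bcoeff (w ^ 8) i j = (if 8 dvd i \<and> 8 dvd j then bcoeff w (i div 8) (j div 8) ^ 8 else 0)" for i j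
  proof -
    have eight: "(2 :: nat) ^ 3 = 8" by simp
    show ?thesis by (simp add: bcoeff_def coeff_frobenius[where k = 3, unfolded eight])
  qed
  have "0 = bcoeff (?al * (vx ^ 4 * (vy ^ (4 * N + 2) * (EE ^ 7 * w ^ 8)))) (4 * N - 3) (8 * N - 2)"
    using in_id M unfolding xy_ideal_iff_bcoeff by simp
  also have "\<dots> = (l ^ 2 + l) * bcoeff (EE ^ 7 * w ^ 8) (4 * N - 7) (4 * N - 4)"
  proof -
    have "4 \<le> 4 * N - 3" "4 * N + 2 \<le> 8 * N - 2" "4 * N - 3 - 4 = 4 * N - 7"
      "8 * N - 2 - (4 * N + 2) = 4 * N - 4" using M(1,4) by linarith+
    then show ?thesis by (simp only: bcoeff_scalar_mult bcoeff_vx_mult bcoeff_vy_mult if_True)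
  qed
  also have "bcoeff (EE ^ 7 * w ^ 8) (4 * N - 7) (4 * N - 4) = bcoeff w (N div 2 - 2) (N div 2 - 2) ^ 8"
  proof -
    have odd_part: "bcoeff (w ^ 8) i j = 0" if "i + d = 8 * (4 * M)" "\<not> 8 dvd d" for i j d
    proof -
      have "\<not> 8 dvd i" using that by (metis dvd_add_right_iff dvd_triv_left)
      then show ?thesis by (simp add: w8)
    qed
    have zero: "bcoeff (w ^ 8) (32 * M - d) j = 0" if "d \<le> 32" "\<not> 8 dvd d" for j d
      by (rule odd_part[OF _ that(2)]) (use that M(4) in simp)
    have "32 * M - 16 = 8 * (4 * M - 2)" by simp
    then have one: "bcoeff (w ^ 8) (32 * M - 16) (32 * M - 16) = bcoeff w (4 * M - 2) (4 * M - 2) ^ 8"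
      unfolding w8 by simp
    show ?thesis unfolding EE_power_7 using M(4)
      by (simp add: M(1) bcoeff_binomial_mult zero one)
  qed
  finally show False using mid_w l by (auto simp: char2_eq_iff[symmetric])
qed

end

section \<open>The special fibres\<close>

lemma monic_division:
  fixes f g :: "'a :: comm_ring_1 poly"
  assumes "lead_coeff g = 1" "0 < degree g"
  obtains q r where "f = q * g + r" "degree r < degree g"
proof -
  obtain q r where qr: "pseudo_divmod f g = (q, r)" by fastforce
  have "g \<noteq> 0" using assms(2) by auto
  from pseudo_divmod[OF this qr] assms show thesis
    by (intro that[of q r]) (auto simp: mult.commute)
qed

lemma quartic_poly: "quartic [:D:] [:E:] [:t:] [:0, 1:] = [:t * D ^ 2, E, D, 0, 1:]"
  by (simp add: quartic_def eval_nat_numeral)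

lemma const_quadc: "quadc [:D:] [:E:] m = [:quadc D E m:]"
  by (rule quadc_ring_hom[symmetric]) simp_all

lemma const_linc: "linc [:D:] [:E:] m = [:linc D E m:]"
  by (cases m) (simp_all add: const_quadc poly_const_pow)

lemma const_constc: "constc [:D:] [:E:] [:t:] m = [:constc D E t m:]"
  by (induction m) (simp_all add: const_quadc poly_const_pow power_mult_distrib)

text \<open>The quartic in \<open>z\<close> at the parameter value \<open>t\<close>.\<close>

definition qpoly :: "'k :: char2 \<Rightarrow> 'k poly poly poly" where
  "qpoly t = quartic [:DD:] [:EE:] [:scalar t:] [:0, 1:]"

lemma qpoly_degree: "degree (qpoly t) = 4" "lead_coeff (qpoly t) = 1"
  by (simp_all add: qpoly_def quartic_poly)

lemma power_mod_qpoly: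
  obtains h where "[:0, 1:] ^ (2 ^ Suc m) =
    h * qpoly t + ([:quadc DD EE m:] * [:0, 1:] ^ 2 + [:linc DD EE m:] * [:0, 1:] + [:constc DD EE (scalar t) m:])"
proof -
  from power_mod_quartic[of "[:DD:]" "[:EE:]" "[:scalar t:]" "[:0, 1:]" m]
  obtain h where "[:0, 1:] ^ (2 ^ Suc m) + ([:quadc DD EE m:] * [:0, 1:] ^ 2 + [:linc DD EE m:] * [:0, 1:] +
    [:constc DD EE (scalar t) m:]) = qpoly t * h"
    unfolding qpoly_def const_quadc const_linc const_constc by (rule dvdE)
  from char2_add_eq[OF this] show thesis by (intro that[of h]) (simp only: mult.commute)
qed

text \<open>The ideal \<open>(x^a, y^b, g)\<close> of \<open>k[x, y][z]\<close>.\<close>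

definition curve_ideal :: "'k :: char2 \<Rightarrow> nat \<Rightarrow> nat \<Rightarrow> 'k poly poly poly set" where
  "curve_ideal t a b = {[:vx ^ a:] * A + [:vy ^ b:] * B + h * qpoly t |A B h. True}"

lemma curve_idealI: "[:vx ^ a:] * A + [:vy ^ b:] * B + h * qpoly t \<in> curve_ideal t a b"
  unfolding curve_ideal_def by blast

lemma curve_ideal_add: "f \<in> curve_ideal t a b \<Longrightarrow> g \<in> curve_ideal t a b \<Longrightarrow> f + g \<in> curve_ideal t a b"
proof -
  assume "f \<in> curve_ideal t a b" "g \<in> curve_ideal t a b"
  then obtain A B h A' B' h' where "f = [:vx ^ a:] * A + [:vy ^ b:] * B + h * qpoly t"
    "g = [:vx ^ a:] * A' + [:vy ^ b:] * B' + h' * qpoly t" unfolding curve_ideal_def by blast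
  then have "f + g = [:vx ^ a:] * (A + A') + [:vy ^ b:] * (B + B') + (h + h') * qpoly t"
    by (simp only: distrib_left distrib_right add_ac)
  then show ?thesis by (simp only: curve_idealI)
qed

lemma curve_ideal_mult: "f \<in> curve_ideal t a b \<Longrightarrow> g * f \<in> curve_ideal t a b"
proof -
  assume "f \<in> curve_ideal t a b"
  then obtain A B h where "f = [:vx ^ a:] * A + [:vy ^ b:] * B + h * qpoly t" unfolding curve_ideal_def by blast
  then have "g * f = [:vx ^ a:] * (g * A) + [:vy ^ b:] * (g * B) + (g * h) * qpoly t"
    by (simp only: distrib_left mult_ac)
  then show ?thesis by (simp only: curve_idealI)
qed

lemma curve_ideal_qpoly: "h * qpoly t \<in> curve_ideal t a b"
  using curve_idealI[of a 0 b 0 h t] by simp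

lemma curve_ideal_const: "p \<in> xy_ideal a b \<Longrightarrow> [:p:] * f \<in> curve_ideal t a b"
proof -
  assume "p \<in> xy_ideal a b"
  then obtain u v where "p = vx ^ a * u + vy ^ b * v" unfolding xy_ideal_def by blast
  then have "[:p:] = [:vx ^ a:] * [:u:] + [:vy ^ b:] * [:v:]" by simp
  then have "[:p:] * f = [:vx ^ a:] * ([:u:] * f) + [:vy ^ b:] * ([:v:] * f) + 0 * qpoly t"
    by (simp only: distrib_right mult.assoc mult_zero_left add_0_right)
  then show ?thesis by (simp only: curve_idealI)
qed

lemma curve_ideal_frobenius: "f \<in> curve_ideal t a b \<Longrightarrow> f ^ (2 ^ k) \<in> curve_ideal t (2 ^ k * a) (2 ^ k * b)"
proof -
  assume "f \<in> curve_ideal t a b"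
  then obtain A B h where f: "f = [:vx ^ a:] * A + [:vy ^ b:] * B + h * qpoly t" unfolding curve_ideal_def by blast
  have e: "[:p ^ c:] ^ (2 ^ k) = [:p ^ (2 ^ k * c):]" for p :: "'a poly poly" and c
    by (simp add: poly_const_pow mult.commute flip: power_mult)
  have g: "qpoly t ^ (2 ^ k) = qpoly t ^ (2 ^ k - 1) * qpoly t"
    by (simp flip: power_Suc2)
  have "f ^ (2 ^ k) = [:vx ^ (2 ^ k * a):] * A ^ (2 ^ k) + [:vy ^ (2 ^ k * b):] * B ^ (2 ^ k) +
      (h ^ (2 ^ k) * qpoly t ^ (2 ^ k - 1)) * qpoly t"
    unfolding f char2_power_add power_mult_distrib e by (simp only: g mult.assoc)
  then show ?thesis by (simp only: curve_idealI)
qed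

text \<open>\<open>k[x, y][z] / (g)\<close> is free over \<open>k[x, y]\<close> with basis \<open>1, z, z^2, z^3\<close>, so membership of a reduced polynomial can be
  tested on its coefficients.\<close>

lemma curve_ideal_coeff:
  fixes t :: "'k :: {idom, char2}"
  assumes f: "f \<in> curve_ideal t a b" "degree f < 4"
  shows "Polynomial.coeff f i \<in> xy_ideal a b"
proof -
  obtain A B h where eq: "f = [:vx ^ a:] * A + [:vy ^ b:] * B + h * qpoly t" using f(1) unfolding curve_ideal_def by blast
  have deg: "0 < degree (qpoly t)" "lead_coeff (qpoly t) = 1" using qpoly_degree[of t] by auto
  obtain q1 r1 where A: "A = q1 * qpoly t + r1" "degree r1 < 4"
    using monic_division[OF deg(2,1), of A] qpoly_degree by metis
  obtain q2 r2 where B: "B = q2 * qpoly t + r2" "degree r2 < 4"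
    using monic_division[OF deg(2,1), of B] qpoly_degree by metis
  let ?r = "[:vx ^ a:] * r1 + [:vy ^ b:] * r2" and ?q = "[:vx ^ a:] * q1 + [:vy ^ b:] * q2 + h"
  have f_eq: "f = ?r + ?q * qpoly t"
    unfolding eq A B by (simp only: distrib_left distrib_right mult.assoc add_ac)
  have "degree ?r < 4"
    using A(2) B(2) by (intro degree_add_less le_less_trans[OF degree_smult_le]) (simp_all add: le_less_trans[OF degree_smult_le])
  then have "degree (f + ?r) < 4" by (rule degree_add_less[OF f(2)])
  moreover have "f + ?r = ?q * qpoly t" unfolding f_eq by (simp only: char2_add_left_self add.commute[of _ ?r])
  ultimately have "degree (?q * qpoly t) < 4" by simp
  have "?q = 0"
  proof (rule ccontr)
    assume "?q \<noteq> 0"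
    then have "degree (?q * qpoly t) = degree ?q + 4"
      using deg by (subst degree_mult_eq) (auto simp: qpoly_degree)
    then show False using \<open>degree (?q * qpoly t) < 4\<close> by simp
  qed
  then have "f = ?r" using f_eq by simp
  then have "Polynomial.coeff f i = vx ^ a * Polynomial.coeff r1 i + vy ^ b * Polynomial.coeff r2 i" by simp
  then show ?thesis unfolding xy_ideal_def by blast
qed

lemma multiply_out: "R * (d * (v * (h * g + (a * y + b * z + c)))) =
    R * v * d * h * g + ((v * (R * a)) * (d * y) + (v * (R * b)) * (d * z)) + (v * (R * c)) * d"
  for R :: "'a :: comm_ring_1"
  by (simp add: algebra_simps)

text \<open>With \<open>p = 2^k\<close> and \<open>q = 4 N p\<close>, multiply the membership of \<open>d u^q\<close> by \<open>R = E^p r^(8 p)\<close>.  The factor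
  \<open>r^(8 p)\<close> absorbs \<open>z^(4 q) = (z^(2 N))^(8 p)\<close>.  On the left, \<open>z^q\<close> is quadratic in \<open>z\<close>, and \<open>R\<close> kills its
  quadratic and linear coefficients, so only \<open>d\<close> times the constant coefficient is left; modulo the ideal the
  latter is \<open>theta^p\<close>.\<close>

lemma not_in_closure_special:
  fixes l :: "'k :: {field, char2}" and d :: "'k poly poly poly"
  assumes n: "odd n" "3 \<le> n" and per: "l ^ (2 ^ n) = l" "\<And>j. 0 < j \<Longrightarrow> j < n \<Longrightarrow> l ^ (2 ^ j) \<noteq> l"
    and d: "d \<noteq> 0" "degree d < 4"
    and mem: "\<And>e. \<exists>A B C h. d * ([:vx ^ 3 * vy ^ 2:] * [:0, 1:]) ^ (2 ^ e) =
      [:vx ^ (4 * 2 ^ e):] * A + [:vy ^ (4 * 2 ^ e):] * B + [:0, 1:] ^ (4 * 2 ^ e) * C + h * qpoly (l ^ 2 + l)"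
  shows False
proof -
  define N :: nat where "N = 2 ^ n"
  define t where "t = l ^ 2 + l"
  have l2: "l ^ 2 \<noteq> l" using per(2)[of 1] n(2) by simp
  obtain w where w: "homog (N - 4) w" "\<forall>i j. bcoeff w i j \<noteq> 0 \<longrightarrow> i mod 6 = 2"
    "bcoeff w (N div 2 - 2) (N div 2 - 2) \<noteq> 0" "EE * w * constc DD EE (scalar t) n \<in> xy_ideal (2 * N) (2 * N)"
    using annihilator_exists[OF n per] unfolding N_def t_def by metis
  note ctx = n N_def l2 w(1-3)
  define r where "r = EE * w"
  have ra: "r * quadc DD EE n \<in> xy_ideal (2 * N) (2 * N)"
    using xy_ideal_mult[OF EE_quadc_in_xy_ideal[of n], of w] unfolding r_def N_def by (simp only: mult_ac)
  have rb: "r * linc DD EE n \<in> xy_ideal (2 * N) (2 * N)"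
    using xy_ideal_mult[OF EE_linc_in_xy_ideal[of n], of w] unfolding r_def N_def by (simp only: mult_ac)
  have rz: "[:r:] * [:0, 1:] ^ (2 * N) \<in> curve_ideal t (2 * N) (2 * N)"
  proof -
    have e: "2 * N = 2 ^ Suc n" by (simp add: N_def)
    obtain h where h: "[:0, 1:] ^ (2 ^ Suc n) =
      h * qpoly t + ([:quadc DD EE n:] * [:0, 1:] ^ 2 + [:linc DD EE n:] * [:0, 1:] + [:constc DD EE (scalar t) n:])"
      by (rule power_mod_qpoly)
    have "[:r:] * [:0, 1:] ^ (2 ^ Suc n) = [:r:] * h * qpoly t +
       ([:r * quadc DD EE n:] * [:0, 1:] ^ 2 + [:r * linc DD EE n:] * [:0, 1:] + [:r * constc DD EE (scalar t) n:] * 1)"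
    proof -
      have c: "[:r * p:] = [:r:] * [:p:]" for p by simp
      show ?thesis unfolding h c by (simp only: distrib_left mult.assoc mult_1_right)
    qed
    also have "\<dots> \<in> curve_ideal t (2 * N) (2 * N)"
      by (intro curve_ideal_add curve_ideal_qpoly curve_ideal_const ra rb w(4)[folded r_def])
    finally show ?thesis unfolding e .
  qed
  have main: "Polynomial.coeff d i * theta l n w ^ (2 ^ k) \<in> xy_ideal (2 ^ k * (4 * N)) (2 ^ k * (8 * N))"
    if k: "k \<ge> 1" for i k
  proof -
    define m where "m = n + 1 + k"
    define q where "q = 4 * N * 2 ^ k"
    have q: "q = 2 ^ Suc m" "2 * q = 8 * N * 2 ^ k" "4 * q = 2 ^ (k + 3) * (2 * N)"
      by (simp_all add: q_def m_def N_def power_add)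
    define R where "R = EE ^ (2 ^ k) * r ^ (8 * 2 ^ k)"
    let ?z = "[:0, 1:] :: 'k poly poly poly"
    obtain A B C h where eq: "d * ([:vx ^ 3 * vy ^ 2:] * ?z) ^ q =
        [:vx ^ (4 * q):] * A + [:vy ^ (4 * q):] * B + ?z ^ (4 * q) * C + h * qpoly t"
      using mem[of "Suc m"] unfolding q(1)[symmetric] t_def by blast
    have "[:r ^ (8 * 2 ^ k):] * ?z ^ (4 * q) = ([:r:] * ?z ^ (2 * N)) ^ (2 ^ (k + 3))"
      unfolding power_mult_distrib q(3) by (simp add: poly_const_pow power_add mult_ac flip: power_mult)
    also have "\<dots> \<in> curve_ideal t (4 * q) (4 * q)"
      unfolding q(3) by (rule curve_ideal_frobenius[OF rz])
    finally have rzq: "[:r ^ (8 * 2 ^ k):] * ?z ^ (4 * q) \<in> curve_ideal t (4 * q) (4 * q)" .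
    have "[:R:] * (d * ([:vx ^ 3 * vy ^ 2:] * ?z) ^ q) =
        [:R:] * ([:vx ^ (4 * q):] * A + [:vy ^ (4 * q):] * B + h * qpoly t) +
        ([:EE ^ (2 ^ k):] * C) * ([:r ^ (8 * 2 ^ k):] * ?z ^ (4 * q))"
    proof -
      have "[:R:] = [:EE ^ (2 ^ k):] * [:r ^ (8 * 2 ^ k):]" unfolding R_def by simp
      then show ?thesis unfolding eq by (simp only: distrib_left mult_ac add_ac)
    qed
    also have "\<dots> \<in> curve_ideal t (4 * q) (4 * q)"
      by (intro curve_ideal_add[OF curve_ideal_mult[OF curve_idealI] curve_ideal_mult[OF rzq]])
    finally have lhs: "[:R:] * (d * ([:vx ^ 3 * vy ^ 2:] * ?z) ^ q) \<in> curve_ideal t (4 * q) (4 * q)" .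
    obtain h1 where h1: "?z ^ q =
      h1 * qpoly t + ([:quadc DD EE m:] * ?z ^ 2 + [:linc DD EE m:] * ?z + [:constc DD EE (scalar t) m:])"
      using power_mod_qpoly[of m t] unfolding q(1) by blast
    let ?v = "vx ^ (3 * q) * vy ^ (2 * q) :: 'k poly poly"
    have v: "([:vx ^ 3 * vy ^ 2:] * ?z) ^ q = [:?v:] * ?z ^ q"
      by (simp only: power_mult_distrib poly_const_pow power_mult)
    have vm: "?v * p \<in> xy_ideal (4 * q) (4 * q) \<longleftrightarrow> p \<in> xy_ideal q (2 * q)" for p
      using xy_ideal_shift[of "3 * q" "2 * q" p q "2 * q"] by (simp add: mult.assoc)
    have Ra: "R * quadc DD EE m \<in> xy_ideal q (2 * q)"
      using kill_quadk[OF ctx, where k = k] unfolding R_def r_def m_def q(2) unfolding q_def .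
    have Rb: "R * linc DD EE m \<in> xy_ideal q (2 * q)"
    proof -
      obtain k' where k': "k = Suc k'" using k by (cases k) auto
      have m': "m = Suc (n + 1 + k')" by (simp add: m_def k')
      have "(EE ^ (2 ^ k') * r ^ (8 * 2 ^ k') * quadc DD EE (n + 1 + k')) ^ 2 \<in>
          xy_ideal (2 * (4 * N * 2 ^ k')) (2 * (8 * N * 2 ^ k'))"
        using kill_quadk[OF ctx, where k = k'] unfolding r_def by (rule xy_ideal_square)
      moreover have "R * linc DD EE m = EE * (EE ^ (2 ^ k') * r ^ (8 * 2 ^ k') * quadc DD EE (n + 1 + k')) ^ 2"
        unfolding R_def m' linc.simps k' power_Suc power_mult_distrib
        by (simp add: mult_ac flip: power_mult)
      moreover have "2 * (4 * N * 2 ^ k') = q" "2 * (8 * N * 2 ^ k') = 2 * q" by (simp_all add: q_def k')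
      ultimately show ?thesis by (simp only: xy_ideal_mult)
    qed
    let ?f = "[:?v * (R * constc DD EE (scalar t) m):] * d"
    define L where "L = [:R:] * (d * ([:vx ^ 3 * vy ^ 2:] * ?z) ^ q)"
    have c: "[:?v * (R * p):] = [:?v:] * ([:R:] * [:p:])" for p by simp
    have "L = [:R:] * [:?v:] * d * h1 * qpoly t +
        ([:?v * (R * quadc DD EE m):] * (d * ?z ^ 2) + [:?v * (R * linc DD EE m):] * (d * ?z)) + ?f"
      unfolding L_def v h1 c by (rule multiply_out)
    then have "?f + L = [:R:] * [:?v:] * d * h1 * qpoly t +
        ([:?v * (R * quadc DD EE m):] * (d * ?z ^ 2) + [:?v * (R * linc DD EE m):] * (d * ?z))"
      by (simp only: add.commute[of _ ?f] char2_add_left_self)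
    also have "\<dots> \<in> curve_ideal t (4 * q) (4 * q)"
      by (intro curve_ideal_add curve_ideal_qpoly curve_ideal_const) (simp_all only: vm Ra Rb)
    finally have "?f + L + L \<in> curve_ideal t (4 * q) (4 * q)"
      using lhs unfolding L_def by (rule curve_ideal_add)
    then have "?f \<in> curve_ideal t (4 * q) (4 * q)" by (simp only: add.assoc char2_add_self add_0_right)
    moreover have "degree ?f < 4" using d(2) by (simp add: le_less_trans[OF degree_smult_le])
    ultimately have "Polynomial.coeff ?f i \<in> xy_ideal (4 * q) (4 * q)" by (rule curve_ideal_coeff)
    then have "?v * (R * constc DD EE (scalar t) m * Polynomial.coeff d i) \<in> xy_ideal (4 * q) (4 * q)"
      by (simp add: mult.assoc)
    then have "R * constc DD EE (scalar t) m * Polynomial.coeff d i \<in> xy_ideal q (2 * q)" unfolding vm .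
    then have "Polynomial.coeff d i * (R * constc DD EE (scalar t) m) \<in> xy_ideal q (2 * q)" by (simp only: mult.commute)
    moreover have "Polynomial.coeff d i * (R * constc DD EE (scalar t) m + theta l n w ^ (2 ^ k)) \<in> xy_ideal q (2 * q)"
      using theta_power[OF ctx, where k = k] unfolding R_def r_def m_def q(2) unfolding q_def t_def by (rule xy_ideal_mult)
    ultimately have "Polynomial.coeff d i * theta l n w ^ (2 ^ k) \<in> xy_ideal q (2 * q)"
      using xy_ideal_add_iff unfolding distrib_left by blast
    then show ?thesis unfolding q(2) unfolding q_def by (simp only: mult_ac)
  qed
  have "Polynomial.coeff d (degree d) \<noteq> 0" using d(1) by simp
  from xy_ideal_frobenius_cancel[OF this main] have "theta l n w \<in> xy_ideal (4 * N) (8 * N)" .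
  then show False using theta_not_xy_ideal[OF ctx] by contradiction
qed

section \<open>The generic fibre\<close>

lemma homog_linc: "homog (2 * 2 ^ m - 1) (linc DD EE m :: 'k :: {idom, char2} poly poly)"
proof (cases m)
  case (Suc k)
  obtain j where "(2 :: nat) ^ k = Suc j" by (metis not0_implies_Suc power_eq_0_iff zero_neq_numeral)
  then have e: "2 * 2 ^ Suc k - 1 = 3 + 2 * (2 * 2 ^ k - 2 :: nat)" by simp
  show ?thesis unfolding Suc linc.simps e by (intro homog_mult homog_EE homog_power homog_quadc)
qed simp

definition lowpoly :: "nat \<Rightarrow> nat \<Rightarrow> 'k :: comm_ring_1 poly poly poly \<Rightarrow> bool" where
  "lowpoly K \<delta> f \<longleftrightarrow> (\<forall>i. homog \<delta> (Polynomial.coeff f i)) \<and> (\<forall>i\<ge>K. Polynomial.coeff f i = 0)"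

definition genconst :: "nat \<Rightarrow> 'k :: comm_ring_1 poly poly poly" where
  "genconst m = constc [:DD:] [:EE:] [:0, 1:] m"

text \<open>Squaring doubles the degree in \<open>t\<close>, and the summand \<open>t (D quadc)^2\<close> of the recursion only has degree 1, so
  the leading term comes from \<open>t D^2\<close> by repeated squaring.\<close>

lemma genconst_leading:
  "\<exists>f :: 'k :: {idom, char2} poly poly poly. genconst (Suc m) = Polynomial.monom (DD ^ (2 ^ Suc m)) (2 ^ m) + f \<and>
     lowpoly (2 ^ m) (2 * 2 ^ Suc m) f"
proof (induction m)
  case 0
  have "genconst (Suc 0) = (Polynomial.monom (DD ^ 2) 1 :: 'k poly poly poly)"
    by (simp add: genconst_def poly_const_pow monom_altdef)
  then show ?case by (intro exI[of _ 0]) (simp add: lowpoly_def)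
next
  case (Suc m)
  then obtain f :: "'k poly poly poly" where f: "genconst (Suc m) = Polynomial.monom (DD ^ (2 ^ Suc m)) (2 ^ m) + f"
    "lowpoly (2 ^ m) (2 * 2 ^ Suc m) f" by blast
  define v where "v = (DD * quadc DD EE (Suc m) :: 'k poly poly)"
  define f' where "f' = f ^ 2 + Polynomial.monom (v ^ 2) 1"
  have coeff_f': "Polynomial.coeff f' i =
    (if even i then Polynomial.coeff f (i div 2) ^ 2 else 0) + (if i = 1 then v ^ 2 else 0)" for i
    using coeff_frobenius[of f 1 i] by (auto simp: f'_def coeff_monom)
  have "genconst (Suc (Suc m)) = genconst (Suc m) ^ 2 + [:0, 1:] * [:v ^ 2:]"
    unfolding genconst_def constc.simps(2)[of _ _ _ "Suc m"] const_quadc v_def by (simp add: poly_const_pow mult.commute[of _ DD])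
  also have "\<dots> = (Polynomial.monom (DD ^ (2 ^ Suc m)) (2 ^ m)) ^ 2 + f'"
    unfolding f(1) char2_square_add f'_def by (simp add: monom_altdef)
  also have "(Polynomial.monom (DD ^ (2 ^ Suc m)) (2 ^ m)) ^ 2 = (Polynomial.monom (DD ^ (2 ^ Suc (Suc m))) (2 ^ Suc m) :: 'k poly poly poly)"
    unfolding monom_power power_2_Suc[of DD "Suc m"] by (simp add: mult.commute)
  finally have "genconst (Suc (Suc m)) = Polynomial.monom (DD ^ (2 ^ Suc (Suc m))) (2 ^ Suc m) + f'" .
  moreover have "lowpoly (2 ^ Suc m) (2 * 2 ^ Suc (Suc m)) f'"
  proof -
    have "homog (2 * 2 ^ Suc (Suc m)) (Polynomial.coeff f (i div 2) ^ 2)" for i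
      using homog_power[of "2 * 2 ^ Suc m" "Polynomial.coeff f (i div 2)" 2] f(2) by (simp add: lowpoly_def)
    moreover have "homog (2 * 2 ^ Suc (Suc m)) (v ^ 2)"
    proof -
      have "homog (2 * (2 + (2 * 2 ^ Suc m - 2))) (v ^ 2)"
        unfolding v_def by (intro homog_power homog_mult homog_DD homog_quadc)
      moreover have "2 * (2 + (2 * 2 ^ Suc m - 2)) = (2 * 2 ^ Suc (Suc m) :: nat)"
      proof -
        obtain j where "(2 :: nat) ^ m = Suc j" by (metis not0_implies_Suc power_eq_0_iff zero_neq_numeral)
        then show ?thesis by simp
      qed
      ultimately show ?thesis by simp
    qed
    moreover have "Polynomial.coeff f (i div 2) = 0" if "2 ^ Suc m \<le> i" for i
      using f(2) that by (auto simp: lowpoly_def)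
    moreover have "i \<noteq> 1" if "2 ^ Suc m \<le> i" for i :: nat
    proof -
      have "(1 :: nat) \<le> 2 ^ m" by simp
      then show ?thesis using that unfolding power_Suc by linarith
    qed
    ultimately show ?thesis unfolding lowpoly_def coeff_f' by (auto intro: homog_add)
  qed
  ultimately show ?case by blast
qed

text \<open>Modulo \<open>E\<close>, exponents can be moved from \<open>x\<close> to \<open>y\<close> in steps of 3 until \<open>y^N\<close> divides the monomial; the degree
  bound ensures that \<open>x^3\<close> is available before that.\<close>

lemma monomial_decomp:
  assumes "N + 2 \<le> i + j"
  shows "\<exists>w A B. vx ^ i * vy ^ j = (vx ^ N * A + vy ^ N * B + EE * w :: 'k :: char2 poly poly) \<and> homog (i + j - 3) w"
  using assms
proof (induction i arbitrary: j rule: less_induct)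
  case (less i)
  consider "N \<le> i" | "N \<le> j" | "i < N" "j < N" by linarith
  then show ?case
  proof cases
    case 1
    then have e: "vx ^ i = (vx ^ N * vx ^ (i - N) :: 'k poly poly)" by (simp flip: power_add)
    have "vx ^ i * vy ^ j = vx ^ N * (vx ^ (i - N) * vy ^ j) + vy ^ N * 0 + EE * (0 :: 'k poly poly)"
      by (simp only: e mult.assoc mult_zero_right add_0_right)
    then show ?thesis using homog_0 by blast
  next
    case 2
    then have e: "vy ^ j = (vy ^ N * vy ^ (j - N) :: 'k poly poly)" by (simp flip: power_add)
    have "vx ^ i * vy ^ j = vx ^ N * 0 + vy ^ N * (vx ^ i * vy ^ (j - N)) + EE * (0 :: 'k poly poly)"
      by (simp only: e mult.left_commute mult_zero_right add_0_right add_0_left)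
    then show ?thesis using homog_0 by blast
  next
    case 3
    then have "3 \<le> i" using less.prems by linarith
    then obtain i' where i: "i = i' + 3" by (metis le_add_diff_inverse2)
    obtain w A B where w: "vx ^ i' * vy ^ (j + 3) = (vx ^ N * A + vy ^ N * B + EE * w :: 'k poly poly)"
      "homog (i' + (j + 3) - 3) w"
      using less.IH[of i' "j + 3"] less.prems by (auto simp: i)
    have "vx ^ i * vy ^ j = EE * (vx ^ i' * vy ^ j) + (vx ^ i' * vy ^ (j + 3) :: 'k poly poly)"
      unfolding i by (simp only: power_add distrib_right distrib_left mult_ac add.assoc char2_add_self add_0_right)
    also have "\<dots> = vx ^ N * A + vy ^ N * B + EE * (vx ^ i' * vy ^ j + w)"
      unfolding w(1) by (simp only: distrib_left add_ac)
    finally show ?thesis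
      using w(2) homog_monomial[of i' j] unfolding i by (intro exI[of _ "vx ^ i' * vy ^ j + w"] exI[of _ A] exI[of _ B] conjI) (auto intro: homog_add)
  qed
qed

lemma homog_as_sum:
  assumes "homog \<delta> p"
  shows "p = (\<Sum>i\<le>\<delta>. scalar (bcoeff p i (\<delta> - i)) * (vx ^ i * vy ^ (\<delta> - i)))"
proof (rule bcoeff_eqI)
  fix a b
  have "bcoeff (\<Sum>i\<le>\<delta>. scalar (bcoeff p i (\<delta> - i)) * (vx ^ i * vy ^ (\<delta> - i))) a b =
      (\<Sum>i\<le>\<delta>. if i = a then if b = \<delta> - a then bcoeff p a (\<delta> - a) else 0 else 0)"
    unfolding bcoeff_simps bcoeff_scalar_mult bcoeff_monomial by (intro sum.cong) auto
  also have "\<dots> = bcoeff p a b" using assms unfolding homog_def by fastforce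
  finally show "bcoeff p a b = bcoeff (\<Sum>i\<le>\<delta>. scalar (bcoeff p i (\<delta> - i)) * (vx ^ i * vy ^ (\<delta> - i))) a b" ..
qed

lemma homog_decomp:
  fixes p :: "'k :: char2 poly poly"
  assumes p: "homog \<delta> p" and \<delta>: "3 * N + 2 \<le> \<delta>"
  obtains w A B where "p = vx ^ (2 * N) * A + vy ^ (2 * N) * B + DD ^ N * (EE * w)" "homog (\<delta> - 2 * N - 3) w"
proof -
  define good where "good p \<longleftrightarrow> (\<exists>w A B. p = vx ^ (2 * N) * A + vy ^ (2 * N) * B + DD ^ N * (EE * w) \<and>
    homog (\<delta> - 2 * N - 3) w)" for p :: "'k poly poly"
  have good_add: "good (p + q)" if gpq: "good p" "good q" for p q
  proof -
    obtain w A B w' A' B' where "p = vx ^ (2 * N) * A + vy ^ (2 * N) * B + DD ^ N * (EE * w)"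
      "q = vx ^ (2 * N) * A' + vy ^ (2 * N) * B' + DD ^ N * (EE * w')"
      and h: "homog (\<delta> - 2 * N - 3) w" "homog (\<delta> - 2 * N - 3) w'"
      using gpq unfolding good_def by blast
    then have "p + q = vx ^ (2 * N) * (A + A') + vy ^ (2 * N) * (B + B') + DD ^ N * (EE * (w + w'))"
      by (simp only: distrib_left add_ac)
    then show ?thesis unfolding good_def using homog_add[OF h] by blast
  qed
  have good_sc: "good (scalar c * p)" if gp: "good p" for p c
  proof -
    obtain w A B where "p = vx ^ (2 * N) * A + vy ^ (2 * N) * B + DD ^ N * (EE * w)"
      and h: "homog (\<delta> - 2 * N - 3) w"
      using gp unfolding good_def by blast
    then have "scalar c * p = vx ^ (2 * N) * (scalar c * A) + vy ^ (2 * N) * (scalar c * B) + DD ^ N * (EE * (scalar c * w))"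
      by (simp only: distrib_left mult.left_commute[of "scalar c"])
    then show ?thesis unfolding good_def using homog_mult[OF homog_scalar h] by (metis add_0)
  qed
  have good_mono: "good (vx ^ i * vy ^ j)" if ij: "i + j = \<delta>" for i j
  proof -
    consider "2 * N \<le> i" | "2 * N \<le> j" | "N \<le> i" "N \<le> j" using ij \<delta> by linarith
    then show ?thesis
    proof cases
      case 1
      then have e: "vx ^ i = (vx ^ (2 * N) * vx ^ (i - 2 * N) :: 'k poly poly)" by (simp flip: power_add)
      have "vx ^ i * vy ^ j = vx ^ (2 * N) * (vx ^ (i - 2 * N) * vy ^ j) + vy ^ (2 * N) * 0 + DD ^ N * (EE * 0 :: 'k poly poly)"
        by (simp only: e mult.assoc mult_zero_right add_0_right)
      then show ?thesis unfolding good_def using homog_0 by blast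
    next
      case 2
      then have e: "vy ^ j = (vy ^ (2 * N) * vy ^ (j - 2 * N) :: 'k poly poly)" by (simp flip: power_add)
      have "vx ^ i * vy ^ j = vx ^ (2 * N) * 0 + vy ^ (2 * N) * (vx ^ i * vy ^ (j - 2 * N)) + DD ^ N * (EE * 0 :: 'k poly poly)"
        by (simp only: e mult.left_commute mult_zero_right add_0_right add_0_left)
      then show ?thesis unfolding good_def using homog_0 by blast
    next
      case 3
      obtain i' j' where e: "i = N + i'" "j = N + j'" using 3 by (metis le_add_diff_inverse)
      have "N + 2 \<le> i' + j'" using ij \<delta> e by linarith
      then obtain w A B where w: "vx ^ i' * vy ^ j' = (vx ^ N * A + vy ^ N * B + EE * w :: 'k poly poly)"
        "homog (i' + j' - 3) w" using monomial_decomp by blast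
      have "vx ^ i * vy ^ j = DD ^ N * (vx ^ i' * vy ^ j' :: 'k poly poly)"
        unfolding e by (simp only: power_add power_mult_distrib mult_ac)
      also have "\<dots> = vx ^ (2 * N) * (vy ^ N * A) + vy ^ (2 * N) * (vx ^ N * B) + DD ^ N * (EE * w)"
      proof -
        have e2: "v ^ (2 * N) = v ^ N * v ^ N" for v :: "'k poly poly" by (simp only: mult_2 power_add)
        show ?thesis unfolding w(1) e2 by (simp only: distrib_left power_mult_distrib mult_ac)
      qed
      finally have "vx ^ i * vy ^ j =
        vx ^ (2 * N) * (vy ^ N * A) + vy ^ (2 * N) * (vx ^ N * B) + DD ^ N * (EE * w)" .
      moreover have "\<delta> - 2 * N - 3 = i' + j' - 3" using ij e by simp
      ultimately show ?thesis unfolding good_def using w(2) by metis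
    qed
  qed
  have "good (\<Sum>i\<in>I. scalar (bcoeff p i (\<delta> - i)) * (vx ^ i * vy ^ (\<delta> - i)))" if "finite I" "I \<subseteq> {..\<delta>}" for I
    using that
  proof (induction I)
    case empty
    have "good (scalar 0 * (vx ^ \<delta> * vy ^ 0))" by (intro good_sc good_mono) simp
    then show ?case by (simp add: scalar_def)
  next
    case (insert i I)
    then show ?case by (simp add: good_add good_sc good_mono)
  qed
  from this[of "{..\<delta>}"] have "good p" using homog_as_sum[OF p] by simp
  then show thesis unfolding good_def using that by blast
qed

lemma finite_bit: "finite (UNIV :: bit set)"
proof -
  have "UNIV = {0, 1 :: bit}" by (auto intro: bit.exhaust)
  then show ?thesis by (metis finite.emptyI finite.insertI)
qed

lemma finite_homog: "finite {p :: bit poly poly. homog \<delta> p}"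
proof (rule finite_subset)
  show "{p :: bit poly poly. homog \<delta> p} \<subseteq> (\<lambda>c. \<Sum>i\<le>\<delta>. scalar (c i) * (vx ^ i * vy ^ (\<delta> - i))) ` ({..\<delta>} \<rightarrow>\<^sub>E UNIV)"
  proof
    fix p :: "bit poly poly" assume "p \<in> {p. homog \<delta> p}"
    then have "p = (\<Sum>i\<le>\<delta>. scalar (bcoeff p i (\<delta> - i)) * (vx ^ i * vy ^ (\<delta> - i)))" using homog_as_sum by blast
    also have "\<dots> = (\<Sum>i\<le>\<delta>. scalar (restrict (\<lambda>i. bcoeff p i (\<delta> - i)) {..\<delta>} i) * (vx ^ i * vy ^ (\<delta> - i)))"
      by (intro sum.cong) auto
    finally show "p \<in> (\<lambda>c. \<Sum>i\<le>\<delta>. scalar (c i) * (vx ^ i * vy ^ (\<delta> - i))) ` ({..\<delta>} \<rightarrow>\<^sub>E UNIV)"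
      by (rule image_eqI[where x = "restrict (\<lambda>i. bcoeff p i (\<delta> - i)) {..\<delta>}"]) auto
  qed
  show "finite ((\<lambda>c. \<Sum>i\<le>\<delta>. scalar (c i) * (vx ^ i * vy ^ (\<delta> - i))) ` ({..\<delta>} \<rightarrow>\<^sub>E (UNIV :: bit set)))"
    by (intro finite_imageI finite_PiE finite_bit) auto
qed

lemma finite_lowpoly: "finite {f :: bit poly poly poly. lowpoly K \<delta> f}"
proof (rule finite_subset)
  let ?H = "{p :: bit poly poly. homog \<delta> p}"
  show "{f :: bit poly poly poly. lowpoly K \<delta> f} \<subseteq> Poly ` {xs. set xs \<subseteq> ?H \<and> length xs = K}"
  proof
    fix f :: "bit poly poly poly" assume "f \<in> {f. lowpoly K \<delta> f}"
    then have f: "lowpoly K \<delta> f" by simp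
    have "f = Poly (map (Polynomial.coeff f) [0..<K])"
      using f by (intro poly_eqI) (auto simp: coeff_Poly_eq nth_default_def lowpoly_def)
    then show "f \<in> Poly ` {xs. set xs \<subseteq> ?H \<and> length xs = K}"
      by (rule image_eqI) (use f in \<open>auto simp: lowpoly_def\<close>)
  qed
  show "finite (Poly ` {xs. set xs \<subseteq> ?H \<and> length xs = K})"
    by (intro finite_imageI finite_lists_length_eq finite_homog)
qed

text \<open>The ideal \<open>(x^(2 N), y^(2 N), E c)\<close> of \<open>k[x, y][t]\<close> with \<open>N = 2^m\<close>.\<close>

definition family_ideal :: "nat \<Rightarrow> 'k :: comm_ring_1 poly poly poly set" where
  "family_ideal m = {[:vx ^ (2 * 2 ^ m):] * A + [:vy ^ (2 * 2 ^ m):] * B + [:EE:] * genconst m * W |A B W. True}"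

lemma family_idealI: "[:vx ^ (2 * 2 ^ m):] * A + [:vy ^ (2 * 2 ^ m):] * B + [:EE:] * genconst m * W \<in> family_ideal m"
  unfolding family_ideal_def by blast

lemma family_ideal_0: "0 \<in> family_ideal m"
  using family_idealI[of m 0 0 0] by simp

lemma family_ideal_add: "f \<in> family_ideal m \<Longrightarrow> g \<in> family_ideal m \<Longrightarrow> f + g \<in> family_ideal m"
proof -
  assume "f \<in> family_ideal m" "g \<in> family_ideal m"
  then obtain A B W A' B' W' where
    "f = [:vx ^ (2 * 2 ^ m):] * A + [:vy ^ (2 * 2 ^ m):] * B + [:EE:] * genconst m * W"
    "g = [:vx ^ (2 * 2 ^ m):] * A' + [:vy ^ (2 * 2 ^ m):] * B' + [:EE:] * genconst m * W'"
    unfolding family_ideal_def by blast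
  then have "f + g = [:vx ^ (2 * 2 ^ m):] * (A + A') + [:vy ^ (2 * 2 ^ m):] * (B + B') + [:EE:] * genconst m * (W + W')"
    by (simp only: distrib_left add_ac)
  then show ?thesis by (simp only: family_idealI)
qed

lemma family_ideal_mult: "f \<in> family_ideal m \<Longrightarrow> g * f \<in> family_ideal m"
proof -
  assume "f \<in> family_ideal m"
  then obtain A B W where
    "f = [:vx ^ (2 * 2 ^ m):] * A + [:vy ^ (2 * 2 ^ m):] * B + [:EE:] * genconst m * W"
    unfolding family_ideal_def by blast
  then have "g * f = [:vx ^ (2 * 2 ^ m):] * (g * A) + [:vy ^ (2 * 2 ^ m):] * (g * B) + [:EE:] * genconst m * (g * W)"
    by (simp only: distrib_left mult_ac)
  then show ?thesis by (simp only: family_idealI)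
qed

text \<open>Multiplication by \<open>t\<close> raises the top coefficient to degree \<open>K = N / 2\<close> in \<open>t\<close>.  Modulo \<open>x^(2 N)\<close> and \<open>y^(2 N)\<close> this
  coefficient is a multiple of \<open>D^N E\<close>, and \<open>t^K D^N\<close> is congruent to terms of lower degree modulo \<open>c\<close>.\<close>

lemma lowpoly_shift:
  fixes f :: "'k :: {idom, char2} poly poly poly"
  assumes f: "lowpoly (2 ^ m) \<delta> f" and \<delta>: "3 * 2 ^ Suc m + 2 \<le> \<delta>"
  obtains f' where "lowpoly (2 ^ m) \<delta> f'" "[:0, 1:] * f + f' \<in> family_ideal (Suc m)"
proof -
  define N :: nat where "N = 2 ^ Suc m"
  define K :: nat where "K = 2 ^ m"
  have K: "K \<ge> 1" by (simp add: K_def)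
  define p where "p = Polynomial.coeff f (K - 1)"
  have p: "homog \<delta> p" using f by (simp add: p_def lowpoly_def)
  obtain w A B where w: "p = vx ^ (2 * N) * A + vy ^ (2 * N) * B + DD ^ N * (EE * w)" "homog (\<delta> - 2 * N - 3) w"
    using homog_decomp[OF p] \<delta> unfolding N_def by metis
  obtain h :: "'k poly poly poly" where h: "genconst (Suc m) = Polynomial.monom (DD ^ N) K + h" "lowpoly K (2 * N) h"
    using genconst_leading[of m] unfolding N_def K_def by blast
  define f0 where "f0 = [:0, 1:] * f + Polynomial.monom p K"
  have coeff_f0: "Polynomial.coeff f0 i = (if i = 0 \<or> K \<le> i then 0 else Polynomial.coeff f (i - 1))" for i
  proof -
    have "Polynomial.coeff f0 i = (case i of 0 \<Rightarrow> 0 | Suc j \<Rightarrow> Polynomial.coeff f j) + (if i = K then p else 0)"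
      by (simp add: f0_def coeff_pCons coeff_monom eq_commute)
    moreover have "Polynomial.coeff f j = 0" if "K \<le> j" for j
      using f that by (simp add: lowpoly_def K_def)
    ultimately show ?thesis using K by (cases i; cases "i = K") (auto simp: p_def)
  qed
  define f' where "f' = f0 + [:EE * w:] * h"
  have "homog \<delta> (EE * w * Polynomial.coeff h i)" for i
  proof -
    have "homog (3 + (\<delta> - 2 * N - 3) + 2 * N) (EE * w * Polynomial.coeff h i)"
      using h(2) by (intro homog_mult homog_EE w(2)) (simp add: lowpoly_def)
    moreover have "3 + (\<delta> - 2 * N - 3) + 2 * N = \<delta>"
    proof -
      have "(1 :: nat) \<le> 2 ^ m" by simp
      then have "2 * N + 3 \<le> \<delta>" using \<delta> unfolding N_def power_Suc by linarith
      then show ?thesis by simp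
    qed
    ultimately show ?thesis by simp
  qed
  then have "lowpoly K \<delta> f'"
    using f h(2) unfolding lowpoly_def f'_def by (auto simp: coeff_f0 homog_add)
  moreover have "[:0, 1:] * f + f' \<in> family_ideal (Suc m)"
  proof -
    have "[:0, 1:] * f + f' = Polynomial.monom p K + [:EE * w:] * h"
      unfolding f'_def f0_def by (simp only: add.assoc char2_add_left_self)
    also have "Polynomial.monom p K = [:vx ^ (2 * N):] * Polynomial.monom A K + [:vy ^ (2 * N):] * Polynomial.monom B K +
        [:EE * w:] * Polynomial.monom (DD ^ N) K"
      unfolding w(1) by (simp add: smult_monom add_monom mult_ac)
    also have "\<dots> + [:EE * w:] * h = [:vx ^ (2 * N):] * Polynomial.monom A K + [:vy ^ (2 * N):] * Polynomial.monom B K +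
        [:EE:] * genconst (Suc m) * [:w:]"
    proof -
      have "[:EE * w:] = [:EE:] * [:w:]" by simp
      then show ?thesis unfolding h(1) by (simp only: distrib_left distrib_right mult_ac add_ac)
    qed
    finally show ?thesis using family_idealI[of "Suc m"] unfolding N_def by (simp only:)
  qed
  ultimately show thesis using that unfolding K_def by blast
qed

lemma power_reduction:
  fixes p :: "'k :: {idom, char2} poly poly"
  assumes p: "homog \<delta> p" and \<delta>: "3 * 2 ^ Suc m + 2 \<le> \<delta>"
  shows "\<exists>f. lowpoly (2 ^ m) \<delta> f \<and> Polynomial.monom p k + f \<in> family_ideal (Suc m)"
proof (induction k)
  case 0
  show ?case
  proof (intro exI conjI)
    show "lowpoly (2 ^ m) \<delta> [:p:]"
      using p by (auto simp: lowpoly_def coeff_pCons split: nat.split)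
    show "Polynomial.monom p 0 + [:p:] \<in> family_ideal (Suc m)" by (simp add: monom_0 family_ideal_0)
  qed
next
  case (Suc k)
  then obtain f where f: "lowpoly (2 ^ m) \<delta> f" "Polynomial.monom p k + f \<in> family_ideal (Suc m)" by blast
  obtain f' where f': "lowpoly (2 ^ m) \<delta> f'" "[:0, 1:] * f + f' \<in> family_ideal (Suc m)"
    using lowpoly_shift[OF f(1) \<delta>] .
  have "[:0, 1:] * (Polynomial.monom p k + f) + ([:0, 1:] * f + f') \<in> family_ideal (Suc m)"
    by (intro family_ideal_add family_ideal_mult f f')
  also have "[:0, 1:] * (Polynomial.monom p k + f) + ([:0, 1:] * f + f') = Polynomial.monom p (Suc k) + f'"
    unfolding distrib_left by (simp add: monom_Suc add.assoc)
  finally show ?case using f'(1) by blast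
qed

text \<open>Over a finite field there are only finitely many remainders.\<close>

lemma pigeonhole_multiplier:
  fixes p :: "bit poly poly"
  assumes p: "homog \<delta> p" and \<delta>: "3 * 2 ^ Suc m + 2 \<le> \<delta>"
  obtains i j where "i < j" "Polynomial.monom p i + Polynomial.monom p j \<in> family_ideal (Suc m)"
proof -
  obtain F where F: "\<And>k. lowpoly (2 ^ m) \<delta> (F k)" "\<And>k. Polynomial.monom p k + F k \<in> family_ideal (Suc m)"
    using power_reduction[OF p \<delta>] by metis
  have "finite (range F)"
    by (rule finite_subset[OF _ finite_lowpoly[of "2 ^ m" \<delta>]]) (use F(1) in auto)
  then have "\<not> inj F" using finite_imageD[of F UNIV] infinite_UNIV_nat by (auto simp: inj_on_def)
  then obtain i' j' where ij': "i' \<noteq> j'" "F i' = F j'" unfolding inj_on_def by blast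
  have mem: "Polynomial.monom p a + Polynomial.monom p b \<in> family_ideal (Suc m)" if ab: "F a = F b" for a b
  proof -
    have "(Polynomial.monom p a + F a) + (Polynomial.monom p b + F b) \<in> family_ideal (Suc m)"
      by (intro family_ideal_add F)
    also have "(Polynomial.monom p a + F a) + (Polynomial.monom p b + F b) = Polynomial.monom p a + Polynomial.monom p b"
      unfolding ab by (simp only: add_ac char2_add_left_self)
    finally show ?thesis .
  qed
  show thesis
  proof (cases "i' < j'")
    case True then show ?thesis using that mem ij'(2) by blast
  next
    case False
    then have "j' < i'" using ij'(1) by simp
    then show ?thesis using that mem ij'(2)[symmetric] by blast
  qed
qed

definition rhom :: "('a :: comm_ring_1 \<Rightarrow> 'b :: comm_ring_1) \<Rightarrow> bool" where
  "rhom h \<longleftrightarrow> h 1 = 1 \<and> (\<forall>a b. h (a + b) = h a + h b) \<and> (\<forall>a b. h (a * b) = h a * h b)"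

lemma rhomD:
  assumes "rhom h"
  shows "h 1 = 1" "h (a + b) = h a + h b" "h (a * b) = h a * h b" "h 0 = 0" "h (a ^ n) = h a ^ n"
    "h (sum f I) = (\<Sum>i\<in>I. h (f i))"
proof -
  show h: "h 1 = 1" "h (a + b) = h a + h b" "h (a * b) = h a * h b" for a b
    using assms unfolding rhom_def by blast+
  show h0: "h 0 = 0" using h(2)[of 0 0] by simp
  show "h (a ^ n) = h a ^ n" by (induction n) (simp_all add: h)
  show "h (sum f I) = (\<Sum>i\<in>I. h (f i))" by (induction I rule: infinite_finite_induct) (simp_all add: h h0)
qed

lemma rhom_comp: "rhom g \<Longrightarrow> rhom h \<Longrightarrow> rhom (\<lambda>a. g (h a))"
  unfolding rhom_def by simp

lemma rhom_const: "rhom (\<lambda>c. [:c:])"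
  unfolding rhom_def by (simp add: one_pCons)

lemma rhom_poly: "rhom (\<lambda>p. poly p a)"
  unfolding rhom_def by simp

lemma rhom_map_poly:
  assumes "rhom h" shows "rhom (map_poly h)"
proof -
  note h = rhomD[OF assms]
  have "map_poly h (p + q) = map_poly h p + map_poly h q" for p q
    by (rule poly_eqI) (simp add: coeff_map_poly h)
  moreover have "map_poly h (p * q) = map_poly h p * map_poly h q" for p q
    by (rule poly_eqI) (simp add: coeff_map_poly h Polynomial.coeff_mult)
  ultimately show ?thesis unfolding rhom_def by (simp add: h)
qed

lemma rhom_scalar: "rhom scalar"
  using rhom_comp[OF rhom_const rhom_const] unfolding scalar_def .

lemma scalar_1: "scalar 1 = 1" by (rule rhomD(1)[OF rhom_scalar])

definition tconst :: "bit poly \<Rightarrow> bit poly poly poly" where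
  "tconst s = map_poly scalar s"

lemma tconst_simps: "tconst (s * s') = tconst s * tconst s'" "tconst (s + s') = tconst s + tconst s'"
  "tconst (Polynomial.monom c i) = Polynomial.monom (scalar c) i" "tconst 1 = 1"
  using rhomD[OF rhom_map_poly[OF rhom_scalar]] by (simp_all add: tconst_def map_poly_monom rhomD(4)[OF rhom_scalar])

text \<open>Treat the coefficients with respect to \<open>t\<close> one after the other and multiply the multipliers.\<close>

lemma multiplier_exists:
  fixes f :: "bit poly poly poly"
  assumes f: "\<And>i. homog \<delta> (Polynomial.coeff f i)" and \<delta>: "3 * 2 ^ Suc m + 2 \<le> \<delta>"
  shows "\<exists>s. s \<noteq> 0 \<and> tconst s * f \<in> family_ideal (Suc m)"
  using f
proof (induction f)
  case 0
  then show ?case by (intro exI[of _ 1]) (simp add: family_ideal_0)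
next
  case (pCons p f)
  have "homog \<delta> p" using pCons.prems[of 0] by simp
  then obtain i j where ij: "i < j" "Polynomial.monom p i + Polynomial.monom p j \<in> family_ideal (Suc m)"
    using pigeonhole_multiplier[OF _ \<delta>] by blast
  define s1 where "s1 = (Polynomial.monom 1 i + Polynomial.monom 1 j :: bit poly)"
  have "Polynomial.coeff s1 i \<noteq> 0" using ij(1) by (simp add: s1_def coeff_monom)
  then have "s1 \<noteq> 0" by auto
  have "homog \<delta> (Polynomial.coeff f k)" for k using pCons.prems[of "Suc k"] by simp
  then obtain s2 where s2: "s2 \<noteq> 0" "tconst s2 * f \<in> family_ideal (Suc m)" using pCons.IH by blast
  have "tconst s1 * [:p:] = Polynomial.monom p i + Polynomial.monom p j"
    by (simp add: s1_def tconst_simps distrib_right scalar_1 smult_monom smult_add_right mult.commute[of _ "[:p:]"])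
  then have "tconst s1 * [:p:] \<in> family_ideal (Suc m)" using ij(2) by (simp only:)
  from family_ideal_add[OF family_ideal_mult[OF this] family_ideal_mult[OF s2(2)]]
  have "tconst s2 * (tconst s1 * [:p:]) + ([:0, 1:] * tconst s1) * (tconst s2 * f) \<in> family_ideal (Suc m)" .
  also have "tconst s2 * (tconst s1 * [:p:]) + ([:0, 1:] * tconst s1) * (tconst s2 * f) =
      tconst (s1 * s2) * pCons p f"
  proof -
    have "pCons p f = [:p:] + [:0, 1:] * f" by simp
    then show ?thesis unfolding tconst_simps by (simp only: distrib_left mult_ac)
  qed
  finally show ?case using \<open>s1 \<noteq> 0\<close> s2(1) by (intro exI[of _ "s1 * s2"]) simp
qed

section \<open>Both fibres over the polynomial ring\<close>

text \<open>The ring \<open>F_2[x, y][t][z]\<close>, nested in this order from the inside out, and the elements of the counterexample.\<close>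

type_synonym ambient = "bit poly poly poly poly"

definition xR :: ambient where "xR = [:[:vx:]:]"
definition yR :: ambient where "yR = [:[:vy:]:]"
definition zR :: ambient where "zR = [:0, 1:]"
definition gR :: ambient where "gR = quartic [:[:DD:]:] [:[:EE:]:] [:[:0, 1:]:] zR"
definition uR :: ambient where "uR = [:[:vx ^ 3 * vy ^ 2:]:] * zR"
definition sR :: "bit poly \<Rightarrow> ambient" where "sR s = [:tconst s:]"

text \<open>The ideal \<open>(x^k, y^k, z^k, g)\<close>; for \<open>k = 4 q\<close> it is the preimage of the Frobenius power \<open>I^[q]\<close>.\<close>

definition bracket_ideal :: "nat \<Rightarrow> ambient set" where
  "bracket_ideal k = {xR ^ k * A + yR ^ k * B + zR ^ k * C + h * gR |A B C h. True}"

lemma bracket_idealI: "xR ^ k * A + yR ^ k * B + zR ^ k * C + h * gR \<in> bracket_ideal k"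
  unfolding bracket_ideal_def by blast

lemma bracket_ideal_add: "f \<in> bracket_ideal k \<Longrightarrow> g \<in> bracket_ideal k \<Longrightarrow> f + g \<in> bracket_ideal k"
proof -
  assume "f \<in> bracket_ideal k" "g \<in> bracket_ideal k"
  then obtain A B C h A' B' C' h' where "f = xR ^ k * A + yR ^ k * B + zR ^ k * C + h * gR"
    "g = xR ^ k * A' + yR ^ k * B' + zR ^ k * C' + h' * gR" unfolding bracket_ideal_def by blast
  then have "f + g = xR ^ k * (A + A') + yR ^ k * (B + B') + zR ^ k * (C + C') + (h + h') * gR"
    by (simp only: distrib_left distrib_right add_ac)
  then show ?thesis by (simp only: bracket_idealI)
qed

lemma bracket_ideal_mult: "f \<in> bracket_ideal k \<Longrightarrow> g * f \<in> bracket_ideal k"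
proof -
  assume "f \<in> bracket_ideal k"
  then obtain A B C h where "f = xR ^ k * A + yR ^ k * B + zR ^ k * C + h * gR" unfolding bracket_ideal_def by blast
  then have "g * f = xR ^ k * (g * A) + yR ^ k * (g * B) + zR ^ k * (g * C) + (g * h) * gR"
    by (simp only: distrib_left mult_ac)
  then show ?thesis by (simp only: bracket_idealI)
qed

lemma bracket_ideal_gR: "h * gR \<in> bracket_ideal k" using bracket_idealI[of k 0 0 0 h] by simp
lemma bracket_ideal_x: "xR ^ k * h \<in> bracket_ideal k" using bracket_idealI[of k h 0 0 0] by simp
lemma bracket_ideal_y: "yR ^ k * h \<in> bracket_ideal k" using bracket_idealI[of k 0 h 0 0] by simp
lemma bracket_ideal_z: "zR ^ k * h \<in> bracket_ideal k" using bracket_idealI[of k 0 0 h 0] by simp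

lemma gR_poly: "gR = [:[:0, DD ^ 2:], [:EE:], [:DD:], 0, 1:]"
  unfolding gR_def zR_def quartic_poly by (simp add: poly_const_pow)

lemma gR_degree: "degree gR = 4" "lead_coeff gR = 1"
  by (simp_all add: gR_poly)

lemma zR_power:
  obtains h where "zR ^ (2 ^ Suc m) =
    h * gR + ([:[:quadc DD EE m:]:] * zR ^ 2 + [:[:linc DD EE m:]:] * zR + [:genconst m:])"
proof -
  have c: "quadc [:[:DD:]:] [:[:EE:]:] m = [:[:quadc DD EE m:]:]" "linc [:[:DD:]:] [:[:EE:]:] m = [:[:linc DD EE m:]:]"
    "constc [:[:DD:]:] [:[:EE:]:] [:[:0, 1:]:] m = [:genconst m:]"
    by (simp_all only: const_quadc const_linc const_constc genconst_def)
  obtain h where "zR ^ (2 ^ Suc m) + ([:[:quadc DD EE m:]:] * zR ^ 2 + [:[:linc DD EE m:]:] * zR + [:genconst m:]) = gR * h"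
    using power_mod_quartic[of "[:[:DD:]:]" "[:[:EE:]:]" "[:[:0, 1:]:]" zR m] unfolding gR_def c by (rule dvdE)
  from char2_add_eq[OF this] show thesis by (intro that[of h]) (simp only: mult.commute)
qed

lemma xR_power: "xR ^ k = [:[:vx ^ k:]:]" and yR_power: "yR ^ k = [:[:vy ^ k:]:]"
  by (simp_all add: xR_def yR_def poly_const_pow)

lemma xy_ideal_bracket_ideal: "p \<in> xy_ideal k k \<Longrightarrow> [:[:p:]:] * f \<in> bracket_ideal k"
proof -
  assume "p \<in> xy_ideal k k"
  then obtain a b where "p = vx ^ k * a + vy ^ k * b" unfolding xy_ideal_def by blast
  then have "[:[:p:]:] = xR ^ k * [:[:a:]:] + yR ^ k * [:[:b:]:]" unfolding xR_power yR_power by simp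
  then have "[:[:p:]:] * f = xR ^ k * ([:[:a:]:] * f) + yR ^ k * ([:[:b:]:] * f)"
    by (simp only: distrib_right mult.assoc)
  then show ?thesis using bracket_ideal_add[OF bracket_ideal_x bracket_ideal_y] by (simp only:)
qed

text \<open>Since \<open>E\<close> kills the other two coefficients of \<open>z^(2 N)\<close>, the element \<open>E c\<close> is congruent to \<open>E z^(2 N)\<close>.\<close>

lemma family_ideal_bracket_ideal:
  assumes "f \<in> family_ideal m"
  shows "[:f:] \<in> bracket_ideal (2 * 2 ^ m)"
proof -
  let ?k = "2 * 2 ^ m"
  obtain h where h: "zR ^ (2 ^ Suc m) =
    h * gR + ([:[:quadc DD EE m:]:] * zR ^ 2 + [:[:linc DD EE m:]:] * zR + [:genconst m:])"
    by (rule zR_power)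
  have E: "[:[:EE * p:]:] = [:[:EE:]:] * ([:[:p:]:] :: ambient)" for p by simp
  have "[:[:EE:] * genconst m:] = [:[:EE:]:] * [:genconst m:]" by simp
  also have "\<dots> = zR ^ ?k * [:[:EE:]:] + ([:[:EE:]:] * h) * gR +
      ([:[:EE * quadc DD EE m:]:] * zR ^ 2 + [:[:EE * linc DD EE m:]:] * zR)"
  proof -
    have e: "?k = 2 ^ Suc m" by simp
    have "zR ^ ?k * [:[:EE:]:] + ([:[:EE:]:] * h) * gR +
      ([:[:EE * quadc DD EE m:]:] * zR ^ 2 + [:[:EE * linc DD EE m:]:] * zR) =
      [:[:EE:]:] * ((h * gR + ([:[:quadc DD EE m:]:] * zR ^ 2 + [:[:linc DD EE m:]:] * zR + [:genconst m:])) +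
       (h * gR + ([:[:quadc DD EE m:]:] * zR ^ 2 + [:[:linc DD EE m:]:] * zR)))"
      unfolding e h E by (simp only: distrib_left mult_ac add_ac)
    also have "\<dots> = [:[:EE:]:] * [:genconst m:]"
      by (simp only: add_ac char2_add_left_self char2_add_self add_0_right add_0_left)
    finally show ?thesis ..
  qed
  also have "\<dots> \<in> bracket_ideal ?k"
    by (intro bracket_ideal_add bracket_ideal_z bracket_ideal_gR xy_ideal_bracket_ideal EE_quadc_in_xy_ideal EE_linc_in_xy_ideal)
  finally have main: "[:[:EE:] * genconst m:] \<in> bracket_ideal ?k" .
  obtain A B W where f: "f = [:vx ^ ?k:] * A + [:vy ^ ?k:] * B + [:EE:] * genconst m * W"
    using assms unfolding family_ideal_def by blast
  have "[:f:] = xR ^ ?k * [:A:] + yR ^ ?k * [:B:] + [:W:] * [:[:EE:] * genconst m:]"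
    unfolding f xR_power yR_power by (simp add: mult.commute)
  also have "\<dots> \<in> bracket_ideal ?k"
    by (intro bracket_ideal_add bracket_ideal_x bracket_ideal_y bracket_ideal_mult main)
  finally show ?thesis .
qed

lemma homog_genconst: "homog (2 * 2 ^ m) (Polynomial.coeff (genconst m :: 'k :: {idom, char2} poly poly poly) i)"
proof (cases m)
  case 0 then show ?thesis by (simp add: genconst_def)
next
  case (Suc k)
  obtain f :: "'k poly poly poly" where f: "genconst (Suc k) = Polynomial.monom (DD ^ (2 ^ Suc k)) (2 ^ k) + f"
     "lowpoly (2 ^ k) (2 * 2 ^ Suc k) f" using genconst_leading by blast
  have "homog (2 ^ Suc k * 2) (DD ^ (2 ^ Suc k) :: 'k poly poly)" by (intro homog_power homog_DD)
  then show ?thesis using f(2) unfolding Suc f(1) lowpoly_def by (auto simp: coeff_monom mult.commute intro!: homog_add)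
qed

text \<open>For \<open>q > 1\<close>, the coefficients of \<open>x E u^q\<close> with respect to \<open>1, z, z^2\<close> are forms of degree at least
  \<open>6 q + 2 = 3 N + 2\<close> with \<open>N = 2 q\<close>; the factor \<open>x E\<close> is there to reach this degree.\<close>

lemma in_closure_generic:
  "\<exists>s. s \<noteq> 0 \<and> sR s * ([:[:vx * EE:]:] * uR ^ (2 ^ e)) \<in> bracket_ideal (4 * 2 ^ e)"
proof (cases e)
  case 0
  have "[:[:vx * EE:]:] * uR ^ (2 ^ e) = xR ^ 4 * ([:[:EE * vy ^ 2:]:] * zR)"
    unfolding xR_power uR_def 0 by (simp add: eval_nat_numeral mult_ac)
  then have "[:[:vx * EE:]:] * uR ^ (2 ^ e) \<in> bracket_ideal 4" by (simp only: bracket_ideal_x)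
  then have "sR 1 * ([:[:vx * EE:]:] * uR ^ (2 ^ e)) \<in> bracket_ideal 4" by (rule bracket_ideal_mult)
  then have "sR 1 * ([:[:vx * EE:]:] * uR ^ (2 ^ e)) \<in> bracket_ideal (4 * 2 ^ e)"
    unfolding 0 by (simp only: power_0 mult_1_right)
  then show ?thesis using zero_neq_one by metis
next
  case (Suc m)
  define q :: nat where "q = 2 ^ e"
  have q: "q = 2 ^ Suc m" "4 * q = 2 * 2 ^ Suc e" "3 * 2 ^ Suc e = 6 * q" by (simp_all add: q_def Suc)
  obtain h where h: "zR ^ q =
    h * gR + ([:[:quadc DD EE m:]:] * zR ^ 2 + [:[:linc DD EE m:]:] * zR + [:genconst m:])"
    unfolding q(1) by (rule zR_power)
  define V where "V = vx * EE * (vx ^ (3 * q) * vy ^ (2 * q) :: bit poly poly)"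
  have V: "homog (1 + 3 + (3 * q + 2 * q)) V"
    using homog_vx[of 1] unfolding V_def by (intro homog_mult homog_EE homog_monomial) simp
  have mult: "\<exists>s. s \<noteq> 0 \<and> sR s * [:[:V:] * f:] \<in> bracket_ideal (4 * q)"
    if f: "\<And>i. homog \<delta> (Polynomial.coeff f i)" and \<delta>: "q \<le> \<delta> + 2" for f \<delta>
  proof -
    have "homog (1 + 3 + (3 * q + 2 * q) + \<delta>) (Polynomial.coeff ([:V:] * f) i)" for i
      using homog_mult[OF V f] by simp
    moreover have "3 * 2 ^ Suc e + 2 \<le> 1 + 3 + (3 * q + 2 * q) + \<delta>" using \<delta> unfolding q(3) by simp
    ultimately obtain s where s: "s \<noteq> 0" "tconst s * ([:V:] * f) \<in> family_ideal (Suc e)"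
      using multiplier_exists by blast
    have "sR s * [:[:V:] * f:] = [:tconst s * ([:V:] * f):]" by (simp only: sR_def rhomD(3)[OF rhom_const])
    then show ?thesis using s(1) family_ideal_bracket_ideal[OF s(2)] unfolding q(2) by metis
  qed
  have "q \<le> (2 * 2 ^ m - 2) + 2" "q \<le> (2 * 2 ^ m - 1) + 2" "q \<le> 2 * 2 ^ m + 2" by (simp_all add: q(1))
  moreover have "homog (2 * 2 ^ m - 2) (Polynomial.coeff [:quadc DD EE m :: bit poly poly:] i)"
    "homog (2 * 2 ^ m - 1) (Polynomial.coeff [:linc DD EE m :: bit poly poly:] i)" for i
    using homog_quadc[of m] homog_linc[of m] by (cases i; simp)+
  ultimately obtain s1 s2 s3 where s: "s1 \<noteq> 0" "s2 \<noteq> 0" "s3 \<noteq> 0"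
    and m1: "sR s1 * [:[:V:] * [:quadc DD EE m:]:] \<in> bracket_ideal (4 * q)"
    and m2: "sR s2 * [:[:V:] * [:linc DD EE m:]:] \<in> bracket_ideal (4 * q)"
    and m3: "sR s3 * [:[:V:] * genconst m:] \<in> bracket_ideal (4 * q)"
    using mult homog_genconst by meson
  have sR_mult: "sR (a * b) = sR a * sR b" for a b by (simp add: sR_def tconst_simps)
  have u: "[:[:vx * EE:]:] * uR ^ q = [:[:V:]:] * zR ^ q"
  proof -
    have "uR ^ q = [:[:vx ^ (3 * q) * vy ^ (2 * q):]:] * zR ^ q"
      unfolding uR_def by (simp only: power_mult_distrib poly_const_pow power_mult)
    then show ?thesis by (simp add: V_def)
  qed
  have c: "[:[:V:] * p:] = [:[:V:]:] * [:p:]" for p by simp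
  have "sR (s1 * s2 * s3) * ([:[:vx * EE:]:] * uR ^ q) =
    (sR (s1 * s2 * s3) * [:[:V:]:] * h) * gR +
    ((sR s2 * sR s3 * zR ^ 2) * (sR s1 * [:[:V:] * [:quadc DD EE m:]:]) +
     (sR s1 * sR s3 * zR) * (sR s2 * [:[:V:] * [:linc DD EE m:]:]) +
     (sR s1 * sR s2) * (sR s3 * [:[:V:] * genconst m:]))"
    unfolding u h c sR_mult by (simp only: distrib_left mult_ac)
  also have "\<dots> \<in> bracket_ideal (4 * q)"
    by (intro bracket_ideal_add bracket_ideal_gR bracket_ideal_mult m1 m2 m3)
  finally show ?thesis using s unfolding q_def by (intro exI[of _ "s1 * s2 * s3"]) simp
qed

lemma rhom_poly_map: "rhom h \<Longrightarrow> h (poly p a) = poly (map_poly h p) (h a)"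
proof -
  assume "rhom h"
  note h = rhomD[OF this]
  show ?thesis by (induction p) (simp_all add: h map_poly_pCons)
qed

definition of_F2 :: "bit \<Rightarrow> 'k :: char2" where "of_F2 b = (if b = 1 then 1 else 0)"

lemma rhom_of_F2: "rhom (of_F2 :: bit \<Rightarrow> 'k :: char2)"
proof -
  have "of_F2 (a + b) = (of_F2 a + of_F2 b :: 'k)" "of_F2 (a * b) = (of_F2 a * of_F2 b :: 'k)" for a b
    by (cases a; cases b; simp add: of_F2_def)+
  then show ?thesis unfolding rhom_def by (simp add: of_F2_def)
qed

lemma of_F2_eq_0: "of_F2 b = (0 :: 'k :: {char2, zero_neq_one}) \<longleftrightarrow> b = 0"
  by (cases b) (simp_all add: of_F2_def)

text \<open>Extension of scalars from \<open>F_2\<close> and evaluation of \<open>t\<close>; together they are the specialisation map.\<close>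

definition emb :: "bit poly poly \<Rightarrow> 'k :: char2 poly poly" where
  "emb = map_poly (map_poly of_F2)"

lemma rhom_emb: "rhom emb"
  unfolding emb_def by (intro rhom_map_poly rhom_of_F2)

lemma bcoeff_emb: "bcoeff (emb p) i j = of_F2 (bcoeff p i j)"
  unfolding bcoeff_def emb_def by (simp add: coeff_map_poly of_F2_def)

lemma emb_eq_0: "emb p = (0 :: 'k :: {idom, char2} poly poly) \<longleftrightarrow> p = 0"
proof
  assume "emb p = (0 :: 'k poly poly)"
  then have "of_F2 (bcoeff p i j) = (0 :: 'k)" for i j by (simp flip: bcoeff_emb)
  then show "p = 0" by (intro bcoeff_eqI) (simp add: of_F2_eq_0)
qed (simp add: rhomD(4)[OF rhom_emb])

lemma emb_vx: "emb vx = vx" and emb_vy: "emb vy = vy"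
  by (simp_all add: emb_def vx_def vy_def map_poly_pCons of_F2_def)

definition evt :: "'k :: char2 \<Rightarrow> bit poly poly poly \<Rightarrow> 'k poly poly" where
  "evt t f = poly (map_poly emb f) (scalar t)"

lemma rhom_evt: "rhom (evt t)"
  unfolding evt_def by (rule rhom_comp[OF rhom_poly rhom_map_poly[OF rhom_emb]])

lemma evt_const: "evt t [:p:] = emb p"
  by (simp add: evt_def map_poly_pCons rhomD(4)[OF rhom_emb])

lemma evt_t: "evt t [:0, 1:] = scalar t"
  by (simp add: evt_def map_poly_pCons rhomD(1,4)[OF rhom_emb])

lemma evt_tconst: "evt t (tconst s) = scalar (poly (map_poly of_F2 s) t)" for t :: "'k :: char2"
proof -
  have c: "emb (scalar c) = (scalar (of_F2 c) :: 'k poly poly)" for c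
    by (simp add: emb_def scalar_def map_poly_pCons of_F2_def)
  have "map_poly emb (tconst s) = (map_poly scalar (map_poly of_F2 s) :: 'k poly poly poly)"
    unfolding tconst_def by (rule poly_eqI) (simp add: c coeff_map_poly rhomD(4)[OF rhom_emb] rhomD(4)[OF rhom_scalar] rhomD(4)[OF rhom_of_F2])
  then show ?thesis unfolding evt_def by (simp add: rhom_poly_map[OF rhom_scalar])
qed

lemma finite_evt_zero:
  fixes f :: "bit poly poly poly"
  assumes "f \<noteq> 0"
  shows "finite {t :: 'k :: {idom, char2}. evt t f = 0}"
proof -
  let ?F = "map_poly emb f :: 'k poly poly poly"
  have "?F \<noteq> 0"
  proof
    assume "?F = 0"
    then have "Polynomial.coeff ?F (degree f) = 0" by simp
    then have "emb (lead_coeff f) = (0 :: 'k poly poly)"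
      by (simp add: coeff_map_poly rhomD(4)[OF rhom_emb])
    then show False using assms by (simp add: emb_eq_0)
  qed
  then have "finite {a. poly ?F a = 0}" by (rule poly_roots_finite)
  then have "finite (scalar -` {a. poly ?F a = 0})"
    by (rule finite_vimageI) (simp add: inj_def scalar_def)
  then show ?thesis by (simp add: evt_def vimage_def)
qed

lemma finite_artin_schreier_preimage:
  fixes B :: "'k :: {field, char2} set"
  assumes "finite B" shows "finite {l. l ^ 2 + l \<in> B}"
proof -
  have "finite {l. poly [:t, 1, 1:] l = 0}" for t :: 'k
    by (rule poly_roots_finite) simp
  moreover have "{l. l ^ 2 + l \<in> B} \<subseteq> (\<Union>t\<in>B. {l. poly [:t, 1, 1:] l = 0})"
    by (auto simp: power2_eq_square algebra_simps)
  ultimately show ?thesis using assms by (meson finite_UN_I finite_subset)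
qed

lemma frobenius_period_gcd:
  fixes l :: "'k :: comm_ring_1"
  assumes a: "l ^ (2 ^ a) = l" and b: "l ^ (2 ^ b) = l"
  shows "l ^ (2 ^ gcd a b) = l"
proof (cases "a = 0")
  case False
  have iter: "l ^ (2 ^ (c * x)) = l" if "l ^ (2 ^ c) = l" for c x
    by (induction x) (simp_all add: power_add power_mult that)
  obtain x y where "a * x = b * y + gcd a b" using bezout_nat[OF False] by blast
  then have "l = l ^ (2 ^ (b * y + gcd a b))" using iter[OF a, of x] by simp
  also have "\<dots> = l ^ (2 ^ gcd a b)" by (simp only: power_add[of 2] power_mult[of l "2 ^ (b * y)"] iter[OF b])
  finally show ?thesis ..
qed (use b in simp)

text \<open>A root of \<open>1 + X + ... + X^(2^n - 2)\<close> is a \<open>(2^n - 1)\<close>-st root of unity other than 1.\<close>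

lemma frobenius_period_exists:
  assumes p: "Factorial_Ring.prime (n :: nat)"
  obtains l :: "'k :: {alg_closed_field, char2}" where "l ^ (2 ^ n) = l"
    "\<And>j. 0 < j \<Longrightarrow> \<not> n dvd j \<Longrightarrow> l ^ (2 ^ j) \<noteq> l"
proof -
  have n: "n \<ge> 2" using p prime_ge_2_nat by blast
  define M :: nat where "M = 2 ^ n - 1"
  have "(2 :: nat) ^ 2 \<le> 2 ^ n" using n by (intro power_increasing) simp_all
  then have M: "M \<ge> 3" "Suc M = 2 ^ n" "odd M" using n by (simp_all add: M_def)
  define P :: "'k poly" where "P = (\<Sum>i<M. Polynomial.monom 1 i)"
  have cP: "Polynomial.coeff P i = (if i < M then 1 else 0)" for i
    by (simp add: P_def coeff_sum coeff_monom)
  have "degree P \<ge> 1" by (rule le_degree) (use M in \<open>simp add: cP\<close>)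
  then obtain l where l: "poly P l = 0"
    using alg_closed_imp_poly_has_root[of P] by auto
  have e: "poly P l = (\<Sum>i<M. l ^ i)" by (simp add: P_def poly_sum poly_monom)
  have "l ^ M + 1 = (l + 1) * poly P l"
    using power_diff_1_eq[of l M] unfolding e char2_diff .
  then have "l ^ M + 1 = 0" using l by simp
  then have lM: "l ^ M = 1" by (simp only: char2_eq_iff[of "l ^ M" 1])
  then have per: "l ^ (2 ^ n) = l" unfolding M(2)[symmetric] by simp
  have "l \<noteq> 1"
  proof
    assume "l = 1"
    then have "poly P l = of_nat M" by (simp add: P_def poly_sum poly_monom)
    also have "\<dots> = 1" using M(3) by (auto elim!: oddE)
    finally show False using l by simp
  qed
  moreover have "l \<noteq> 0" using lM M(1) by (cases M) auto
  ultimately have l2: "l ^ (2 ^ 1) \<noteq> l" by (simp add: power2_eq_square)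
  have "l ^ (2 ^ j) \<noteq> l" if "0 < j" "\<not> n dvd j" for j
  proof
    assume "l ^ (2 ^ j) = l"
    then have "l ^ (2 ^ gcd n j) = l" using per by (intro frobenius_period_gcd)
    moreover have "gcd n j = 1" using p that(2) by (metis coprime_iff_gcd_eq_1 prime_imp_coprime)
    ultimately show False using l2 by simp
  qed
  then show thesis using that per by blast
qed

text \<open>Different primes give different \<open>l\<close>, so infinitely many parameters \<open>l^2 + l\<close> are available and a finite set of
  bad ones can be avoided.\<close>

lemma special_parameter_exists:
  fixes B :: "'k :: {alg_closed_field, char2} set"
  assumes "finite B"
  obtains l :: 'k and n where "odd n" "3 \<le> n" "l ^ (2 ^ n) = l"
    "\<forall>j. 0 < j \<longrightarrow> j < n \<longrightarrow> l ^ (2 ^ j) \<noteq> l" "l ^ 2 + l \<notin> B"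
proof -
  define Q where "Q = {n :: nat. Factorial_Ring.prime n \<and> n \<noteq> 2}"
  have "infinite Q"
  proof
    assume "finite Q"
    then have "finite (insert 2 Q)" by simp
    moreover have "{n :: nat. Factorial_Ring.prime n} \<subseteq> insert 2 Q" by (auto simp: Q_def)
    ultimately show False using primes_infinite finite_subset by blast
  qed
  have "\<forall>n\<in>Q. \<exists>l :: 'k. l ^ (2 ^ n) = l \<and> (\<forall>j. 0 < j \<longrightarrow> \<not> n dvd j \<longrightarrow> l ^ (2 ^ j) \<noteq> l)"
  proof
    fix n assume "n \<in> Q"
    then have "Factorial_Ring.prime n" by (simp add: Q_def)
    from frobenius_period_exists[OF this, where 'k='k]
    show "\<exists>l :: 'k. l ^ (2 ^ n) = l \<and> (\<forall>j. 0 < j \<longrightarrow> \<not> n dvd j \<longrightarrow> l ^ (2 ^ j) \<noteq> l)" by metis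
  qed
  then obtain L :: "nat \<Rightarrow> 'k" where L: "\<And>n. n \<in> Q \<Longrightarrow> L n ^ (2 ^ n) = L n"
    "\<And>n j. n \<in> Q \<Longrightarrow> 0 < j \<Longrightarrow> \<not> n dvd j \<Longrightarrow> L n ^ (2 ^ j) \<noteq> L n" by metis
  have "inj_on L Q"
  proof (rule inj_onI, rule ccontr)
    fix m n assume mn: "m \<in> Q" "n \<in> Q" "L m = L n" "m \<noteq> n"
    have "\<not> m dvd n" using mn unfolding Q_def by (auto dest: primes_dvd_imp_eq)
    moreover have "0 < n" using mn(2) by (simp add: Q_def prime_gt_0_nat)
    ultimately show False using L(2)[OF mn(1)] L(1)[OF mn(2)] mn(3) by metis
  qed
  then have "infinite (L ` Q)" using \<open>infinite Q\<close> finite_imageD by blast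
  then have "\<not> L ` Q \<subseteq> {l. l ^ 2 + l \<in> B}"
    using finite_artin_schreier_preimage[OF assms] finite_subset by blast
  then obtain n where n: "n \<in> Q" "L n ^ 2 + L n \<notin> B" by blast
  have on: "odd n" "3 \<le> n"
    using n(1) prime_odd_nat[of n] prime_ge_2_nat[of n] by (auto simp: Q_def)
  have per: "\<forall>j. 0 < j \<longrightarrow> j < n \<longrightarrow> L n ^ (2 ^ j) \<noteq> L n"
    using L(2)[OF n(1)] nat_dvd_not_less by blast
  show thesis by (rule that[OF on L(1)[OF n(1)] per n(2)])
qed

text \<open>Replace \<open>d\<close> by its remainder modulo \<open>g\<close> and choose a nonzero coefficient.  It and \<open>s\<close> vanish at only finitely many
  parameters; at any other one, \<open>s\<close> becomes a unit and \<open>not_in_closure_special\<close> applies.\<close>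

lemma not_in_closure_generic:
  assumes d: "\<not> gR dvd d" and s: "s \<noteq> 0"
  shows "\<exists>e. d * (sR s * uR) ^ (2 ^ e) \<notin> bracket_ideal (4 * 2 ^ e)"
proof (rule ccontr)
  assume "\<not> ?thesis"
  then have mem: "d * (sR s * uR) ^ (2 ^ e) \<in> bracket_ideal (4 * 2 ^ e)" for e by blast
  obtain q r where qr: "d = q * gR + r" "degree r < 4"
    using monic_division[of gR d] gR_degree by auto
  have "r \<noteq> 0" using d qr(1) by auto
  then obtain i where i: "Polynomial.coeff r i \<noteq> 0" by (metis leading_coeff_0_iff)
  have mem_r: "r * (sR s * uR) ^ (2 ^ e) \<in> bracket_ideal (4 * 2 ^ e)" for e
  proof -
    have "d * (sR s * uR) ^ (2 ^ e) + (q * (sR s * uR) ^ (2 ^ e)) * gR \<in> bracket_ideal (4 * 2 ^ e)"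
      by (intro bracket_ideal_add mem bracket_ideal_gR)
    also have "d * (sR s * uR) ^ (2 ^ e) + (q * (sR s * uR) ^ (2 ^ e)) * gR = r * (sR s * uR) ^ (2 ^ e)"
      unfolding qr(1) by (simp only: distrib_right mult_ac add_ac char2_add_left_self char2_add_self add_0_right add_0_left)
    finally show ?thesis .
  qed
  define B :: "bit alg_closure set" where
    "B = {t. evt t (Polynomial.coeff r i) = 0} \<union> {t. poly (map_poly of_F2 s) t = 0}"
  have "map_poly of_F2 s \<noteq> (0 :: bit alg_closure poly)"
    using s by (simp add: poly_eq_iff coeff_map_poly of_F2_eq_0 of_F2_def)
  then have "finite B" unfolding B_def by (intro finite_UnI finite_evt_zero i poly_roots_finite)
  then obtain l n where n: "odd n" "3 \<le> n" and l: "l ^ (2 ^ n) = l"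
    "\<forall>j. 0 < j \<longrightarrow> j < n \<longrightarrow> l ^ (2 ^ j) \<noteq> l" and B: "l ^ 2 + l \<notin> B"
    by (rule special_parameter_exists)
  define t where "t = l ^ 2 + l"
  define \<sigma> where "\<sigma> = map_poly (evt t)"
  note \<sigma> = rhomD[OF rhom_map_poly[OF rhom_evt[of t]], folded \<sigma>_def]
  define v where "v = poly (map_poly of_F2 s) t"
  have v: "v \<noteq> 0" using B by (simp add: B_def v_def t_def)
  have \<sigma>_const: "\<sigma> [:f:] = [:evt t f:]" for f
    by (simp add: \<sigma>_def map_poly_pCons rhomD(4)[OF rhom_evt])
  have \<sigma>z: "\<sigma> zR = [:0, 1:]"
    by (simp add: \<sigma>_def zR_def map_poly_pCons rhomD(1,4)[OF rhom_evt])
  have \<sigma>x: "\<sigma> xR = [:vx:]" "\<sigma> yR = [:vy:]" "\<sigma> uR = [:vx ^ 3 * vy ^ 2:] * [:0, 1:]"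
    unfolding xR_def yR_def uR_def \<sigma>(3) \<sigma>z \<sigma>_const evt_const
    by (simp_all add: rhomD[OF rhom_emb] emb_vx emb_vy)
  have \<sigma>s: "\<sigma> (sR s) = [:scalar v:]" by (simp add: sR_def \<sigma>_const evt_tconst v_def)
  have \<sigma>g: "\<sigma> gR = qpoly t"
    unfolding gR_def qpoly_def quartic_def \<sigma> \<sigma>z \<sigma>_const evt_const evt_t
    by (simp only: rhomD[OF rhom_emb] emb_vx emb_vy)
  have "degree (\<sigma> r) < 4" using qr(2) map_poly_degree_leq[of "evt t" r] rhomD(4)[OF rhom_evt] unfolding \<sigma>_def by (metis le_less_trans)
  moreover have "\<sigma> r \<noteq> 0"
  proof
    assume "\<sigma> r = 0"
    then have "Polynomial.coeff (\<sigma> r) i = 0" by simp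
    then show False using B by (simp add: \<sigma>_def coeff_map_poly rhomD(4)[OF rhom_evt] B_def t_def)
  qed
  moreover have "\<exists>A B C h. \<sigma> r * ([:vx ^ 3 * vy ^ 2:] * [:0, 1:]) ^ (2 ^ e) =
      [:vx ^ (4 * 2 ^ e):] * A + [:vy ^ (4 * 2 ^ e):] * B + [:0, 1:] ^ (4 * 2 ^ e) * C + h * qpoly (l ^ 2 + l)" for e
  proof -
    let ?k = "4 * 2 ^ e" and ?q = "2 ^ e"
    obtain A B C h where "r * (sR s * uR) ^ ?q = xR ^ ?k * A + yR ^ ?k * B + zR ^ ?k * C + h * gR"
      using mem_r[of e] unfolding bracket_ideal_def by blast
    then have "\<sigma> (r * (sR s * uR) ^ ?q) = \<sigma> (xR ^ ?k * A + yR ^ ?k * B + zR ^ ?k * C + h * gR)" by simp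
    then have eq: "\<sigma> r * ([:scalar v:] * ([:vx ^ 3 * vy ^ 2:] * [:0, 1:])) ^ ?q =
      [:vx:] ^ ?k * \<sigma> A + [:vy:] ^ ?k * \<sigma> B + [:0, 1:] ^ ?k * \<sigma> C + \<sigma> h * qpoly t"
      unfolding \<sigma> \<sigma>x \<sigma>z \<sigma>s \<sigma>g .
    define c where "c = [:scalar (inverse v):] ^ ?q"
    have "[:scalar (inverse v):] * [:scalar v:] = 1"
      using v by (simp add: scalar_def one_pCons)
    then have c1: "c * [:scalar v:] ^ ?q = 1" unfolding c_def by (simp flip: power_mult_distrib)
    have "\<sigma> r * ([:vx ^ 3 * vy ^ 2:] * [:0, 1:]) ^ ?q =
        c * [:scalar v:] ^ ?q * (\<sigma> r * ([:vx ^ 3 * vy ^ 2:] * [:0, 1:]) ^ ?q)" unfolding c1 by simp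
    also have "\<dots> = c * (\<sigma> r * ([:scalar v:] * ([:vx ^ 3 * vy ^ 2:] * [:0, 1:])) ^ ?q)"
      unfolding power_mult_distrib[of "[:scalar v:]"] by (simp only: mult_ac)
    also have "\<dots> = [:vx ^ ?k:] * (c * \<sigma> A) + [:vy ^ ?k:] * (c * \<sigma> B) + [:0, 1:] ^ ?k * (c * \<sigma> C) + (c * \<sigma> h) * qpoly t"
      unfolding eq poly_const_pow by (simp only: distrib_left mult_ac)
    finally show ?thesis unfolding t_def by blast
  qed
  ultimately show False using not_in_closure_special[OF n l(1)] l(2) by blast
qed

section \<open>The quartic is prime\<close>

lemma sum_distinct_degrees_nonzero:
  fixes f :: "'i \<Rightarrow> 'a :: comm_ring_1 poly"
  assumes "finite I" "i0 \<in> I" "f i0 \<noteq> 0"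
    and inj: "\<And>i j. i \<in> I \<Longrightarrow> j \<in> I \<Longrightarrow> f i \<noteq> 0 \<Longrightarrow> f j \<noteq> 0 \<Longrightarrow> degree (f i) = degree (f j) \<Longrightarrow> i = j"
  shows "sum f I \<noteq> 0"
proof -
  define J where "J = {i \<in> I. f i \<noteq> 0}"
  have J: "finite J" "J \<noteq> {}" using assms(1-3) by (auto simp: J_def)
  define D where "D = Max ((\<lambda>i. degree (f i)) ` J)"
  have "D \<in> (\<lambda>i. degree (f i)) ` J" unfolding D_def using J by (intro Max_in) auto
  then obtain i where i: "i \<in> J" "degree (f i) = D" by auto
  have "Polynomial.coeff (f j) D = 0" if j: "j \<in> I - {i}" for j
  proof (cases "f j = 0")
    case False
    then have "j \<in> J" using j by (simp add: J_def)
    then have "degree (f j) \<le> D" unfolding D_def using J(1) by (intro Max_ge) auto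
    moreover have "degree (f j) \<noteq> D" using inj[of j i] i j False by (auto simp: J_def)
    ultimately show ?thesis by (intro coeff_eq_0) simp
  qed simp
  then have "Polynomial.coeff (sum f I) D = Polynomial.coeff (f i) D"
    using assms(1) i(1) by (simp add: coeff_sum sum.remove[of I i] J_def)
  also have "\<dots> \<noteq> 0" using i by (auto simp: J_def)
  finally show ?thesis by auto
qed

type_synonym fracK = "bit poly poly fract"

text \<open>The value of \<open>t\<close> that makes \<open>z\<close> a root of \<open>g\<close>: as \<open>g\<close> is linear in \<open>t\<close>, substituting it embeds \<open>A\<close> into
  \<open>F_2(x, y)[z]\<close>, which is a domain.\<close>

definition tauK :: "fracK poly" where
  "tauK = - Polynomial.smult (inverse (to_fract DD ^ 2))
     ([:0, 1:] ^ 4 + [:to_fract DD:] * [:0, 1:] ^ 2 + [:to_fract EE:] * [:0, 1:])"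

lemma tauK_degree: "degree tauK = 4"
proof -
  have "(DD :: bit poly poly) \<noteq> 0"
  proof
    assume "(DD :: bit poly poly) = 0"
    then have "bcoeff (vx ^ 1 * vy ^ 1 :: bit poly poly) 1 1 = 0" by (simp only: power_one_right bcoeff_simps)
    then show False unfolding bcoeff_monomial by simp
  qed
  moreover have "[:0, 1:] ^ 4 + [:to_fract DD:] * [:0, 1:] ^ 2 + [:to_fract EE:] * [:0, 1:] =
      [:0, to_fract EE, to_fract DD, 0, 1 :: fracK:]" by (simp add: eval_nat_numeral)
  ultimately show ?thesis unfolding tauK_def by simp
qed

definition substK :: "bit poly poly poly \<Rightarrow> fracK poly" where
  "substK p = pcompose (map_poly to_fract p) tauK"

definition evalK :: "ambient \<Rightarrow> fracK poly" where
  "evalK f = poly (map_poly substK f) [:0, 1:]"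

lemma rhom_to_fract: "rhom to_fract"
  unfolding rhom_def by simp

lemma rhom_substK: "rhom substK"
proof -
  have "rhom (\<lambda>p. pcompose p tauK)"
    unfolding rhom_def by (simp add: pcompose_1 pcompose_add pcompose_mult)
  from rhom_comp[OF this rhom_map_poly[OF rhom_to_fract]] show ?thesis unfolding substK_def .
qed

lemma rhom_evalK: "rhom evalK"
  unfolding evalK_def by (rule rhom_comp[OF rhom_poly rhom_map_poly[OF rhom_substK]])

lemma evalK_gR: "evalK gR = 0"
proof -
  have "(DD :: bit poly poly) \<noteq> 0"
    using tauK_degree by (auto simp: tauK_def)
  have const: "substK [:p:] = [:to_fract p:]" for p
    by (simp add: substK_def map_poly_pCons)
  have t: "substK [:0, 1:] = tauK"
    by (simp add: substK_def map_poly_pCons pcompose_pCons)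
  have evalK_const: "evalK [:p:] = substK p" for p
    by (simp add: evalK_def map_poly_pCons rhomD(4)[OF rhom_substK])
  have z: "evalK zR = [:0, 1:]"
    by (simp add: evalK_def zR_def map_poly_pCons rhomD(1,4)[OF rhom_substK])
  have "evalK gR = [:0, 1:] ^ 4 + [:to_fract DD:] * [:0, 1:] ^ 2 + [:to_fract EE:] * [:0, 1:] + tauK * [:to_fract DD:] ^ 2"
    unfolding gR_def quartic_def by (simp only: rhomD[OF rhom_evalK] evalK_const z const t)
  also have "tauK * [:to_fract DD:] ^ 2 = - ([:0, 1:] ^ 4 + [:to_fract DD:] * [:0, 1:] ^ 2 + [:to_fract EE:] * [:0, 1:])"
    using \<open>DD \<noteq> 0\<close> unfolding tauK_def by (simp add: poly_const_pow)
  finally show ?thesis by simp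
qed

text \<open>The image of \<open>t\<close> has degree 4 in \<open>z\<close>, so the images of the four terms of a reduced polynomial have degrees
  in different residue classes modulo 4.\<close>

lemma evalK_nonzero:
  assumes "degree r < 4" "r \<noteq> 0"
  shows "evalK r \<noteq> 0"
proof -
  let ?f = "\<lambda>i. substK (Polynomial.coeff r i) * [:0, 1:] ^ i"
  have sub0: "substK p = 0 \<longleftrightarrow> p = 0" for p
  proof
    assume "substK p = 0"
    then have "map_poly to_fract p = 0"
      unfolding substK_def using pcompose_eq_0[of "map_poly to_fract p" tauK] tauK_degree by simp
    then show "p = 0" by (simp add: map_poly_eq_0_iff)
  qed (simp add: rhomD(4)[OF rhom_substK])
  have deg: "degree (?f i) = 4 * degree (Polynomial.coeff r i) + i" if "?f i \<noteq> 0" for i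
  proof -
    have "degree (?f i) = degree (substK (Polynomial.coeff r i)) + degree ([:0, 1 :: fracK:] ^ i)"
      using that by (intro degree_mult_eq) auto
    also have "degree ([:0, 1 :: fracK:] ^ i) = i" by (simp add: degree_power_eq)
    also have "degree (substK (Polynomial.coeff r i)) = 4 * degree (Polynomial.coeff r i)"
      unfolding substK_def degree_pcompose tauK_degree by (simp add: degree_map_poly)
    finally show ?thesis .
  qed
  have "evalK r = (\<Sum>i\<le>degree r. ?f i)"
  proof -
    have "evalK r = (\<Sum>i\<le>degree (map_poly substK r). ?f i)"
      unfolding evalK_def poly_altdef by (simp add: coeff_map_poly rhomD(4)[OF rhom_substK])
    also have "degree (map_poly substK r) = degree r" by (simp add: degree_map_poly sub0)
    finally show ?thesis .
  qed
  also have "\<dots> \<noteq> 0"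
  proof (rule sum_distinct_degrees_nonzero)
    show "?f (degree r) \<noteq> 0" using assms(2) by (simp add: sub0)
    fix i j assume ij: "i \<in> {..degree r}" "j \<in> {..degree r}" "?f i \<noteq> 0" "?f j \<noteq> 0" "degree (?f i) = degree (?f j)"
    then have "(4 * degree (Polynomial.coeff r i) + i) mod 4 = (4 * degree (Polynomial.coeff r j) + j) mod 4"
      using deg by metis
    moreover have "i < 4" "j < 4" using ij(1,2) assms(1) by auto
    ultimately show "i = j" unfolding mod_mult_self4 by simp
  qed auto
  finally show ?thesis .
qed

lemma gR_dvd_iff: "gR dvd f \<longleftrightarrow> evalK f = 0"
proof
  assume "gR dvd f"
  then obtain h where "f = gR * h" ..
  then show "evalK f = 0" by (simp add: rhomD(3)[OF rhom_evalK] evalK_gR)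
next
  assume f: "evalK f = 0"
  obtain q r where qr: "f = q * gR + r" "degree r < 4"
    using monic_division[of gR f] gR_degree by auto
  have "evalK r = 0" using f unfolding qr(1) by (simp add: rhomD[OF rhom_evalK] evalK_gR)
  then have "r = 0" using evalK_nonzero qr(2) by blast
  then show "gR dvd f" by (simp add: qr(1))
qed

lemma gR_prime: "gR dvd f * h \<Longrightarrow> gR dvd f \<or> gR dvd h"
  unfolding gR_dvd_iff by (simp add: rhomD(3)[OF rhom_evalK])

lemma gR_not_dvd_low_degree: "degree r < 4 \<Longrightarrow> r \<noteq> 0 \<Longrightarrow> \<not> gR dvd r"
  unfolding gR_dvd_iff by (rule evalK_nonzero)

section \<open>The Hilbert basis theorem\<close>

definition is_ideal :: "'a :: comm_ring_1 set \<Rightarrow> bool" where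
  "is_ideal I \<longleftrightarrow> 0 \<in> I \<and> (\<forall>a\<in>I. \<forall>b\<in>I. a + b \<in> I) \<and> (\<forall>a\<in>I. \<forall>r. r * a \<in> I)"

text \<open>Generation is expressed through all larger ideals, which avoids sums over generators.\<close>

definition finitely_generated :: "'a :: comm_ring_1 set \<Rightarrow> bool" where
  "finitely_generated I \<longleftrightarrow> (\<exists>G. finite G \<and> G \<subseteq> I \<and> (\<forall>J. is_ideal J \<longrightarrow> G \<subseteq> J \<longrightarrow> I \<subseteq> J))"

definition noetherian_type :: "'a :: comm_ring_1 itself \<Rightarrow> bool" where
  "noetherian_type _ \<longleftrightarrow> (\<forall>I :: 'a set. is_ideal I \<longrightarrow> finitely_generated I)"

lemma is_idealD:
  assumes "is_ideal I"
  shows "0 \<in> I" "a \<in> I \<Longrightarrow> b \<in> I \<Longrightarrow> a + b \<in> I" "a \<in> I \<Longrightarrow> r * a \<in> I" "a \<in> I \<Longrightarrow> b \<in> I \<Longrightarrow> a - b \<in> I"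
proof -
  show *: "0 \<in> I" "a \<in> I \<Longrightarrow> b \<in> I \<Longrightarrow> a + b \<in> I" "a \<in> I \<Longrightarrow> r * a \<in> I" for a b r
    using assms unfolding is_ideal_def by blast+
  show "a \<in> I \<Longrightarrow> b \<in> I \<Longrightarrow> a - b \<in> I" using *(2)[of a "- 1 * b"] *(3)[of b "- 1"] by simp
qed

lemma noetherian_type_bit: "noetherian_type TYPE(bit)"
  unfolding noetherian_type_def
proof (intro allI impI)
  fix I :: "bit set"
  show "finitely_generated I" unfolding finitely_generated_def
    by (intro exI[of _ I]) (auto intro: finite_subset[OF _ finite_bit])
qed

definition leading :: "'a :: comm_ring_1 poly set \<Rightarrow> nat \<Rightarrow> 'a set" where
  "leading I n = {Polynomial.coeff f n |f. f \<in> I \<and> degree f \<le> n}"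

lemma is_ideal_leading:
  assumes "is_ideal I" shows "is_ideal (leading I n)"
  unfolding is_ideal_def
proof (intro conjI ballI allI)
  note I = is_idealD[OF assms]
  show "0 \<in> leading I n" unfolding leading_def using I(1) by force
  fix a assume "a \<in> leading I n"
  then obtain f where f: "a = Polynomial.coeff f n" "f \<in> I" "degree f \<le> n" unfolding leading_def by blast
  show "r * a \<in> leading I n" for r
  proof -
    have "r * a = Polynomial.coeff ([:r:] * f) n" "[:r:] * f \<in> I" "degree ([:r:] * f) \<le> n"
      using f(1,3) I(3)[OF f(2), of "[:r:]"] by (auto intro: order_trans[OF degree_smult_le])
    then show ?thesis unfolding leading_def by blast
  qed
  fix b assume "b \<in> leading I n"
  then obtain g where g: "b = Polynomial.coeff g n" "g \<in> I" "degree g \<le> n" unfolding leading_def by blast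
  have "a + b = Polynomial.coeff (f + g) n" "f + g \<in> I" "degree (f + g) \<le> n"
    using f g I(2) by (auto intro: degree_add_le)
  then show "a + b \<in> leading I n" unfolding leading_def by blast
qed

lemma leading_mono:
  assumes I: "is_ideal I" and "m \<le> n" shows "leading I m \<subseteq> leading I n"
proof
  fix a assume "a \<in> leading I m"
  then obtain f where f: "a = Polynomial.coeff f m" "f \<in> I" "degree f \<le> m" unfolding leading_def by blast
  let ?g = "Polynomial.monom 1 (n - m) * f"
  have "Polynomial.coeff ?g n = a" using f assms(2) by (simp add: coeff_monom_mult)
  moreover have "degree ?g \<le> n"
    using degree_mult_le[of "Polynomial.monom 1 (n - m)" f] degree_monom_le[of "1 :: 'a" "n - m"] f(3) assms(2) by linarith
  moreover have "?g \<in> I" using is_idealD(3)[OF I f(2)] .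
  ultimately show "a \<in> leading I n" unfolding leading_def by blast
qed

lemma finite_subset_leading:
  assumes I: "is_ideal I" and "finite G" "G \<subseteq> (\<Union>n. leading I n)"
  shows "\<exists>N. G \<subseteq> leading I N"
  using assms(2,3)
proof (induction G)
  case (insert a G)
  then obtain N n where "G \<subseteq> leading I N" "a \<in> leading I n" by auto
  then have "insert a G \<subseteq> leading I (max N n)"
    using leading_mono[OF I, of N "max N n"] leading_mono[OF I, of n "max N n"] by auto
  then show ?case by blast
qed simp

text \<open>Choose generators for the ideals of leading coefficients in degrees up to \<open>N\<close>, where \<open>N\<close> is so large that
  degree \<open>N\<close> already contains generators of the union of all of them, and lift them to polynomials.  An ideal \<open>J\<close>
  containing the lifts has, in every degree, all leading coefficients that \<open>I\<close> has.\<close>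

lemma hilbert_basis:
  assumes "noetherian_type TYPE('a :: comm_ring_1)"
  shows "noetherian_type TYPE('a poly)"
  unfolding noetherian_type_def
proof (intro allI impI)
  fix I :: "'a poly set" assume I: "is_ideal I"
  define L where "L = (\<Union>n. leading I n)"
  have "is_ideal L"
    unfolding is_ideal_def
  proof (intro conjI ballI allI)
    show "0 \<in> L" using is_idealD(1)[OF is_ideal_leading[OF I]] by (auto simp: L_def)
    fix a assume "a \<in> L"
    then obtain m where m: "a \<in> leading I m" by (auto simp: L_def)
    then show "r * a \<in> L" for r using is_idealD(3)[OF is_ideal_leading[OF I]] by (auto simp: L_def)
    fix b assume "b \<in> L"
    then obtain n where n: "b \<in> leading I n" by (auto simp: L_def)
    have "a \<in> leading I (max m n)" "b \<in> leading I (max m n)"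
      using leading_mono[OF I, of m "max m n"] leading_mono[OF I, of n "max m n"] m n by auto
    then show "a + b \<in> L" using is_idealD(2)[OF is_ideal_leading[OF I]] unfolding L_def by blast
  qed
  then have "finitely_generated L" using assms unfolding noetherian_type_def by blast
  then obtain G where G: "finite G" "G \<subseteq> L" "\<forall>J. is_ideal J \<longrightarrow> G \<subseteq> J \<longrightarrow> L \<subseteq> J"
    unfolding finitely_generated_def by blast
  obtain N where N: "G \<subseteq> leading I N"
    using finite_subset_leading[OF I G(1)] G(2) unfolding L_def by blast
  define gens where "gens n H \<longleftrightarrow> finite H \<and> H \<subseteq> leading I n \<and> (\<forall>J. is_ideal J \<longrightarrow> H \<subseteq> J \<longrightarrow> leading I n \<subseteq> J)" for n H
  define H where "H n = (SOME H. gens n H)" for n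
  have "gens n (H n)" for n
  proof -
    have "finitely_generated (leading I n)" using assms is_ideal_leading[OF I] unfolding noetherian_type_def by blast
    then have "\<exists>H. gens n H" unfolding finitely_generated_def gens_def .
    then show ?thesis unfolding H_def by (rule someI_ex)
  qed
  then have H: "finite (H n)" "H n \<subseteq> leading I n" "\<forall>J. is_ideal J \<longrightarrow> H n \<subseteq> J \<longrightarrow> leading I n \<subseteq> J" for n
    unfolding gens_def by blast+
  define F where "F n a = (SOME f. f \<in> I \<and> degree f \<le> n \<and> Polynomial.coeff f n = a)" for n a
  have "F n a \<in> I \<and> degree (F n a) \<le> n \<and> Polynomial.coeff (F n a) n = a" if "a \<in> leading I n" for n a
  proof -
    have "\<exists>f. f \<in> I \<and> degree f \<le> n \<and> Polynomial.coeff f n = a" using that unfolding leading_def by blast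
    then show ?thesis unfolding F_def by (rule someI_ex)
  qed
  then have F: "F n a \<in> I" "degree (F n a) \<le> n" "Polynomial.coeff (F n a) n = a" if "a \<in> leading I n" for n a
    using that by blast+
  define B where "B = F N ` G \<union> (\<Union>n\<le>N. F n ` H n)"
  have "finite B" using G(1) H(1) by (simp add: B_def)
  moreover have "B \<subseteq> I" using F(1) N H(2) unfolding B_def by blast
  moreover have "I \<subseteq> J" if J: "is_ideal J" "B \<subseteq> J" for J
  proof -
    have IJ: "is_ideal (I \<inter> J)" using I J(1) unfolding is_ideal_def by blast
    have BI: "F N a \<in> I \<inter> J" if "a \<in> G" for a using that \<open>B \<subseteq> I\<close> J(2) unfolding B_def by blast
    have BH: "F n a \<in> I \<inter> J" if "n \<le> N" "a \<in> H n" for n a using that \<open>B \<subseteq> I\<close> J(2) unfolding B_def by blast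
    have lead: "leading I n \<subseteq> leading (I \<inter> J) n" for n
    proof (cases "n \<le> N")
      case True
      have "H n \<subseteq> leading (I \<inter> J) n"
      proof
        fix a assume "a \<in> H n"
        then have "a \<in> leading I n" "F n a \<in> I \<inter> J" using H(2) BH[OF True] by auto
        then show "a \<in> leading (I \<inter> J) n" unfolding leading_def[of "I \<inter> J"] using F(2,3) by force
      qed
      then show ?thesis using H(3) is_ideal_leading[OF IJ] by blast
    next
      case False
      have "G \<subseteq> leading (I \<inter> J) N"
      proof
        fix a assume "a \<in> G"
        then have "a \<in> leading I N" "F N a \<in> I \<inter> J" using N BI by auto
        then show "a \<in> leading (I \<inter> J) N" unfolding leading_def[of "I \<inter> J"] using F(2,3) by force
      qed
      then have "L \<subseteq> leading (I \<inter> J) N" using G(3) is_ideal_leading[OF IJ] by blast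
      also have "\<dots> \<subseteq> leading (I \<inter> J) n" using False by (intro leading_mono[OF IJ]) simp
      finally show ?thesis unfolding L_def by blast
    qed
    have "f \<in> J" if "f \<in> I" "degree f < n" for f n
      using that
    proof (induction n arbitrary: f)
      case (Suc n)
      have "Polynomial.coeff f n \<in> leading I n" unfolding leading_def using Suc.prems by force
      then obtain g where g: "Polynomial.coeff f n = Polynomial.coeff g n" "g \<in> I" "g \<in> J" "degree g \<le> n"
        using lead[of n] unfolding leading_def[of "I \<inter> J"] by blast
      have fg: "f - g \<in> I" using is_idealD(4)[OF I] Suc.prems(1) g(2) by blast
      have "f - g \<in> J"
      proof (cases "f - g = 0")
        case True then show ?thesis using is_idealD(1)[OF J(1)] by simp
      next
        case False
        have "degree (f - g) \<le> n" using Suc.prems(2) g(4) by (intro degree_diff_le) simp_all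
        moreover have "degree (f - g) \<noteq> n"
          using False g(1) by (metis coeff_diff diff_self leading_coeff_0_iff)
        ultimately have "degree (f - g) < n" by simp
        then show ?thesis using Suc.IH fg by blast
      qed
      then show ?case using is_idealD(2)[OF J(1), of "f - g" g] g(3) by simp
    qed simp
    then show ?thesis by (meson lessI subsetI)
  qed
  ultimately show "finitely_generated I" unfolding finitely_generated_def by blast
qed

section \<open>Quotients of polynomial rings as rings on natural numbers\<close>

instance poly :: ("{countable, zero}") countable
proof
  show "\<exists>f :: 'a poly \<Rightarrow> nat. inj f"
    by (rule exI[of _ "\<lambda>p. to_nat (coeffs p)"]) (simp add: inj_def coeffs_eq_iff)
qed

instance bit :: countable
  by (rule countable_classI[of "\<lambda>b. if b = 0 then 0 else 1"]) (auto split: if_splits)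

lemma cring_idealI:
  fixes R (structure)
  assumes R: "cring R" and I: "I \<subseteq> carrier R" "\<zero> \<in> I"
    "\<And>a b. a \<in> I \<Longrightarrow> b \<in> I \<Longrightarrow> a \<oplus> b \<in> I" "\<And>a r. a \<in> I \<Longrightarrow> r \<in> carrier R \<Longrightarrow> r \<otimes> a \<in> I"
  shows "ideal I R"
proof -
  interpret cring R by (rule R)
  show ?thesis
  proof (rule idealI)
    show "ring R" by (rule ring_axioms)
    show "subgroup I (add_monoid R)"
    proof (rule add.subgroupI)
      fix a assume a: "a \<in> I"
      then have "\<ominus> a = (\<ominus> \<one>) \<otimes> a" using I(1) by (simp add: l_minus subset_iff)
      then show "\<ominus> a \<in> I" using I(4)[OF a, of "\<ominus> \<one>"] by simp
    qed (use I in auto)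
    show "a \<otimes> x \<in> I" if "a \<in> I" "x \<in> carrier R" for a x
      using I(1) I(4)[OF that] that m_comm by (metis subset_iff)
  qed (use I in auto)
qed

lemma ring_char_eq_2:
  fixes R (structure)
  assumes R: "ring R" and "\<one> \<noteq> \<zero>" "\<one> \<oplus> \<one> = \<zero>"
  shows "ring_char R = 2"
proof -
  interpret ring R by (rule R)
  have "[(2 :: nat)] \<cdot> \<one> = \<zero>" using assms(3) by (simp add: numeral_2_eq_2 add.nat_pow_Suc)
  then have "ring_char R dvd 2" by (simp only: ring_char_dvd_iff)
  moreover have "[(1 :: nat)] \<cdot> \<one> \<noteq> \<zero>" using assms(2) by simp
  then have "\<not> ring_char R dvd 1" by (simp only: ring_char_dvd_iff not_False_eq_True)
  ultimately show ?thesis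
    by (metis One_nat_def dvd_refl prime_nat_iff two_is_prime_nat)
qed

text \<open>A quotient is encoded by a map \<open>\<phi>\<close> whose fibres are the residue classes; products and sums are computed on
  arbitrary preimages.\<close>

definition quotient_ring :: "('a :: comm_ring_1 \<Rightarrow> 'b) \<Rightarrow> 'b ring" where
  "quotient_ring \<phi> = \<lparr>carrier = range \<phi>, mult = (\<lambda>m n. \<phi> (inv_into UNIV \<phi> m * inv_into UNIV \<phi> n)), one = \<phi> 1,
     zero = \<phi> 0, add = (\<lambda>m n. \<phi> (inv_into UNIV \<phi> m + inv_into UNIV \<phi> n))\<rparr>"

definition quotient_map :: "('a :: comm_ring_1 \<Rightarrow> 'b) \<Rightarrow> 'a set \<Rightarrow> bool" where
  "quotient_map \<phi> P \<longleftrightarrow> is_ideal P \<and> (\<forall>a b. \<phi> a = \<phi> b \<longleftrightarrow> a - b \<in> P)"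

text \<open>Number the chosen representatives of the residue classes.\<close>

lemma quotient_map_exists:
  fixes P :: "'a :: {comm_ring_1, countable} set"
  assumes P: "is_ideal P"
  shows "\<exists>\<phi> :: 'a \<Rightarrow> nat. quotient_map \<phi> P"
proof -
  define rep where "rep a = (SOME b. a - b \<in> P)" for a
  have rep: "a - rep a \<in> P" for a
    unfolding rep_def by (rule someI[of _ a]) (simp add: is_idealD(1)[OF P])
  have "rep a = rep b \<longleftrightarrow> a - b \<in> P" for a b
  proof
    assume "rep a = rep b"
    then have eq: "a - b = (a - rep a) - (b - rep b)" by simp
    show "a - b \<in> P" by (subst eq) (rule is_idealD(4)[OF P rep rep])
  next
    assume ab: "a - b \<in> P"
    have "a - c \<in> P \<longleftrightarrow> b - c \<in> P" for c
      using is_idealD(2)[OF P ab, of "b - c"] is_idealD(4)[OF P _ ab, of "a - c"] by auto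
    then show "rep a = rep b" unfolding rep_def by simp
  qed
  then have "quotient_map (\<lambda>a. to_nat (rep a)) P" unfolding quotient_map_def using P by simp
  then show ?thesis by blast
qed

context
  fixes \<phi> :: "'a :: comm_ring_1 \<Rightarrow> 'b" and P :: "'a set"
  assumes q: "quotient_map \<phi> P"
begin

lemma q_ideal: "is_ideal P" using q by (simp add: quotient_map_def)

lemma q_eq: "\<phi> a = \<phi> b \<longleftrightarrow> a - b \<in> P" using q by (simp add: quotient_map_def)

lemma q_inv: "inv_into UNIV \<phi> (\<phi> a) - a \<in> P"
  unfolding q_eq[symmetric] by (rule f_inv_into_f) simp

lemma q_carrier: "carrier (quotient_ring \<phi>) = range \<phi>" and q_one: "\<one>\<^bsub>quotient_ring \<phi>\<^esub> = \<phi> 1"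
  and q_zero: "\<zero>\<^bsub>quotient_ring \<phi>\<^esub> = \<phi> 0"
  by (simp_all add: quotient_ring_def)

lemma q_mult: "\<phi> a \<otimes>\<^bsub>quotient_ring \<phi>\<^esub> \<phi> b = \<phi> (a * b)"
proof -
  let ?a = "inv_into UNIV \<phi> (\<phi> a)" and ?b = "inv_into UNIV \<phi> (\<phi> b)"
  have "?a * ?b - a * b = ?a * (?b - b) + b * (?a - a)" by (simp add: algebra_simps)
  also have "\<dots> \<in> P" by (intro is_idealD(2,3)[OF q_ideal] q_inv)
  finally show ?thesis by (simp add: quotient_ring_def q_eq)
qed

lemma q_add: "\<phi> a \<oplus>\<^bsub>quotient_ring \<phi>\<^esub> \<phi> b = \<phi> (a + b)"
proof -
  let ?a = "inv_into UNIV \<phi> (\<phi> a)" and ?b = "inv_into UNIV \<phi> (\<phi> b)"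
  have "?a + ?b - (a + b) = (?a - a) + (?b - b)" by (simp add: algebra_simps)
  also have "\<dots> \<in> P" by (intro is_idealD(2)[OF q_ideal] q_inv)
  finally show ?thesis by (simp add: quotient_ring_def q_eq)
qed

lemma q_pow: "\<phi> a [^]\<^bsub>quotient_ring \<phi>\<^esub> (n :: nat) = \<phi> (a ^ n)"
  by (induction n) (simp_all add: nat_pow_def q_one q_mult mult.commute)

lemmas q_simps = q_carrier q_one q_zero q_mult q_add q_pow

lemma q_cring: "cring (quotient_ring \<phi>)"
proof (rule cringI)
  show "abelian_group (quotient_ring \<phi>)"
  proof (rule abelian_groupI)
    fix x assume "x \<in> carrier (quotient_ring \<phi>)"
    then obtain a where "x = \<phi> a" by (auto simp: q_carrier)
    then show "\<exists>y\<in>carrier (quotient_ring \<phi>). y \<oplus>\<^bsub>quotient_ring \<phi>\<^esub> x = \<zero>\<^bsub>quotient_ring \<phi>\<^esub>"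
      by (intro bexI[of _ "\<phi> (- a)"]) (simp_all add: q_simps)
  qed (auto simp: q_simps add_ac)
  show "comm_monoid (quotient_ring \<phi>)"
    by (rule comm_monoidI) (auto simp: q_simps mult_ac)
qed (auto simp: q_simps algebra_simps)

lemma q_ideal_image: "is_ideal J \<Longrightarrow> ideal (\<phi> ` J) (quotient_ring \<phi>)"
proof (rule cring_idealI[OF q_cring])
  assume J: "is_ideal J"
  show "\<phi> ` J \<subseteq> carrier (quotient_ring \<phi>)" by (auto simp: q_carrier)
  show "\<zero>\<^bsub>quotient_ring \<phi>\<^esub> \<in> \<phi> ` J" using is_idealD(1)[OF J] by (simp add: q_zero)
  fix x assume x: "x \<in> \<phi> ` J"
  show "x \<oplus>\<^bsub>quotient_ring \<phi>\<^esub> y \<in> \<phi> ` J" if "y \<in> \<phi> ` J" for y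
    using x that is_idealD(2)[OF J] by (auto simp: q_add)
  show "r \<otimes>\<^bsub>quotient_ring \<phi>\<^esub> x \<in> \<phi> ` J" if "r \<in> carrier (quotient_ring \<phi>)" for r
    using x that is_idealD(3)[OF J] by (auto simp: q_mult q_carrier)
qed

lemma q_ideal_vimage:
  assumes "ideal I (quotient_ring \<phi>)" shows "is_ideal (\<phi> -` I)"
proof -
  interpret I: ideal I "quotient_ring \<phi>" by (rule assms)
  have "\<phi> 0 \<in> I" using additive_subgroup.zero_closed[OF ideal.axioms(1)[OF assms]] by (simp add: q_zero)
  moreover have "\<phi> (a + b) \<in> I" if "\<phi> a \<in> I" "\<phi> b \<in> I" for a b
    using additive_subgroup.a_closed[OF ideal.axioms(1)[OF assms] that] by (simp add: q_add)
  moreover have "\<phi> (r * a) \<in> I" if "\<phi> a \<in> I" for r a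
    using I.I_l_closed[OF that, of "\<phi> r"] by (simp add: q_mult q_carrier)
  ultimately show ?thesis unfolding is_ideal_def by simp
qed

lemma q_noetherian_domain:
  assumes n: "noetherian_type TYPE('a)" and prime: "1 \<notin> P" "\<And>a b. a * b \<in> P \<Longrightarrow> a \<in> P \<or> b \<in> P"
  shows "noetherian_domain (quotient_ring \<phi>)"
proof -
  interpret cring "quotient_ring \<phi>" by (rule q_cring)
  have "domain (quotient_ring \<phi>)"
  proof (rule domainI)
    show "\<one>\<^bsub>quotient_ring \<phi>\<^esub> \<noteq> \<zero>\<^bsub>quotient_ring \<phi>\<^esub>" using prime(1) by (simp add: q_simps q_eq)
    fix x y assume xy: "x \<otimes>\<^bsub>quotient_ring \<phi>\<^esub> y = \<zero>\<^bsub>quotient_ring \<phi>\<^esub>" "x \<in> carrier (quotient_ring \<phi>)" "y \<in> carrier (quotient_ring \<phi>)"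
    then obtain a b where "x = \<phi> a" "y = \<phi> b" by (auto simp: q_carrier)
    then show "x = \<zero>\<^bsub>quotient_ring \<phi>\<^esub> \<or> y = \<zero>\<^bsub>quotient_ring \<phi>\<^esub>" using xy(1) prime(2)[of a b] by (simp add: q_simps q_eq)
  qed (rule q_cring)
  moreover have "noetherian_ring (quotient_ring \<phi>)"
  proof (rule noetherian_ringI)
    fix I assume I: "ideal I (quotient_ring \<phi>)"
    then have "finitely_generated (\<phi> -` I)" using n q_ideal_vimage unfolding noetherian_type_def by blast
    then obtain G where G: "finite G" "G \<subseteq> \<phi> -` I" "\<forall>J. is_ideal J \<longrightarrow> G \<subseteq> J \<longrightarrow> \<phi> -` I \<subseteq> J"
      unfolding finitely_generated_def by blast
    have carr: "\<phi> ` G \<subseteq> carrier (quotient_ring \<phi>)" by (auto simp: q_carrier)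
    have "I \<subseteq> carrier (quotient_ring \<phi>)" using I by (simp add: ideal.axioms(1) additive_subgroup.a_subset)
    have "\<phi> -` I \<subseteq> \<phi> -` (Idl\<^bsub>quotient_ring \<phi>\<^esub> (\<phi> ` G))"
      using G(3) q_ideal_vimage[OF genideal_ideal[OF carr]] genideal_self[OF carr] by (metis image_subset_iff_subset_vimage)
    then have "I \<subseteq> Idl\<^bsub>quotient_ring \<phi>\<^esub> (\<phi> ` G)" using \<open>I \<subseteq> carrier (quotient_ring \<phi>)\<close> unfolding q_carrier by blast
    moreover have "Idl\<^bsub>quotient_ring \<phi>\<^esub> (\<phi> ` G) \<subseteq> I" using genideal_minimal[OF I] G(2) by blast
    ultimately show "\<exists>B\<subseteq>carrier (quotient_ring \<phi>). finite B \<and> I = Idl\<^bsub>quotient_ring \<phi>\<^esub> B"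
      using carr G(1) by (intro exI[of _ "\<phi> ` G"]) auto
  qed
  ultimately show ?thesis unfolding noetherian_domain_def by blast
qed

end

section \<open>The counterexample\<close>

definition P0 :: "ambient set" where "P0 = {f. gR dvd f}"

lemma is_ideal_P0: "is_ideal P0"
  unfolding is_ideal_def P0_def by auto

lemma is_ideal_bracket_ideal: "is_ideal (bracket_ideal k)"
  unfolding is_ideal_def using bracket_ideal_add bracket_ideal_mult bracket_ideal_gR[of 0] by auto

lemma P0_bracket_ideal: "f \<in> P0 \<Longrightarrow> f \<in> bracket_ideal k"
  unfolding P0_def using bracket_ideal_gR by (auto elim!: dvdE simp: mult.commute)

lemma bracket_ideal_frobenius: "f \<in> bracket_ideal k \<Longrightarrow> f ^ (2 ^ e) \<in> bracket_ideal (k * 2 ^ e)"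
proof -
  assume "f \<in> bracket_ideal k"
  then obtain A B C h where f: "f = xR ^ k * A + yR ^ k * B + zR ^ k * C + h * gR" unfolding bracket_ideal_def by blast
  have g: "gR ^ (2 ^ e) = gR ^ (2 ^ e - 1) * gR" by (simp flip: power_Suc2)
  have "f ^ (2 ^ e) = xR ^ (k * 2 ^ e) * A ^ (2 ^ e) + yR ^ (k * 2 ^ e) * B ^ (2 ^ e) + zR ^ (k * 2 ^ e) * C ^ (2 ^ e)
      + (h ^ (2 ^ e) * gR ^ (2 ^ e - 1)) * gR"
    unfolding f char2_power_add power_mult_distrib power_mult by (simp only: g mult.assoc)
  then show ?thesis by (simp only: bracket_idealI)
qed

lemma noetherian_type_ambient: "noetherian_type TYPE(ambient)"
  by (intro hilbert_basis noetherian_type_bit)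

lemma sR_simps: "sR (a * b) = sR a * sR b" "sR 1 = 1"
  by (simp add: sR_def tconst_simps, simp only: sR_def tconst_simps one_pCons[symmetric])

lemma sR_not_P0: "s \<noteq> 0 \<Longrightarrow> sR s \<notin> P0"
proof -
  assume "s \<noteq> 0"
  have "sR s \<noteq> 0"
  proof
    assume "sR s = 0"
    then have "tconst s = 0" by (simp add: sR_def)
    then have "scalar (Polynomial.coeff s (degree s)) = 0"
      by (metis coeff_0 coeff_map_poly rhomD(4)[OF rhom_scalar] tconst_def)
    then show False using \<open>s \<noteq> 0\<close> by (simp add: scalar_def)
  qed
  then show ?thesis unfolding P0_def using gR_not_dvd_low_degree[of "sR s"] by (simp add: sR_def)
qed

text \<open>The multiplier \<open>x E\<close> of \<open>in_closure_generic\<close>.\<close>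

definition dR :: ambient where "dR = [:[:vx * EE:]:]"

lemma dR_not_P0: "dR \<notin> P0"
proof -
  have "(vx :: bit poly poly) \<noteq> 0" by (simp add: vx_def)
  then have "(vx * EE :: bit poly poly) \<noteq> 0" using EE_nonzero by (simp only: mult_eq_0_iff) simp
  then show ?thesis unfolding P0_def dR_def using gR_not_dvd_low_degree[of "[:[:vx * EE:]:]"] by simp
qed

context
  fixes \<phi> :: "ambient \<Rightarrow> nat"
  assumes q: "quotient_map \<phi> P0"
begin

abbreviation "AA \<equiv> quotient_ring \<phi>"
abbreviation "II \<equiv> \<phi> ` bracket_ideal 4"
abbreviation "SS \<equiv> (\<lambda>s. \<phi> (sR s)) ` {s. s \<noteq> 0}"

lemmas A_simps = q_carrier[OF q] q_one[OF q] q_zero[OF q] q_mult[OF q] q_add[OF q] q_pow[OF q]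

lemma A_noetherian_domain: "noetherian_domain AA"
proof (rule q_noetherian_domain[OF q noetherian_type_ambient])
  show "1 \<notin> P0" using sR_not_P0[of 1] by (simp add: sR_simps)
  show "a * b \<in> P0 \<Longrightarrow> a \<in> P0 \<or> b \<in> P0" for a b unfolding P0_def using gR_prime by blast
qed

interpretation AA: domain AA
  using A_noetherian_domain by (simp add: noetherian_domain_def)

lemma phi_eq_0: "\<phi> a = \<phi> 0 \<longleftrightarrow> a \<in> P0"
  using q_eq[OF q, of a 0] by simp

lemma A_char: "ring_char AA = 2"
proof (rule ring_char_eq_2[OF AA.ring_axioms AA.one_not_zero])
  show "\<one>\<^bsub>AA\<^esub> \<oplus>\<^bsub>AA\<^esub> \<one>\<^bsub>AA\<^esub> = \<zero>\<^bsub>AA\<^esub>" by (simp add: A_simps)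
qed

lemma S_submonoid: "submonoid SS AA"
proof
  show "SS \<subseteq> carrier AA" by (auto simp: A_simps)
  show "\<one>\<^bsub>AA\<^esub> \<in> SS" by (rule image_eqI[of _ _ 1]) (simp_all add: A_simps sR_simps)
  fix x y assume "x \<in> SS" "y \<in> SS"
  then obtain a b where "x = \<phi> (sR a)" "y = \<phi> (sR b)" "a \<noteq> 0" "b \<noteq> 0" by auto
  then show "x \<otimes>\<^bsub>AA\<^esub> y \<in> SS" by (intro image_eqI[of _ _ "a * b"]) (simp_all add: A_simps sR_simps)
qed

lemma S_nonzero: "\<zero>\<^bsub>AA\<^esub> \<notin> SS"
proof
  assume "\<zero>\<^bsub>AA\<^esub> \<in> SS"
  then obtain s where "s \<noteq> 0" "\<phi> (sR s) = \<phi> 0" by (auto simp: A_simps)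
  then show False using sR_not_P0 phi_eq_0 by blast
qed

lemma I_ideal: "ideal II AA"
  by (rule q_ideal_image[OF q is_ideal_bracket_ideal])

text \<open>The generators of a Frobenius power of \<open>I\<close> can be taken to be the powers of generators of \<open>I\<close>, because the
  \<open>2^e\<close>-th power map is additive.\<close>

lemma frobenius_power_A: "frobenius_power AA II (2 ^ e) = \<phi> ` bracket_ideal (4 * 2 ^ e)"
proof
  show "frobenius_power AA II (2 ^ e) \<subseteq> \<phi> ` bracket_ideal (4 * 2 ^ e)"
    unfolding frobenius_power_def
    by (rule AA.genideal_minimal[OF q_ideal_image[OF q is_ideal_bracket_ideal]]) (auto simp: A_simps bracket_ideal_frobenius)
  have carr: "{v [^]\<^bsub>AA\<^esub> (2 ^ e :: nat) |v. v \<in> II} \<subseteq> carrier AA" by (auto simp: A_simps)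
  have J: "is_ideal (\<phi> -` frobenius_power AA II (2 ^ e))"
    unfolding frobenius_power_def by (rule q_ideal_vimage[OF q AA.genideal_ideal[OF carr]])
  have mem: "f ^ (2 ^ e) \<in> \<phi> -` frobenius_power AA II (2 ^ e)" if "f \<in> bracket_ideal 4" for f
  proof -
    have "\<phi> f [^]\<^bsub>AA\<^esub> (2 ^ e :: nat) \<in> frobenius_power AA II (2 ^ e)"
      using AA.genideal_self[OF carr] that unfolding frobenius_power_def by blast
    then show ?thesis by (simp add: A_simps)
  qed
  have g: "xR ^ 4 \<in> bracket_ideal 4" "yR ^ 4 \<in> bracket_ideal 4" "zR ^ 4 \<in> bracket_ideal 4"
    using bracket_ideal_x[of 4 1] bracket_ideal_y[of 4 1] bracket_ideal_z[of 4 1] by simp_all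
  have z: "f \<in> \<phi> -` frobenius_power AA II (2 ^ e)" if "f \<in> P0" for f
  proof -
    have "\<phi> f = \<phi> 0" using that phi_eq_0 by blast
    then show ?thesis using is_idealD(1)[OF J] by simp
  qed
  show "\<phi> ` bracket_ideal (4 * 2 ^ e) \<subseteq> frobenius_power AA II (2 ^ e)"
  proof clarify
    fix f assume "f \<in> bracket_ideal (4 * 2 ^ e)"
    then obtain a b c h where "f = xR ^ (4 * 2 ^ e) * a + yR ^ (4 * 2 ^ e) * b + zR ^ (4 * 2 ^ e) * c + h * gR"
      unfolding bracket_ideal_def by blast
    then have f: "f = a * (xR ^ 4) ^ (2 ^ e) + b * (yR ^ 4) ^ (2 ^ e) + c * (zR ^ 4) ^ (2 ^ e) + h * gR"
      by (simp only: power_mult mult.commute)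
    have "f \<in> \<phi> -` frobenius_power AA II (2 ^ e)"
      unfolding f by (intro is_idealD(2)[OF J] is_idealD(3)[OF J] mem g z) (simp add: P0_def)
    then show "\<phi> f \<in> frobenius_power AA II (2 ^ e)" by simp
  qed
qed

lemma mem_frobenius_power_A: "\<phi> f \<in> frobenius_power AA II (2 ^ e) \<longleftrightarrow> f \<in> bracket_ideal (4 * 2 ^ e)"
proof
  assume "\<phi> f \<in> frobenius_power AA II (2 ^ e)"
  then obtain h where h: "h \<in> bracket_ideal (4 * 2 ^ e)" "\<phi> f = \<phi> h" unfolding frobenius_power_A by auto
  then have "f - h \<in> bracket_ideal (4 * 2 ^ e)" using q_eq[OF q] P0_bracket_ideal by blast
  then have "(f - h) + h \<in> bracket_ideal (4 * 2 ^ e)" using h(1) bracket_ideal_add by blast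
  then show "f \<in> bracket_ideal (4 * 2 ^ e)" by simp
qed (simp add: frobenius_power_A)

lemma tight_closure_A:
  "tight_closure AA II = \<phi> ` {u. \<exists>d. d \<notin> P0 \<and> (\<forall>e. d * u ^ (2 ^ e) \<in> bracket_ideal (4 * 2 ^ e))}"
proof -
  have "\<phi> u \<in> tight_closure AA II \<longleftrightarrow> (\<exists>d. d \<notin> P0 \<and> (\<forall>e. d * u ^ (2 ^ e) \<in> bracket_ideal (4 * 2 ^ e)))" for u
  proof -
    have "\<phi> u \<in> tight_closure AA II \<longleftrightarrow>
      (\<exists>d. \<phi> d \<noteq> \<phi> 0 \<and> (\<forall>e. \<phi> (d * u ^ (2 ^ e)) \<in> frobenius_power AA II (2 ^ e)))"
    proof
      assume "\<exists>d. \<phi> d \<noteq> \<phi> 0 \<and> (\<forall>e. \<phi> (d * u ^ (2 ^ e)) \<in> frobenius_power AA II (2 ^ e))"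
      then obtain d where "\<phi> d \<noteq> \<phi> 0" "\<And>e. \<phi> (d * u ^ (2 ^ e)) \<in> frobenius_power AA II (2 ^ e)" by blast
      then show "\<phi> u \<in> tight_closure AA II"
        unfolding tight_closure_def A_char by (auto simp: A_simps intro!: bexI[of _ "\<phi> d"])
    qed (auto simp: tight_closure_def A_char A_simps)
    then show ?thesis by (simp add: mem_frobenius_power_A phi_eq_0)
  qed
  moreover have "tight_closure AA II \<subseteq> range \<phi>" by (auto simp: tight_closure_def A_simps)
  ultimately show ?thesis by blast
qed

lemma tight_closure_A_ideal: "ideal (tight_closure AA II) AA"
  unfolding tight_closure_A
proof (rule q_ideal_image[OF q])
  show "is_ideal {u. \<exists>d. d \<notin> P0 \<and> (\<forall>e. d * u ^ (2 ^ e) \<in> bracket_ideal (4 * 2 ^ e))}"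
    unfolding is_ideal_def
  proof (intro conjI ballI allI)
    have "1 \<notin> P0" using sR_not_P0[of 1] by (simp add: sR_simps)
    then show "0 \<in> {u. \<exists>d. d \<notin> P0 \<and> (\<forall>e. d * u ^ (2 ^ e) \<in> bracket_ideal (4 * 2 ^ e))}"
      using is_idealD(1)[OF is_ideal_bracket_ideal] by (auto simp: zero_power)
  next
    fix u v assume "u \<in> {u. \<exists>d. d \<notin> P0 \<and> (\<forall>e. d * u ^ (2 ^ e) \<in> bracket_ideal (4 * 2 ^ e))}"
      "v \<in> {u. \<exists>d. d \<notin> P0 \<and> (\<forall>e. d * u ^ (2 ^ e) \<in> bracket_ideal (4 * 2 ^ e))}"
    then obtain c d where c: "c \<notin> P0" "\<And>e. c * u ^ (2 ^ e) \<in> bracket_ideal (4 * 2 ^ e)"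
      and d: "d \<notin> P0" "\<And>e. d * v ^ (2 ^ e) \<in> bracket_ideal (4 * 2 ^ e)" by blast
    have "c * d \<notin> P0" using c(1) d(1) gR_prime unfolding P0_def by blast
    moreover have "(c * d) * (u + v) ^ (2 ^ e) \<in> bracket_ideal (4 * 2 ^ e)" for e
    proof -
      have "(c * d) * (u + v) ^ (2 ^ e) = d * (c * u ^ (2 ^ e)) + c * (d * v ^ (2 ^ e))"
        unfolding char2_power_add by (simp only: distrib_left mult_ac)
      then show ?thesis by (simp only: bracket_ideal_add bracket_ideal_mult c d)
    qed
    ultimately show "u + v \<in> {u. \<exists>d. d \<notin> P0 \<and> (\<forall>e. d * u ^ (2 ^ e) \<in> bracket_ideal (4 * 2 ^ e))}" by blast
  next
    fix u r assume "u \<in> {u. \<exists>d. d \<notin> P0 \<and> (\<forall>e. d * u ^ (2 ^ e) \<in> bracket_ideal (4 * 2 ^ e))}"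
    then obtain c where c: "c \<notin> P0" "\<And>e. c * u ^ (2 ^ e) \<in> bracket_ideal (4 * 2 ^ e)" by blast
    have "c * (r * u) ^ (2 ^ e) \<in> bracket_ideal (4 * 2 ^ e)" for e
      using bracket_ideal_mult[OF c(2), of "r ^ (2 ^ e)" e] by (simp only: power_mult_distrib mult_ac)
    then show "r * u \<in> {u. \<exists>d. d \<notin> P0 \<and> (\<forall>e. d * u ^ (2 ^ e) \<in> bracket_ideal (4 * 2 ^ e))}" using c(1) by blast
  qed
qed

abbreviation "LL \<equiv> localization AA SS"
abbreviation "lfrac \<equiv> fraction AA SS"

lemmas fr_mult = fraction_mult[OF AA.is_cring S_submonoid]
lemmas fr_add = fraction_add[OF AA.is_cring S_submonoid]
lemmas fr_one = localization_one[OF AA.is_cring S_submonoid]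
lemmas fr_zero = localization_zero[OF AA.is_cring S_submonoid]

lemma S_carrier: "s \<in> SS \<Longrightarrow> s \<in> carrier AA" and S_one: "\<one>\<^bsub>AA\<^esub> \<in> SS"
  using submonoid.subset[OF S_submonoid] submonoid.one_closed[OF S_submonoid] by auto

lemma fr_eq:
  assumes "a \<in> carrier AA" "s \<in> SS" "b \<in> carrier AA" "t \<in> SS"
  shows "lfrac a s = lfrac b t \<longleftrightarrow> a \<otimes>\<^bsub>AA\<^esub> t = b \<otimes>\<^bsub>AA\<^esub> s"
proof -
  have "v \<otimes>\<^bsub>AA\<^esub> (a \<otimes>\<^bsub>AA\<^esub> t) = v \<otimes>\<^bsub>AA\<^esub> (b \<otimes>\<^bsub>AA\<^esub> s) \<longleftrightarrow> a \<otimes>\<^bsub>AA\<^esub> t = b \<otimes>\<^bsub>AA\<^esub> s" if "v \<in> SS" for v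
  proof -
    have "v \<noteq> \<zero>\<^bsub>AA\<^esub>" using that S_nonzero by metis
    then show ?thesis using that assms S_carrier by (intro AA.m_lcancel) auto
  qed
  then show ?thesis
    using fraction_eq_iff[OF AA.is_cring S_submonoid assms] S_one by blast
qed

lemma fr_carrier: "a \<in> carrier AA \<Longrightarrow> s \<in> SS \<Longrightarrow> lfrac a s \<in> carrier LL"
  unfolding localization_carrier[OF AA.is_cring S_submonoid] by blast

interpretation LL: cring LL by (rule localization_cring[OF AA.is_cring S_submonoid])

interpretation fr_hom: ring_hom_cring AA LL "\<lambda>a. lfrac a \<one>\<^bsub>AA\<^esub>"
  by (rule ring_hom_cringI[OF AA.is_cring LL.is_cring fraction_hom[OF AA.is_cring S_submonoid]])

lemma L_one_not_zero: "\<one>\<^bsub>LL\<^esub> \<noteq> \<zero>\<^bsub>LL\<^esub>"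
  unfolding fr_one fr_zero fr_eq[OF AA.one_closed S_one AA.zero_closed S_one]
  by (simp only: AA.r_one AA.one_closed AA.zero_closed AA.one_not_zero) simp

lemma L_char: "ring_char LL = 2"
proof (rule ring_char_eq_2[OF LL.ring_axioms L_one_not_zero])
  have "\<one>\<^bsub>AA\<^esub> \<oplus>\<^bsub>AA\<^esub> \<one>\<^bsub>AA\<^esub> = \<zero>\<^bsub>AA\<^esub>" by (simp add: A_simps)
  then show "\<one>\<^bsub>LL\<^esub> \<oplus>\<^bsub>LL\<^esub> \<one>\<^bsub>LL\<^esub> = \<zero>\<^bsub>LL\<^esub>"
    using fr_hom.hom_add[OF AA.one_closed AA.one_closed] by (simp only: fr_hom.hom_one fr_hom.hom_zero)
qed

abbreviation "IIL \<equiv> extended_ideal AA SS II"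

lemma I_carrier: "II \<subseteq> carrier AA" by (auto simp: A_simps)

lemma fr_frobenius_power:
  assumes "a \<in> frobenius_power AA II k"
  shows "lfrac a \<one>\<^bsub>AA\<^esub> \<in> frobenius_power LL IIL k"
proof -
  have imgI: "(\<lambda>a. lfrac a \<one>\<^bsub>AA\<^esub>) ` II \<subseteq> carrier LL" using I_carrier fr_hom.hom_closed by blast
  have IIL: "ideal IIL LL" "(\<lambda>a. lfrac a \<one>\<^bsub>AA\<^esub>) ` II \<subseteq> IIL"
    unfolding extended_ideal_def using LL.genideal_ideal[OF imgI] LL.genideal_self[OF imgI] by auto
  have carr: "{v [^]\<^bsub>LL\<^esub> k |v. v \<in> IIL} \<subseteq> carrier LL"
    using ideal.Icarr[OF IIL(1)] by auto
  have FL: "ideal (frobenius_power LL IIL k) LL" "{v [^]\<^bsub>LL\<^esub> k |v. v \<in> IIL} \<subseteq> frobenius_power LL IIL k"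
    unfolding frobenius_power_def using LL.genideal_ideal[OF carr] LL.genideal_self[OF carr] by auto
  let ?J = "{a \<in> carrier AA. lfrac a \<one>\<^bsub>AA\<^esub> \<in> frobenius_power LL IIL k}"
  have J1: "\<zero>\<^bsub>AA\<^esub> \<in> ?J"
    using additive_subgroup.zero_closed[OF ideal.axioms(1)[OF FL(1)]] by simp
  have J2: "x \<oplus>\<^bsub>AA\<^esub> y \<in> ?J" if "x \<in> ?J" "y \<in> ?J" for x y
    using that additive_subgroup.a_closed[OF ideal.axioms(1)[OF FL(1)]] by simp
  have J3: "r \<otimes>\<^bsub>AA\<^esub> x \<in> ?J" if "x \<in> ?J" "r \<in> carrier AA" for x r
    using that ideal.I_l_closed[OF FL(1)] by simp
  have "ideal ?J AA"
    by (rule cring_idealI[OF AA.is_cring _ J1 J2 J3]) auto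
  moreover have "{v [^]\<^bsub>AA\<^esub> k |v. v \<in> II} \<subseteq> ?J"
  proof (rule subsetI)
    fix x assume "x \<in> {v [^]\<^bsub>AA\<^esub> k |v. v \<in> II}"
    then obtain v where x: "x = v [^]\<^bsub>AA\<^esub> k" and v: "v \<in> II" by blast
    then have "v \<in> carrier AA" using I_carrier by blast
    moreover have "lfrac (v [^]\<^bsub>AA\<^esub> k) \<one>\<^bsub>AA\<^esub> = (lfrac v \<one>\<^bsub>AA\<^esub>) [^]\<^bsub>LL\<^esub> k"
      using fr_hom.ring.hom_nat_pow calculation by simp
    moreover have "lfrac v \<one>\<^bsub>AA\<^esub> \<in> IIL" using IIL(2) v by blast
    ultimately show "x \<in> ?J" using FL(2) unfolding x by auto
  qed
  ultimately have "frobenius_power AA II k \<subseteq> ?J"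
    unfolding frobenius_power_def[of AA] by (rule AA.genideal_minimal)
  then show ?thesis using assms by blast
qed

text \<open>If \<open>s b\<close> is in \<open>I^[q]\<close>, then \<open>b / 1 = (1 / s) (s b / 1)\<close> is in the Frobenius power of the extended ideal.\<close>

lemma u_in_localized_closure: "lfrac (\<phi> uR) \<one>\<^bsub>AA\<^esub> \<in> tight_closure LL IIL"
proof -
  have c: "\<phi> f \<in> carrier AA" for f by (simp add: A_simps)
  have dL: "lfrac (\<phi> dR) \<one>\<^bsub>AA\<^esub> \<noteq> \<zero>\<^bsub>LL\<^esub>"
  proof -
    have "\<phi> dR \<noteq> \<zero>\<^bsub>AA\<^esub>" using dR_not_P0 phi_eq_0 by (simp add: A_simps)
    then show ?thesis
      unfolding fr_zero fr_eq[OF c S_one AA.zero_closed S_one] by (simp only: AA.r_one c AA.zero_closed not_False_eq_True)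
  qed
  have mem: "lfrac (\<phi> dR) \<one>\<^bsub>AA\<^esub> \<otimes>\<^bsub>LL\<^esub> (lfrac (\<phi> uR) \<one>\<^bsub>AA\<^esub>) [^]\<^bsub>LL\<^esub> (2 ^ e :: nat) \<in> frobenius_power LL IIL (2 ^ e)" for e
  proof -
    let ?k = "2 ^ e :: nat"
    define b where "b = dR * uR ^ ?k"
    obtain s where s: "s \<noteq> 0" "sR s * b \<in> bracket_ideal (4 * 2 ^ e)" using in_closure_generic[of e] unfolding b_def dR_def by blast
    have dfr: "lfrac (\<phi> dR) \<one>\<^bsub>AA\<^esub> \<otimes>\<^bsub>LL\<^esub> (lfrac (\<phi> uR) \<one>\<^bsub>AA\<^esub>) [^]\<^bsub>LL\<^esub> ?k = lfrac (\<phi> dR \<otimes>\<^bsub>AA\<^esub> \<phi> uR [^]\<^bsub>AA\<^esub> ?k) \<one>\<^bsub>AA\<^esub>"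
      by (simp only: fr_hom.hom_mult fr_hom.ring.hom_nat_pow c AA.nat_pow_closed)
    have bd: "\<phi> dR \<otimes>\<^bsub>AA\<^esub> \<phi> uR [^]\<^bsub>AA\<^esub> ?k = \<phi> b" by (simp only: b_def A_simps)
    have sS: "\<phi> (sR s) \<in> SS" using s(1) by blast
    have bfr: "lfrac (\<phi> b) \<one>\<^bsub>AA\<^esub> = lfrac \<one>\<^bsub>AA\<^esub> (\<phi> (sR s)) \<otimes>\<^bsub>LL\<^esub> lfrac (\<phi> (sR s * b)) \<one>\<^bsub>AA\<^esub>"
    proof -
      have "lfrac \<one>\<^bsub>AA\<^esub> (\<phi> (sR s)) \<otimes>\<^bsub>LL\<^esub> lfrac (\<phi> (sR s * b)) \<one>\<^bsub>AA\<^esub> = lfrac (\<phi> (sR s * b)) (\<phi> (sR s))"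
        using fr_mult[OF AA.one_closed sS c S_one] S_carrier[OF sS] c by (simp only: AA.l_one AA.r_one)
      also have "\<dots> = lfrac (\<phi> b) \<one>\<^bsub>AA\<^esub>"
        unfolding fr_eq[OF c sS c S_one] by (simp only: A_simps mult.commute mult_1_right mult_1_left)
      finally show ?thesis ..
    qed
    note bfr
    also have "\<dots> \<in> frobenius_power LL IIL ?k"
    proof -
      have imgI: "(\<lambda>a. lfrac a \<one>\<^bsub>AA\<^esub>) ` II \<subseteq> carrier LL" using I_carrier fr_hom.hom_closed by blast
      have IIL: "ideal IIL LL" unfolding extended_ideal_def using LL.genideal_ideal[OF imgI] .
      have "{v [^]\<^bsub>LL\<^esub> ?k |v. v \<in> IIL} \<subseteq> carrier LL" using ideal.Icarr[OF IIL] LL.nat_pow_closed by blast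
      then have "ideal (frobenius_power LL IIL ?k) LL" unfolding frobenius_power_def by (rule LL.genideal_ideal)
      moreover have "lfrac (\<phi> (sR s * b)) \<one>\<^bsub>AA\<^esub> \<in> frobenius_power LL IIL ?k"
        using s(2) by (intro fr_frobenius_power) (simp add: mem_frobenius_power_A)
      moreover have "lfrac \<one>\<^bsub>AA\<^esub> (\<phi> (sR s)) \<in> carrier LL" using fr_carrier[OF AA.one_closed sS] .
      ultimately show ?thesis by (rule ideal.I_l_closed)
    qed
    finally show ?thesis unfolding dfr bd .
  qed
  have cL: "lfrac (\<phi> f) \<one>\<^bsub>AA\<^esub> \<in> carrier LL" for f by (rule fr_carrier[OF c S_one])
  show ?thesis
    unfolding tight_closure_def mem_Collect_eq L_char
  proof (intro conjI bexI[of _ "lfrac (\<phi> dR) \<one>\<^bsub>AA\<^esub>"] allI)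
    show "lfrac (\<phi> dR) \<one>\<^bsub>AA\<^esub> \<in> carrier LL - {\<zero>\<^bsub>LL\<^esub>}" using dL cL by blast
  qed (rule cL, rule mem)
qed

text \<open>The extension of an ideal \<open>T\<close> of \<open>A\<close> consists of fractions with numerator in \<open>T\<close>, so \<open>u / 1\<close> in the extension of the
  tight closure means that \<open>s u\<close> is in the tight closure for some \<open>s\<close> in \<open>S\<close>.\<close>

lemma u_not_in_extended_closure: "lfrac (\<phi> uR) \<one>\<^bsub>AA\<^esub> \<notin> extended_ideal AA SS (tight_closure AA II)"
proof (rule notI)
  assume u: "lfrac (\<phi> uR) \<one>\<^bsub>AA\<^esub> \<in> extended_ideal AA SS (tight_closure AA II)"
  let ?T = "tight_closure AA II"
  note T = tight_closure_A_ideal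
  note Tc = ideal.Icarr[OF T] and T_add = additive_subgroup.a_closed[OF ideal.axioms(1)[OF T]]
    and T_l = ideal.I_l_closed[OF T] and T_r = ideal.I_r_closed[OF T]
  let ?E = "{lfrac a s |a s. a \<in> ?T \<and> s \<in> SS}"
  have Sm: "s \<otimes>\<^bsub>AA\<^esub> t \<in> SS" if "s \<in> SS" "t \<in> SS" for s t
    using submonoid.m_closed[OF S_submonoid that] .
  have "ideal ?E LL"
  proof (rule cring_idealI[OF LL.is_cring])
    show "?E \<subseteq> carrier LL" using fr_carrier Tc by blast
    have "\<zero>\<^bsub>AA\<^esub> \<in> ?T" by (rule additive_subgroup.zero_closed[OF ideal.axioms(1)[OF tight_closure_A_ideal]])
    then show "\<zero>\<^bsub>LL\<^esub> \<in> ?E" unfolding fr_zero using S_one by blast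
  next
    fix x y assume "x \<in> ?E" "y \<in> ?E"
    then obtain a s b t where ab: "x = lfrac a s" "y = lfrac b t" "a \<in> ?T" "s \<in> SS" "b \<in> ?T" "t \<in> SS" by blast
    have "x \<oplus>\<^bsub>LL\<^esub> y = lfrac (a \<otimes>\<^bsub>AA\<^esub> t \<oplus>\<^bsub>AA\<^esub> b \<otimes>\<^bsub>AA\<^esub> s) (s \<otimes>\<^bsub>AA\<^esub> t)"
      unfolding ab(1,2) by (intro fr_add ab Tc)
    moreover have "a \<otimes>\<^bsub>AA\<^esub> t \<oplus>\<^bsub>AA\<^esub> b \<otimes>\<^bsub>AA\<^esub> s \<in> ?T"
      by (intro T_add T_r ab S_carrier)
    ultimately show "x \<oplus>\<^bsub>LL\<^esub> y \<in> ?E" using Sm[OF ab(4,6)] by blast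
  next
    fix x r assume "x \<in> ?E" "r \<in> carrier LL"
    then obtain a s b t where ab: "x = lfrac a s" "r = lfrac b t" "a \<in> ?T" "s \<in> SS" "b \<in> carrier AA" "t \<in> SS"
      unfolding localization_carrier[OF AA.is_cring S_submonoid] by blast
    have "r \<otimes>\<^bsub>LL\<^esub> x = lfrac (b \<otimes>\<^bsub>AA\<^esub> a) (t \<otimes>\<^bsub>AA\<^esub> s)"
      unfolding ab(1,2) by (intro fr_mult ab Tc)
    moreover have "b \<otimes>\<^bsub>AA\<^esub> a \<in> ?T" by (intro T_l ab)
    ultimately show "r \<otimes>\<^bsub>LL\<^esub> x \<in> ?E" using Sm[OF ab(6,4)] by blast
  qed
  moreover have "(\<lambda>a. lfrac a \<one>\<^bsub>AA\<^esub>) ` ?T \<subseteq> ?E" using S_one by blast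
  ultimately have "extended_ideal AA SS ?T \<subseteq> ?E" unfolding extended_ideal_def by (rule LL.genideal_minimal)
  then obtain a s where as: "lfrac (\<phi> uR) \<one>\<^bsub>AA\<^esub> = lfrac a s" "a \<in> ?T" "s \<in> SS" using u by blast
  have c: "\<phi> f \<in> carrier AA" for f by (simp add: A_simps)
  obtain s' where s': "s' \<noteq> 0" "s = \<phi> (sR s')" using as(3) by blast
  have "\<phi> uR \<otimes>\<^bsub>AA\<^esub> s = a \<otimes>\<^bsub>AA\<^esub> \<one>\<^bsub>AA\<^esub>" using as fr_eq[OF c S_one Tc[OF as(2)] as(3)] by blast
  then have "\<phi> uR \<otimes>\<^bsub>AA\<^esub> s = a" by (simp only: AA.r_one[OF Tc[OF as(2)]])
  then have "\<phi> (sR s' * uR) = a" unfolding s'(2) by (simp only: A_simps mult.commute)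
  then obtain v d where v: "\<phi> (sR s' * uR) = \<phi> v" "d \<notin> P0" "\<And>e. d * v ^ (2 ^ e) \<in> bracket_ideal (4 * 2 ^ e)"
    using as(2) unfolding tight_closure_A by auto
  have "d * (sR s' * uR) ^ (2 ^ e) \<in> bracket_ideal (4 * 2 ^ e)" for e
  proof -
    have "\<phi> (d * (sR s' * uR) ^ (2 ^ e)) = \<phi> d \<otimes>\<^bsub>AA\<^esub> \<phi> (sR s' * uR) [^]\<^bsub>AA\<^esub> (2 ^ e :: nat)" by (simp add: A_simps)
    also have "\<dots> = \<phi> (d * v ^ (2 ^ e))" unfolding v(1) by (simp add: A_simps)
    finally show ?thesis using v(3) mem_frobenius_power_A by metis
  qed
  moreover have "\<not> gR dvd d" using v(2) by (simp add: P0_def)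
  ultimately show False using not_in_closure_generic s'(1) by blast
qed

end

theorem mainTheorem1:
  shows "\<exists>(A :: nat ring) (p :: nat) (I :: nat set) (S :: nat set).
    noetherian_domain A \<and> Factorial_Ring.prime p \<and> ring_char A = p \<and>
    ideal I A \<and> submonoid S A \<and> \<zero>\<^bsub>A\<^esub> \<notin> S \<and>
    tight_closure (localization A S) (extended_ideal A S I)
      \<noteq> extended_ideal A S (tight_closure A I)"
proof -
  obtain \<phi> :: "ambient \<Rightarrow> nat" where q: "quotient_map \<phi> P0"
    using quotient_map_exists[OF is_ideal_P0] by blast
  show ?thesis
  proof (intro exI conjI)
    show "noetherian_domain (quotient_ring \<phi>)" by (rule A_noetherian_domain[OF q])
    show "Factorial_Ring.prime (2 :: nat)" by (rule two_is_prime_nat)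
    show "ring_char (quotient_ring \<phi>) = 2" by (rule A_char[OF q])
    show "ideal (\<phi> ` bracket_ideal 4) (quotient_ring \<phi>)" by (rule I_ideal[OF q])
    show "submonoid ((\<lambda>s. \<phi> (sR s)) ` {s. s \<noteq> 0}) (quotient_ring \<phi>)" by (rule S_submonoid[OF q])
    show "\<zero>\<^bsub>quotient_ring \<phi>\<^esub> \<notin> (\<lambda>s. \<phi> (sR s)) ` {s. s \<noteq> 0}" by (rule S_nonzero[OF q])
    show "tight_closure (localization (quotient_ring \<phi>) ((\<lambda>s. \<phi> (sR s)) ` {s. s \<noteq> 0}))
        (extended_ideal (quotient_ring \<phi>) ((\<lambda>s. \<phi> (sR s)) ` {s. s \<noteq> 0}) (\<phi> ` bracket_ideal 4)) \<noteq>
      extended_ideal (quotient_ring \<phi>) ((\<lambda>s. \<phi> (sR s)) ` {s. s \<noteq> 0}) (tight_closure (quotient_ring \<phi>) (\<phi> ` bracket_ideal 4))"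
      using u_in_localized_closure[OF q] u_not_in_extended_closure[OF q] by metis
  qed
qed

end
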